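(* Let $(a,b)\subset\mathbb{R}$ be a finite interval, let $m,r,l\ge 1$ and $n\ge 0$ be integers, and let $1\le p\le\infty$. Let $A_{0},\dots,A_{r-1}\in (W_p^{n})^{m\times m}$, let $B\colon (W_p^{n+r})^m\to\mathbb{C}^l$ be a continuous linear operator, and let $$(Ly)(t):=y^{(r)}(t)+\sum_{j=1}^{r}A_{r-j}(t)\,y^{(r-j)}(t),\qquad t\in(a,b).$$ Let $M(L,B)\in\mathbb{C}^{l\times mr}$ be the characteristic matrix of $(L,B)$. Then the dimensions of the kernel and cokernel of the operator $$(L,B)\colon (W_p^{n+r})^m\to (W_p^{n})^m\times\mathbb{C}^l,\qquad y\mapsto (Ly,By),$$ are equal to the dimensions of the kernel and cokernel of the matrix $M(L,B)$, respectively.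
   Context: For an integer $s\ge 1$, $W_p^{s}=W_p^{s}([a,b];\mathbb{C})$ is the complex Sobolev space $\{y\in C^{s-1}[a,b] : y^{(s-1)}\in AC[a,b],\ y^{(s)}\in L_p[a,b]\}$, and $W_p^0:=L_p$. It is a Banach space with norm $\|y\|_{s,p}=\sum_{k=0}^{s}\|y^{(k)}\|_p$, where $\|\cdot\|_p$ is the norm in $L_p([a,b];\mathbb{C})$. $(W_p^s)^m:=W_p^s([a,b];\mathbb{C}^m)$ and $(W_p^s)^{m\times m}:=W_p^s([a,b];\mathbb{C}^{m\times m})$ are the Sobolev spaces of vector-valued (column) functions and matrix-valued functions with entries in $W_p^s$, with the analogous norms. Characteristic matrix: for each $k\in\{1,\dots,r\}$ let $Y_k\in(W_p^{n+r})^{m\times m}$ be the unique solution of the matrix Cauchy problem $$Y_k^{(r)}(t)+\sum_{j=1}^{r}A_{r-j}(t)Y_k^{(r-j)}(t)=O_m,\quad t\in(a,b),\qquad Y_k^{(j-1)}(a)=\delta_{k,j}I_m,\quad j\in\{1,\dots,r\},$$ where $O_m$ and $I_m$ are the zero and identity $m\times m$ matrices and $\delta_{k,j}$ is the Kronecker symbol. Let $[BY_k]\in\mathbb{C}^{l\times m}$ be the matrix whose $j$-th column is the result of applying $B$ to the $j$-th column of $Y_k$. Then $$M(L,B):=\big([BY_1],\dots,[BY_r]\big)\in\mathbb{C}^{l\times mr}.$$ The kernel and cokernel of $M(L,B)$ are those of the linear map $\mathbb{C}^{mr}\to\mathbb{C}^{l}$ it defines. The cokernel of an operator $T\colon X\to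 Y$ is $Y/T(X)$. *)

theory Defs
  imports
    "HOL-Analysis.Analysis"
    "HOL-Probability.Essential_Supremum"
    "HOL-Algebra.AbelCoset"
    "Jordan_Normal_Form.Missing_VectorSpace"
begin

section \<open>Complex vector spaces, kernels and cokernels\<close>

definition complex_field :: "complex ring" where
  "complex_field = \<lparr>carrier = UNIV, mult = (*), one = 1, zero = 0, add = (+)\<rparr>"

text \<open>The fields \<open>mult\<close> and \<open>one\<close> of a \<open>module\<close> record play no role in a vector space.\<close>

definition coord_space :: "(complex, complex ^ 'k) module" where
  "coord_space = \<lparr>carrier = UNIV, mult = (\<lambda>_ _. 0), one = 0, zero = 0, add = (+),
     smult = (\<lambda>c v. c *s v)\<rparr>"

lemma field_complex_field: "field complex_field"
proof (rule cring.cring_fieldI2)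
  show "cring complex_field"
  proof (rule cringI)
    show "abelian_group complex_field"
    proof (rule abelian_groupI)
      fix x :: complex
      show "\<exists>y\<in>carrier complex_field. y \<oplus>\<^bsub>complex_field\<^esub> x = \<zero>\<^bsub>complex_field\<^esub>"
        by (rule bexI[of _ "- x"]) (simp_all add: complex_field_def)
    qed (simp_all add: complex_field_def)
    show "Group.comm_monoid complex_field"
      by (rule comm_monoidI) (simp_all add: complex_field_def)
  qed (simp_all add: complex_field_def distrib_right)
  show "\<zero>\<^bsub>complex_field\<^esub> \<noteq> \<one>\<^bsub>complex_field\<^esub>" by (simp add: complex_field_def)
  show "\<And>a. a \<in> carrier complex_field \<Longrightarrow> a \<noteq> \<zero>\<^bsub>complex_field\<^esub> \<Longrightarrow>
      \<exists>b\<in>carrier complex_field. a \<otimes>\<^bsub>complex_field\<^esub> b = \<one>\<^bsub>complex_field\<^esub>"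
    by (auto simp: complex_field_def intro: right_inverse)
qed

text \<open>The quotient of a vector space \<open>V\<close> by a subspace \<open>U\<close>, carried by the additive cosets of \<open>U\<close>.
  In \<open>smult\<close> the union adds \<open>U\<close> back, so that multiplication by \<open>0\<close> yields the coset \<open>U\<close>
  and not \<open>{0}\<close>.\<close>

definition quotient_space :: "('k, 'v) module \<Rightarrow> 'v set \<Rightarrow> ('k, 'v set) module" where
  "quotient_space V U = \<lparr>carrier = a_rcosets\<^bsub>V\<^esub> U, mult = (\<lambda>_ _. U), one = U, zero = U,
     add = set_add V, smult = (\<lambda>c S. \<Union>x\<in>S. U +>\<^bsub>V\<^esub> (c \<odot>\<^bsub>V\<^esub> x))\<rparr>"

definition kernel_space ::
    "('k, 'v) module \<Rightarrow> ('k, 'w) module \<Rightarrow> ('v \<Rightarrow> 'w) \<Rightarrow> ('k, 'v) module" where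
  "kernel_space V W T = V\<lparr>carrier := mod_hom.ker V W T\<rparr>"

definition cokernel_space ::
    "('k, 'v) module \<Rightarrow> ('k, 'w) module \<Rightarrow> ('v \<Rightarrow> 'w) \<Rightarrow> ('k, 'w set) module" where
  "cokernel_space V W T = quotient_space W (mod_hom.im V T)"


section \<open>Sobolev spaces on an interval\<close>

text \<open>A function on \<open>[a,b]\<close> is represented by its extension by \<open>0\<close> to the real line, so that
  functions equal on \<open>[a,b]\<close> are equal. Derivatives are one-sided at \<open>a\<close> and \<open>b\<close>.
  Where \<open>f\<close> is not differentiable, \<open>vector_derivative\<close> has an unspecified value; below, this
  happens only on null sets.\<close>

definition deriv_on :: "real \<Rightarrow> real \<Rightarrow> (real \<Rightarrow> 'v::real_normed_vector) \<Rightarrow> real \<Rightarrow> 'v" where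
  "deriv_on a b f = (\<lambda>t. if t \<in> {a..b} then vector_derivative f (at t within {a..b}) else 0)"

definition nth_deriv ::
    "real \<Rightarrow> real \<Rightarrow> nat \<Rightarrow> (real \<Rightarrow> 'v::real_normed_vector) \<Rightarrow> real \<Rightarrow> 'v" where
  "nth_deriv a b k f = (deriv_on a b ^^ k) f"

definition Lp_fun :: "ennreal \<Rightarrow> real \<Rightarrow> real \<Rightarrow> (real \<Rightarrow> 'v::real_normed_vector) \<Rightarrow> bool" where
  "Lp_fun p a b f \<longleftrightarrow> f \<in> borel_measurable (lebesgue_on {a..b}) \<and>
     (if p = \<infinity> then esssup (lebesgue_on {a..b}) (\<lambda>t. ennreal (norm (f t))) < \<infinity>
      else integrable (lebesgue_on {a..b}) (\<lambda>t. norm (f t) powr enn2real p))"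

definition Lp_norm :: "ennreal \<Rightarrow> real \<Rightarrow> real \<Rightarrow> (real \<Rightarrow> 'v::real_normed_vector) \<Rightarrow> real" where
  "Lp_norm p a b f =
     (if p = \<infinity> then enn2real (esssup (lebesgue_on {a..b}) (\<lambda>t. ennreal (norm (f t))))
      else (\<integral>t. norm (f t) powr enn2real p \<partial>lebesgue_on {a..b}) powr (1 / enn2real p))"

definition abs_continuous_on ::
    "real \<Rightarrow> real \<Rightarrow> (real \<Rightarrow> 'v::real_normed_vector) \<Rightarrow> bool" where
  "abs_continuous_on a b f \<longleftrightarrow>
     (\<forall>\<epsilon>>0. \<exists>\<delta>>0. \<forall>d. d division_of \<Union>d \<longrightarrow> \<Union>d \<subseteq> {a..b} \<longrightarrow> (\<Sum>I\<in>d. measure lborel I) < \<delta> \<longrightarrow>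
        (\<Sum>I\<in>d. norm (f (Sup I) - f (Inf I))) < \<epsilon>)"

text \<open>For \<open>s = 0\<close> the members are representatives of the elements of \<open>L\<^sub>p\<close>. For \<open>s > 0\<close>,
  the a.e. differentiability of the derivative of order \<open>s - 1\<close> is what makes the derivative of
  order \<open>s\<close> meaningful; it also follows from absolute continuity.\<close>

definition sobolev_fun ::
    "ennreal \<Rightarrow> nat \<Rightarrow> real \<Rightarrow> real \<Rightarrow> (real \<Rightarrow> 'v::real_normed_vector) set" where
  "sobolev_fun p s a b = {y.
     (\<forall>t. t \<notin> {a..b} \<longrightarrow> y t = 0) \<and>
     (\<forall>k<s. continuous_on {a..b} (nth_deriv a b k y)) \<and>
     (\<forall>k. Suc k < s \<longrightarrow> (\<forall>t\<in>{a..b}. nth_deriv a b k y differentiable (at t within {a..b}))) \<and>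
     (0 < s \<longrightarrow> abs_continuous_on a b (nth_deriv a b (s - 1) y) \<and>
        (AE t in lebesgue_on {a..b}.
           nth_deriv a b (s - 1) y differentiable (at t within {a..b}))) \<and>
     Lp_fun p a b (nth_deriv a b s y)}"

definition sobolev_norm ::
    "ennreal \<Rightarrow> nat \<Rightarrow> real \<Rightarrow> real \<Rightarrow> (real \<Rightarrow> 'v::real_normed_vector) \<Rightarrow> real" where
  "sobolev_norm p s a b y = (\<Sum>k\<le>s. Lp_norm p a b (nth_deriv a b k y))"

definition sobolev_fun_space ::
    "ennreal \<Rightarrow> nat \<Rightarrow> real \<Rightarrow> real \<Rightarrow> (complex, real \<Rightarrow> complex ^ 'm) module" where
  "sobolev_fun_space p s a b = \<lparr>carrier = sobolev_fun p s a b, mult = (\<lambda>_ _ _. 0), one = (\<lambda>_. 0),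
     zero = (\<lambda>_. 0), add = (\<lambda>f g t. f t + g t), smult = (\<lambda>c f t. c *s f t)\<rparr>"

definition null_fun :: "ennreal \<Rightarrow> nat \<Rightarrow> real \<Rightarrow> real \<Rightarrow> (real \<Rightarrow> complex ^ 'm) set" where
  "null_fun p s a b = {f \<in> sobolev_fun p s a b. AE t in lebesgue_on {a..b}. f t = 0}"

text \<open>For \<open>s = 0\<close> this is \<open>L\<^sub>p\<close> with its classes of a.e. equal functions. For \<open>s > 0\<close> the
  functions are continuous and every class is a singleton.\<close>

definition sobolev_space ::
    "ennreal \<Rightarrow> nat \<Rightarrow> real \<Rightarrow> real \<Rightarrow> (complex, (real \<Rightarrow> complex ^ 'm) set) module" where
  "sobolev_space p s a b = quotient_space (sobolev_fun_space p s a b) (null_fun p s a b)"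

definition sobolev_continuous ::
    "ennreal \<Rightarrow> nat \<Rightarrow> real \<Rightarrow> real \<Rightarrow> ((real \<Rightarrow> complex ^ 'm) \<Rightarrow> complex ^ 'l) \<Rightarrow> bool" where
  "sobolev_continuous p s a b B \<longleftrightarrow>
     (\<forall>y\<in>sobolev_fun p s a b. \<forall>\<epsilon>>0. \<exists>\<delta>>0. \<forall>z\<in>sobolev_fun p s a b.
        sobolev_norm p s a b (\<lambda>t. z t - y t) < \<delta> \<longrightarrow> norm (B z - B y) < \<epsilon>)"


section \<open>The boundary-value problem and its characteristic matrix\<close>

definition diff_op ::
    "nat \<Rightarrow> real \<Rightarrow> real \<Rightarrow> (nat \<Rightarrow> real \<Rightarrow> complex ^ 'm ^ 'm) \<Rightarrow>
     (real \<Rightarrow> complex ^ 'm) \<Rightarrow> real \<Rightarrow> complex ^ 'm" where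
  "diff_op r a b A y = (\<lambda>t. nth_deriv a b r y t +
     (\<Sum>j = 1..r. A (r - j) t *v nth_deriv a b (r - j) y t))"

text \<open>The operator \<open>(L,B)\<close>; \<open>L y\<close> is the coset of \<open>diff_op r a b A y\<close>.\<close>

definition bvp_op ::
    "ennreal \<Rightarrow> nat \<Rightarrow> nat \<Rightarrow> real \<Rightarrow> real \<Rightarrow> (nat \<Rightarrow> real \<Rightarrow> complex ^ 'm ^ 'm) \<Rightarrow>
     ((real \<Rightarrow> complex ^ 'm) \<Rightarrow> complex ^ 'l) \<Rightarrow>
     (real \<Rightarrow> complex ^ 'm) \<Rightarrow> (real \<Rightarrow> complex ^ 'm) set \<times> (complex ^ 'l)" where
  "bvp_op p n r a b A B y =
     (null_fun p n a b +>\<^bsub>sobolev_fun_space p n a b\<^esub> diff_op r a b A y, B y)"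

text \<open>The differential equation is required a.e., as it must be for \<open>n = 0\<close>; for \<open>n > 0\<close> all
  its terms are continuous.\<close>

definition cauchy_solution ::
    "ennreal \<Rightarrow> nat \<Rightarrow> nat \<Rightarrow> real \<Rightarrow> real \<Rightarrow> (nat \<Rightarrow> real \<Rightarrow> complex ^ 'm ^ 'm) \<Rightarrow>
     nat \<Rightarrow> real \<Rightarrow> complex ^ 'm ^ 'm" where
  "cauchy_solution p n r a b A k = (THE Y. Y \<in> sobolev_fun p (n + r) a b \<and>
     (AE t in lebesgue_on {a..b}. nth_deriv a b r Y t +
        (\<Sum>j = 1..r. A (r - j) t ** nth_deriv a b (r - j) Y t) = 0) \<and>
     (\<forall>j\<in>{1..r}. nth_deriv a b (j - 1) Y a = (if k = j then mat 1 else 0)))"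

text \<open>The columns are indexed by pairs of a block and a column within the block; \<open>blk\<close> enumerates
  the \<open>r\<close> blocks, block \<open>\<rho>\<close> being \<open>[B Y\<^sub>k]\<close> for \<open>k = blk \<rho>\<close>.\<close>

definition char_matrix ::
    "('r::finite \<Rightarrow> nat) \<Rightarrow> ennreal \<Rightarrow> nat \<Rightarrow> nat \<Rightarrow> real \<Rightarrow> real \<Rightarrow>
     (nat \<Rightarrow> real \<Rightarrow> complex ^ 'm ^ 'm) \<Rightarrow>
     ((real \<Rightarrow> complex ^ 'm) \<Rightarrow> complex ^ 'l) \<Rightarrow> complex ^ ('r \<times> 'm) ^ 'l" where
  "char_matrix blk p n r a b A B =
     (\<chi> q. \<chi> c. B (\<lambda>t. column (snd c) (cauchy_solution p n r a b A (blk (fst c)) t)) $ q)"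

end

theory Submission
  imports Defs
begin

text \<open>Write \<open>\<Lambda> y\<close> for the class of \<open>L y\<close> in \<open>W\<^sub>p\<^sup>n\<close>. The theorem is linear algebra once two facts about the
  differential equation are known: \<open>\<Lambda>\<close> maps \<open>W\<^sub>p\<^sup>n\<^sup>+\<^sup>r\<close> onto \<open>W\<^sub>p\<^sup>n\<close>, and its kernel is parametrized
  bijectively by the initial values, \<open>c \<mapsto> S c = \<Sum>\<^sub>k Y\<^sub>k c\<^sub>k\<close>. Indeed \<open>B \<circ> S\<close> is multiplication by the
  characteristic matrix \<open>M\<close>. So \<open>S\<close> restricts to an isomorphism from the kernel of \<open>M\<close> onto the
  kernel of \<open>(L,B)\<close>. As \<open>\<Lambda>\<close> is onto, every class of the cokernel of \<open>(L,B)\<close> contains a pair \<open>(0,w)\<close>,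
  and \<open>(0,w)\<close> lies in the range of \<open>(L,B)\<close> exactly if \<open>w = B y\<close> for some \<open>y\<close> with \<open>\<Lambda> y = 0\<close>, that is,
  if \<open>w\<close> lies in the range of \<open>M\<close>. This is \<open>kernel_cokernel_of_pair\<close>, which argues with
  rank and nullity instead of constructing the isomorphism of the cokernels.

  Both facts about the equation are existence and uniqueness for the Cauchy problem
  (\<open>cauchy_problem_exists\<close>, \<open>cauchy_problem_unique\<close>). An equation of order \<open>r\<close> is a first-order
  system for \<open>(y, y', \<dots>, y\<^sup>(\<^sup>r\<^sup>-\<^sup>1\<^sup>))\<close>, and a first-order system with integrable coefficients is a
  Volterra integral equation, whose operator is a contraction in a suitably weighted supremum norm.
  Passing between the differential and the integral form needs the fundamental theorem of
  calculus for absolutely continuous functions in both directions; one direction is Lebesgue's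
  differentiation theorem. If \<open>n > 0\<close>, the equation itself yields the additional
  smoothness of the solution, because \<open>W\<^sub>p\<^sup>s\<close> is an algebra for \<open>s > 0\<close>.

  The Sobolev spaces are handled through one recursion: \<open>y\<close> is in \<open>W\<^sub>p\<^sup>s\<^sup>+\<^sup>1\<close> exactly if it is a
  primitive of a member of \<open>W\<^sub>p\<^sup>s\<close> (\<open>sobolev_fun_primitive\<close>, \<open>primitive_sobolev_fun\<close>).\<close>

section \<open>Absolutely continuous functions and their primitives\<close>

text \<open>A gauge argument. Tags outside \<open>N\<close> contribute little because \<open>f\<close> is differentiable there; the
  intervals with tags in \<open>N\<close> can be forced into an open set of small measure, where absolute
  continuity bounds the total increment of \<open>f\<close>. The Henstock-Kurzweil integral yields the
  integrability of \<open>f'\<close> along with the value of the integral.\<close>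

lemma abs_continuous_on_ftc:
  fixes f :: "real \<Rightarrow> 'v::euclidean_space"
  assumes ab: "a \<le> b" and ac: "abs_continuous_on a b f" and N: "negligible N"
    and der: "\<And>t. t \<in> {a..b} - N \<Longrightarrow> (f has_vector_derivative f' t) (at t within {a..b})"
  shows "(f' has_integral (f b - f a)) {a..b}"
proof -
  define g where "g t = (if t \<in> N then 0 else f' t)" for t
  have "(g has_integral (f b - f a)) (cbox a b)"
    unfolding has_integral
  proof (intro allI impI)
    fix e :: real assume e: "e > 0"
    \<comment> \<open>Half of \<open>e\<close> is for the tags outside \<open>N\<close>; the 1 only avoids division by 0.\<close>
    define e1 where "e1 = e / (2 * (b - a + 1))"
    have e1: "e1 > 0" using e ab by (simp add: e1_def)
    obtain \<delta> where \<delta>: "\<delta> > 0" and ac\<delta>: "\<And>d. d division_of \<Union>d \<Longrightarrow> \<Union>d \<subseteq> {a..b} \<Longrightarrow>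
        (\<Sum>I\<in>d. measure lborel I) < \<delta> \<Longrightarrow> (\<Sum>I\<in>d. norm (f (Sup I) - f (Inf I))) < e/2"
      using ac[unfolded abs_continuous_on_def, rule_format, of "e/2"] e by auto
    have Nnull: "N \<in> null_sets lebesgue" using N negligible_iff_null_sets by blast
    then obtain U where U: "open U" "N \<subseteq> U" "U - N \<in> lmeasurable" "emeasure lebesgue (U - N) < ennreal \<delta>"
      using sets_lebesgue_outer_open[of N \<delta>] \<delta> by (metis null_setsD2)
    have emU: "emeasure lebesgue U = emeasure lebesgue (U - N)"
      using emeasure_Diff_null_set[OF Nnull, of U] U(1) by (simp add: borel_open)
    have Um: "U \<in> lmeasurable"
      using U(1) order_less_trans[OF U(4) ennreal_less_top] emU by (intro fmeasurableI) auto
    have mU: "measure lebesgue U < \<delta>"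
      using U(4) Um \<delta> unfolding emU[symmetric] by (simp add: emeasure_eq_measure2 ennreal_less_iff)
    have "\<forall>x. \<exists>d>0. x \<in> {a..b} - N \<longrightarrow>
         (\<forall>y\<in>{a..b}. norm (y-x) < d \<longrightarrow> norm (f y - f x - (y-x) *\<^sub>R f' x) \<le> e1 * norm (y-x))"
      using der e1 unfolding has_vector_derivative_def has_derivative_within_alt
      by blast
    then obtain d where d: "\<And>x. 0 < d x"
      "\<And>x y. \<lbrakk>x \<in> {a..b} - N; y \<in> {a..b}; norm (y-x) < d x\<rbrakk>
          \<Longrightarrow> norm (f y - f x - (y-x) *\<^sub>R f' x) \<le> e1 * norm (y-x)"
      by metis
    \<comment> \<open>An interval with its tag in \<open>N\<close> is confined to \<open>U\<close>, whose measure is less than \<open>\<delta>\<close>.\<close>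
    define \<gamma> where "\<gamma> x = (if x \<in> N then U else ball x (d x))" for x
    have gau: "gauge \<gamma>" using U d(1) by (auto simp: gauge_def \<gamma>_def)
    have main: "norm ((\<Sum>(x, K)\<in>p. measure lborel K *\<^sub>R g x) - (f b - f a)) < e"
      if ptag: "p tagged_division_of (cbox a b)" and fine: "\<gamma> fine p" for p
    proof -
      have fp: "finite p" using ptag by blast
      have ba: "b - a = (\<Sum>(x,K)\<in>p. Sup K - Inf K)" "f b - f a = (\<Sum>(x,K)\<in>p. f(Sup K) - f(Inf K))"
        using additive_tagged_division_1[where f= "\<lambda>x. x"] additive_tagged_division_1[where f= f] ab ptag
        by auto
      define pN where "pN = {q\<in>p. fst q \<in> N}"
      define pG where "pG = {q\<in>p. fst q \<notin> N}"
      have shape: "\<exists>u v. K = {u..v} \<and> u \<le> v \<and> x \<in> K \<and> K \<subseteq> {a..b} \<and> K \<subseteq> \<gamma> x" if xK: "(x,K) \<in> p" for x K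
      proof -
        obtain u v where "K = cbox u v" using tagged_division_ofD(4)[OF ptag xK] by blast
        then show ?thesis
          using tagged_division_ofD(2,3)[OF ptag xK] fineD[OF fine xK]
          by (intro exI[of _ u] exI[of _ v]) (auto simp: box_real)
      qed
      have split: "(\<Sum>(x, K)\<in>p. measure lborel K *\<^sub>R g x) - (f b - f a)
          = (\<Sum>(x, K)\<in>pG. measure lborel K *\<^sub>R g x - (f(Sup K) - f(Inf K))) - (\<Sum>(x, K)\<in>pN. f(Sup K) - f(Inf K))"
      proof -
        have p: "p = pG \<union> pN" "pG \<inter> pN = {}" "finite pG" "finite pN"
          using fp by (auto simp: pG_def pN_def)
        have z: "(\<Sum>(x, K)\<in>pN. measure lborel K *\<^sub>R g x) = 0"
          by (rule sum.neutral) (auto simp: pN_def g_def)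
        have "(\<Sum>(x, K)\<in>p. measure lborel K *\<^sub>R g x) = (\<Sum>(x, K)\<in>pG. measure lborel K *\<^sub>R g x)"
          by (subst p(1)) (simp add: sum.union_disjoint[OF p(3,4,2)] z)
        moreover have "f b - f a = (\<Sum>(x,K)\<in>pG. f(Sup K) - f(Inf K)) + (\<Sum>(x,K)\<in>pN. f(Sup K) - f(Inf K))"
          unfolding ba(2) by (subst p(1)) (rule sum.union_disjoint[OF p(3,4,2)])
        ultimately show ?thesis by (simp add: sum_subtractf split_def)
      qed
      have G: "norm (\<Sum>(x, K)\<in>pG. measure lborel K *\<^sub>R g x - (f(Sup K) - f(Inf K))) \<le> (\<Sum>(x,K)\<in>pG. e1 * (Sup K - Inf K))"
      proof (rule sum_norm_le, clarify)
        fix x K assume xK: "(x,K) \<in> pG"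
        then obtain u v where k: "K = {u..v}" "u \<le> v" "x \<in> K" "K \<subseteq> {a..b}" "K \<subseteq> ball x (d x)"
          using shape[of x K] by (auto simp: pG_def \<gamma>_def)
        have xN: "x \<in> {a..b} - N" using xK k by (auto simp: pG_def)
        have g: "g x = f' x" using xN by (simp add: g_def)
        have "u \<in> K" "v \<in> K" using k(1,2) by auto
        then have "u \<in> ball x (d x)" "v \<in> ball x (d x)" "u \<in> {a..b}" "v \<in> {a..b}"
          using k(4,5) by blast+
        then have du: "norm (u - x) < d x" "norm (v - x) < d x" "u \<in> {a..b}" "v \<in> {a..b}"
          by (simp_all add: dist_norm norm_minus_commute)
        have "norm ((v - u) *\<^sub>R f' x - (f v - f u)) = norm ((f u - f x - (u - x) *\<^sub>R f' x) - (f v - f x - (v - x) *\<^sub>R f' x))"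
          by (auto simp: algebra_simps)
        also have "\<dots> \<le> norm (f u - f x - (u - x) *\<^sub>R f' x) + norm (f v - f x - (v - x) *\<^sub>R f' x)"
          by (rule norm_triangle_ineq4)
        also have "\<dots> \<le> e1 * norm (u - x) + e1 * norm (v - x)"
          using d(2)[OF xN] du by (intro add_mono) auto
        also have "\<dots> = e1 * (v - u)" using k by (auto simp: algebra_simps)
        finally show "norm (measure lborel K *\<^sub>R g x - (f(Sup K) - f(Inf K))) \<le> e1 * (Sup K - Inf K)"
          using k g by simp
      qed
      also have "\<dots> \<le> (\<Sum>(x,K)\<in>p. e1 * (Sup K - Inf K))"
        using fp e1 by (intro sum_mono2) (auto simp: pG_def dest: shape)
      also have "\<dots> = e1 * (b - a)" unfolding ba(1) by (simp add: sum_distrib_left split_def)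
      also have "\<dots> \<le> e / 2" using ab e by (simp add: e1_def field_simps)
      finally have G': "norm (\<Sum>(x, K)\<in>pG. measure lborel K *\<^sub>R g x - (f(Sup K) - f(Inf K))) \<le> e/2" .
      have pNtag: "pN tagged_partial_division_of (cbox a b)"
        using ptag by (auto simp: pN_def tagged_division_of_def intro: tagged_partial_division_subset)
      define D where "D = snd ` pN"
      have D: "D division_of \<Union>D" unfolding D_def by (rule partial_division_of_tagged_division[OF pNtag])
      have DU: "\<Union>D \<subseteq> U" "\<Union>D \<subseteq> {a..b}"
        using shape unfolding D_def pN_def by (force simp: \<gamma>_def)+
      have "(\<Sum>I\<in>D. measure lborel I) = (\<Sum>I\<in>D. measure lebesgue I)"
        using division_ofD(4)[OF D] by (intro sum.cong refl) fastforce
      also have "\<dots> = measure lebesgue (\<Union>D)" by (rule content_division[OF D])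
      also have "\<dots> \<le> measure lebesgue U"
        using DU(1) Um lmeasurable_division[OF D] by (intro measure_mono_fmeasurable) auto
      finally have "(\<Sum>I\<in>D. norm (f (Sup I) - f (Inf I))) < e/2"
        using ac\<delta>[OF D DU(2)] mU by simp
      moreover have "(\<Sum>(x,K)\<in>pN. norm (f (Sup K) - f (Inf K))) = (\<Sum>I\<in>D. norm (f (Sup I) - f (Inf I)))"
      proof -
        \<comment> \<open>The summand is made 0 on the empty interval, where \<open>Sup\<close> and \<open>Inf\<close> are unspecified.\<close>
        define h where "h K = (if K = {} then 0 else norm (f (Sup K) - f (Inf K)))" for K
        have "(\<Sum>(x,K)\<in>pN. h K) = (\<Sum>I\<in>D. h I)"
          unfolding D_def
        proof (rule sum.over_tagged_division_lemma[OF tagged_partial_division_of_Union_self[OF pNtag]])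
          fix u v :: real assume "box u v = {}"
          then show "h (cbox u v) = 0"
            by (cases "u = v") (auto simp: h_def box_real)
        qed
        moreover have ne: "K \<noteq> {}" if "(x,K) \<in> pN" for x K
          using shape[of x K] that by (auto simp: pN_def)
        moreover have "(\<Sum>(x,K)\<in>pN. norm (f (Sup K) - f (Inf K))) = (\<Sum>(x,K)\<in>pN. h K)"
          by (rule sum.cong) (use ne in \<open>auto simp: h_def\<close>)
        moreover have "(\<Sum>I\<in>D. norm (f (Sup I) - f (Inf I))) = (\<Sum>I\<in>D. h I)"
          by (rule sum.cong) (use ne in \<open>auto simp: h_def D_def\<close>)
        ultimately show ?thesis by simp
      qed
      ultimately have "norm (\<Sum>(x, K)\<in>pN. f(Sup K) - f(Inf K)) < e/2"
        using norm_sum[of "\<lambda>(x,K). f (Sup K) - f (Inf K)" pN] by (simp add: split_def)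
      with G' show ?thesis unfolding split
        using norm_triangle_ineq4[of "(\<Sum>(x, K)\<in>pG. measure lborel K *\<^sub>R g x - (f(Sup K) - f(Inf K)))" "(\<Sum>(x, K)\<in>pN. f(Sup K) - f(Inf K))"]
        by linarith
    qed
    show "\<exists>\<gamma>. gauge \<gamma> \<and> (\<forall>p. p tagged_division_of cbox a b \<and> \<gamma> fine p \<longrightarrow>
        norm ((\<Sum>(x, K)\<in>p. measure lborel K *\<^sub>R g x) - (f b - f a)) < e)"
      by (intro exI[of _ \<gamma>] conjI gau allI impI, elim conjE, rule main)
  qed
  then show ?thesis
    using has_integral_spike[OF N, of "{a..b}" f' g] by (auto simp: g_def)
qed

lemma integrable_on_interval:
  fixes f :: "real \<Rightarrow> 'v::euclidean_space"
  shows "integrable (lebesgue_on {a..b}) f \<Longrightarrow> f integrable_on {a..b}"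
  by (rule integrable_on_lebesgue_on) auto

text \<open>Truncate \<open>\<bar>g\<bar>\<close> at a height \<open>n\<close> that leaves an integral below \<open>e/2\<close>. The truncated part
  contributes at most \<open>n\<close> times the total length of the intervals.\<close>

lemma abs_continuous_on_indefinite_integral:
  fixes g :: "real \<Rightarrow> 'v::euclidean_space"
  assumes g: "integrable (lebesgue_on {a..b}) g"
    and f: "\<And>t. t \<in> {a..b} \<Longrightarrow> f t = c + integral {a..t} g"
  shows "abs_continuous_on a b f"
  unfolding abs_continuous_on_def
proof (intro allI impI)
  fix e :: real assume e: "e > 0"
  let ?L = "lebesgue_on {a..b}"
  define h where "h t = norm (g t)" for t
  define h' where "h' n t = h t - min (h t) (real n)" for n t
  have hi: "integrable ?L h" using g unfolding h_def by simp
  have h'i: "integrable ?L (h' n)" for n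
    using borel_measurable_integrable[OF g] unfolding h'_def
    by (intro Bochner_Integration.integrable_diff hi Bochner_Integration.integrable_bound[OF hi])
      (auto simp: h_def)
  have "(\<lambda>n. integral\<^sup>L ?L (h' n)) \<longlonglongrightarrow> integral\<^sup>L ?L (\<lambda>t. 0)"
  proof (rule integral_dominated_convergence[where w=h])
    show "AE t in ?L. (\<lambda>n. h' n t) \<longlonglongrightarrow> 0"
    proof (intro always_eventually allI)
      fix t
      obtain N where N: "h t \<le> real N" using real_arch_simple by blast
      have "eventually (\<lambda>n. h' n t = 0) sequentially"
        using eventually_ge_at_top[of N] N by (elim eventually_mono) (auto simp: h'_def min_def)
      then show "(\<lambda>n. h' n t) \<longlonglongrightarrow> 0" by (simp add: tendsto_eventually)
    qed
  qed (use hi h'i in \<open>auto simp: h'_def h_def\<close>)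
  then obtain n where "integral\<^sup>L ?L (h' n) < e/2"
    using e order_tendstoD(2)[of _ "0::real" sequentially "e/2"] by (fastforce simp: eventually_sequentially)
  then have n: "integral {a..b} (h' n) < e/2"
    using lebesgue_integral_eq_integral[OF h'i] by simp
  define \<delta> where "\<delta> = e / (2 * (real n + 1))"
  have hI: "h integrable_on {a..b}" and h'I: "h' n integrable_on {a..b}" and gI: "g integrable_on {a..b}"
    using integrable_on_interval hi h'i g by blast+
  show "\<exists>\<delta>>0. \<forall>d. d division_of \<Union>d \<longrightarrow> \<Union>d \<subseteq> {a..b} \<longrightarrow> (\<Sum>I\<in>d. measure lborel I) < \<delta> \<longrightarrow>
        (\<Sum>I\<in>d. norm (f (Sup I) - f (Inf I))) < e"
  proof (intro exI[of _ \<delta>] conjI allI impI)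
    show "\<delta> > 0" using e by (simp add: \<delta>_def)
    fix d :: "real set set" assume d: "d division_of \<Union>d" "\<Union>d \<subseteq> {a..b}" "(\<Sum>I\<in>d. measure lborel I) < \<delta>"
    have "(\<Sum>I\<in>d. norm (f (Sup I) - f (Inf I))) \<le> (\<Sum>I\<in>d. integral I (h' n) + real n * measure lborel I)"
    proof (rule sum_mono)
      fix I assume I: "I \<in> d"
      obtain u v where uv: "I = {u..v}" "u \<le> v"
        using division_ofD(3,4)[OF d(1) I] by (fastforce simp: box_real)
      have sub: "{u..v} \<subseteq> {a..b}" using I d(2) uv by blast
      have sI: "g integrable_on {u..v}" "h integrable_on {u..v}" "h' n integrable_on {u..v}"
        using integrable_subinterval_real[OF _ sub] gI hI h'I by auto
      have "g integrable_on {a..v}" using integrable_subinterval_real[OF gI] sub uv(2) by auto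
      then have "integral {a..u} g + integral {u..v} g = integral {a..v} g"
        using sub uv by (intro Henstock_Kurzweil_Integration.integral_combine) auto
      then have "integral {a..v} g - integral {a..u} g = integral {u..v} g"
        by (metis add_diff_cancel_left')
      then have "norm (f (Sup I) - f (Inf I)) = norm (integral {u..v} g)"
        using uv sub by (auto simp: f)
      also have "\<dots> \<le> integral {u..v} (\<lambda>t. h' n t + real n)"
      proof (rule Henstock_Kurzweil_Integration.integral_norm_bound_integral)
        show "(\<lambda>t. h' n t + real n) integrable_on {u..v}" using sI by (intro integrable_add) auto
      qed (use sI in \<open>auto simp: h'_def h_def\<close>)
      also have "\<dots> = integral I (h' n) + real n * measure lborel I"
        using sI uv by (subst Henstock_Kurzweil_Integration.integral_add) auto
      finally show "norm (f (Sup I) - f (Inf I)) \<le> \<dots>" .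
    qed
    also have "\<dots> = (\<Sum>I\<in>d. integral I (h' n)) + real n * (\<Sum>I\<in>d. measure lborel I)"
      by (simp add: sum.distrib sum_distrib_left)
    also have "(\<Sum>I\<in>d. integral I (h' n)) = integral (\<Union>d) (h' n)"
      using d h'I by (intro integral_combine_division_topdown[symmetric] integrable_on_subdivision[OF d(1)]) auto
    also have "\<dots> \<le> integral {a..b} (h' n)"
      using d h'I by (intro integral_subset_le integrable_on_subdivision[OF d(1)]) (auto simp: h'_def)
    also have "\<dots> + real n * (\<Sum>I\<in>d. measure lborel I) < e/2 + e/2"
    proof (rule add_less_le_mono[OF n])
      have "real n * (\<Sum>I\<in>d. measure lborel I) \<le> real n * \<delta>" using d(3) by (intro mult_left_mono) auto
      also have "\<dots> \<le> e/2" using e by (simp add: \<delta>_def field_simps)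
      finally show "real n * (\<Sum>I\<in>d. measure lborel I) \<le> e/2" .
    qed
    finally show "(\<Sum>I\<in>d. norm (f (Sup I) - f (Inf I))) < e" by simp
  qed
qed

text \<open>Where the difference quotients fail to converge, they miss \<open>g t\<close> by a fixed \<open>1/(k+1)\<close> on
  arbitrarily short intervals with \<open>t\<close> as an endpoint. Vitali's theorem selects disjoint balls around such
  points that cover almost all of them, and Henstock's lemma bounds the total length of the
  corresponding intervals, hence the measure of the exceptional set.\<close>

lemma lebesgue_differentiation:
  fixes g :: "real \<Rightarrow> 'v::euclidean_space"
  assumes g: "g integrable_on {a..b}"
  shows "negligible {t \<in> {a..b}. \<not> ((\<lambda>t. integral {a..t} g) has_vector_derivative g t) (at t within {a..b})}"
proof -
  define G where "G t = integral {a..t} g" for t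
  define bad where "bad k t s \<longleftrightarrow> norm (G s - G t - (s - t) *\<^sub>R g t) > \<bar>s - t\<bar> / real (Suc k)" for k t s
  define E where "E k = {t \<in> {a<..<b}. \<forall>d>0. \<exists>s\<in>{a..b}. s \<noteq> t \<and> \<bar>s - t\<bar> < d \<and> bad k t s}" for k
  have incr: "G v - G u = integral {u..v} g" if "a \<le> u" "u \<le> v" "v \<le> b" for u v
  proof -
    have "g integrable_on {a..v}" using integrable_subinterval_real[OF g] that by auto
    then show ?thesis
      using Henstock_Kurzweil_Integration.integral_combine[of a u v g] that by (auto simp: G_def algebra_simps)
  qed
  have "negligible (E k)" for k
    unfolding negligible_outer_le
  proof (intro allI impI)
    fix e :: real assume e: "e > 0"
    \<comment> \<open>The factor 2 is there because a ball around \<open>t\<close> is twice as long as the interval from \<open>t\<close> to \<open>s\<close>.\<close>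
    define e' where "e' = e / (2 * real (Suc k))"
    have e': "e' > 0" using e by (simp add: e'_def)
    obtain \<gamma> where \<gamma>: "gauge \<gamma>" and hen: "\<And>p. \<lbrakk>p tagged_partial_division_of (cbox a b); \<gamma> fine p\<rbrakk> \<Longrightarrow>
             (\<Sum>(x,K)\<in>p. norm (measure lborel K *\<^sub>R g x - integral K g)) < e'"
      using Henstock_lemma[of g a b e'] g e' by (auto simp: box_real)
    define J where "J q = {min (fst q) (snd q)..max (fst q) (snd q)}" for q :: "real \<times> real"
    define rad where "rad q = \<bar>snd q - fst q\<bar>" for q :: "real \<times> real"
    define K where "K = {q. snd q \<noteq> fst q \<and> fst q \<in> {a..b} \<and> snd q \<in> {a..b} \<and> bad k (fst q) (snd q) \<and> J q \<subseteq> \<gamma> (fst q)}"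
    have Krad: "0 < rad q" if "q \<in> K" for q using that by (auto simp: K_def rad_def)
    have Kcov: "\<exists>q. q \<in> K \<and> t \<in> cball (fst q) (rad q) \<and> rad q < d" if t: "t \<in> E k" and d: "0 < d" for t d
    proof -
      have "open (\<gamma> t)" "t \<in> \<gamma> t" using \<gamma> by (auto simp: gauge_def)
      then obtain \<rho> where \<rho>: "\<rho> > 0" "ball t \<rho> \<subseteq> \<gamma> t" using openE by blast
      then obtain s where s: "s \<in> {a..b}" "s \<noteq> t" "\<bar>s - t\<bar> < min d \<rho>" "bad k t s"
        using t d unfolding E_def mem_Collect_eq by (metis min_less_iff_conj)
      have "J (t,s) \<subseteq> ball t \<rho>" using s(3) by (auto simp: J_def dist_real_def)
      then have "(t,s) \<in> K" using s t \<rho> by (auto simp: K_def E_def)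
      then show ?thesis using s by (intro exI[of _ "(t,s)"]) (auto simp: rad_def)
    qed
    obtain C where C: "countable C" "C \<subseteq> K"
      "pairwise (\<lambda>i j. disjnt (cball (fst i) (rad i)) (cball (fst j) (rad j))) C"
      "negligible (E k - (\<Union>i \<in> C. cball (fst i) (rad i)))"
      by (rule Vitali_covering_theorem_cballs[of K rad "E k" fst, OF Krad Kcov])
    have Jsub: "J q \<subseteq> cball (fst q) (rad q)" for q by (auto simp: J_def rad_def dist_real_def)
    have fin: "measure lebesgue (\<Union>i\<in>F. cball (fst i) (rad i)) \<le> e" if F: "F \<subseteq> C" "finite F" for F
    proof -
      define p where "p = (\<lambda>q. (fst q, J q)) ` F"
      have FK: "q \<in> K" if "q \<in> F" for q using that F C by auto
      have dis: "interior (J q) \<inter> interior (J q') = {}" if "q \<in> F" "q' \<in> F" "q \<noteq> q'" for q q'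
      proof -
        have "disjnt (cball (fst q) (rad q)) (cball (fst q') (rad q'))"
          using C(3) that F unfolding pairwise_def by blast
        then show ?thesis using Jsub[of q] Jsub[of q'] interior_subset[of "J q"] interior_subset[of "J q'"]
          unfolding disjnt_def by blast
      qed
      have ptag: "p tagged_partial_division_of (cbox a b)"
        unfolding tagged_partial_division_of_def
      proof (intro conjI allI impI)
        show "finite p" using F by (simp add: p_def)
      next
        fix x I assume "(x,I) \<in> p"
        then show "x \<in> I" "I \<subseteq> cbox a b" "\<exists>u v. I = cbox u v"
          using FK by (fastforce simp: p_def J_def K_def box_real)+
      next
        fix x1 K1 x2 K2 assume "(x1, K1) \<in> p \<and> (x2, K2) \<in> p \<and> (x1, K1) \<noteq> (x2, K2)"
        then obtain q1 q2 where "q1 \<in> F" "q2 \<in> F" "K1 = J q1" "K2 = J q2" "q1 \<noteq> q2"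
          by (auto simp: p_def)
        then show "interior K1 \<inter> interior K2 = {}" using dis by simp
      qed
      have fine: "\<gamma> fine p" using FK by (auto simp: fine_def p_def K_def)
      have inj: "inj_on (\<lambda>q. (fst q, J q)) F"
        by (rule inj_onI) (auto simp: J_def Icc_eq_Icc prod_eq_iff min_def max_def split: if_splits)
      have "(\<Sum>q\<in>F. rad q / real (Suc k)) \<le> (\<Sum>q\<in>F. norm (measure lborel (J q) *\<^sub>R g (fst q) - integral (J q) g))"
      proof (rule sum_mono)
        fix q assume "q \<in> F"
        then have q: "snd q \<noteq> fst q" "fst q \<in> {a..b}" "snd q \<in> {a..b}" "bad k (fst q) (snd q)"
          using FK by (auto simp: K_def)
        have "norm (G (snd q) - G (fst q) - (snd q - fst q) *\<^sub>R g (fst q)) = norm (measure lborel (J q) *\<^sub>R g (fst q) - integral (J q) g)"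
        proof (cases "fst q \<le> snd q")
          case True
          then show ?thesis using incr[of "fst q" "snd q"] q by (simp add: J_def norm_minus_commute)
        next
          case False
          then have eq: "G (fst q) - G (snd q) = integral (J q) g" "measure lborel (J q) = fst q - snd q"
            using incr[of "snd q" "fst q"] q by (auto simp: J_def)
          have "G (snd q) - G (fst q) - (snd q - fst q) *\<^sub>R g (fst q) = measure lborel (J q) *\<^sub>R g (fst q) - integral (J q) g"
            unfolding eq(2) eq(1)[symmetric] by (simp add: algebra_simps)
          then show ?thesis by simp
        qed
        then show "rad q / real (Suc k) \<le> norm (measure lborel (J q) *\<^sub>R g (fst q) - integral (J q) g)"
          using q(4) by (simp add: bad_def rad_def)
      qed
      also have "\<dots> = (\<Sum>(x,K)\<in>p. norm (measure lborel K *\<^sub>R g x - integral K g))"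
        unfolding p_def by (subst sum.reindex[OF inj]) simp
      also have "\<dots> < e'" by (rule hen[OF ptag fine])
      finally have "(\<Sum>q\<in>F. rad q) < e' * real (Suc k)"
        by (simp add: sum_divide_distrib[symmetric] field_simps del: of_nat_Suc)
      then have s: "2 * (\<Sum>q\<in>F. rad q) < e" using e by (simp add: e'_def del: of_nat_Suc)
      have "measure lebesgue (\<Union>i\<in>F. cball (fst i) (rad i)) \<le> (\<Sum>i\<in>F. measure lebesgue (cball (fst i) (rad i)))"
        by (rule measure_UNION_le[OF F(2)]) auto
      also have "\<dots> = (\<Sum>i\<in>F. 2 * rad i)"
        by (rule sum.cong) (auto simp: cball_eq_atLeastAtMost rad_def)
      also have "\<dots> \<le> e" using s by (simp add: sum_distrib_left)
      finally show ?thesis .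
    qed
    let ?U = "\<Union>i\<in>C. cball (fst i) (rad i)"
    have U: "?U \<in> lmeasurable" "measure lebesgue ?U \<le> e"
      using fmeasurable_UN_bound[OF C(1) _ fin] measure_UN_bound[OF C(1) _ fin] by auto
    have "?U \<union> (E k - ?U) \<in> lmeasurable" 
      using U C(4) by (intro fmeasurable.Un) (auto simp: negligible_imp_measurable)
    moreover have "measure lebesgue (?U \<union> (E k - ?U)) \<le> e"
      using measure_Un_le[of ?U lebesgue "E k - ?U"] U C(4) negligible_imp_measure0[OF C(4)]
      by (auto simp: fmeasurableD negligible_imp_sets)
    ultimately show "\<exists>T. E k \<subseteq> T \<and> T \<in> lmeasurable \<and> measure lebesgue T \<le> e"
      by (intro exI[of _ "?U \<union> (E k - ?U)"]) auto
  qed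
  then have neg: "negligible ({a,b} \<union> (\<Union>k. E k))"
    by (intro negligible_Un negligible_countable_Union[OF countable_image]) auto
  show ?thesis
  proof (rule negligible_subset[OF neg], rule subsetI, rule ccontr)
    fix t assume "t \<in> {t \<in> {a..b}. \<not> ((\<lambda>t. integral {a..t} g) has_vector_derivative g t) (at t within {a..b})}"
      and "t \<notin> {a,b} \<union> (\<Union>k. E k)"
    then have t: "t \<in> {a..b}" "t \<noteq> a" "\<And>k. t \<notin> E k" "t \<noteq> b"
      and nd: "\<not> ((\<lambda>t. integral {a..t} g) has_vector_derivative g t) (at t within {a..b})"
      by auto
    have "(G has_vector_derivative g t) (at t within {a..b})"
      unfolding has_vector_derivative_def has_derivative_within_alt
    proof (intro conjI allI impI)
      show "bounded_linear (\<lambda>x. x *\<^sub>R g t)" by (rule bounded_linear_scaleR_left)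
      fix e :: real assume "e > 0"
      then obtain k where k: "1 / real (Suc k) < e" using nat_approx_posE by blast
      have "t \<notin> E k" by (rule t(3))
      then obtain d where d: "d > 0" "\<And>s. s\<in>{a..b} \<Longrightarrow> s \<noteq> t \<Longrightarrow> \<bar>s - t\<bar> < d \<Longrightarrow> \<not> bad k t s"
        using t unfolding E_def by fastforce
      have "norm (G s - G t - (s - t) *\<^sub>R g t) \<le> e * norm (s - t)" if s: "s \<in> {a..b}" "norm (s - t) < d" for s
      proof (cases "s = t")
        case False
        then have "norm (G s - G t - (s - t) *\<^sub>R g t) \<le> (1 / real (Suc k)) * \<bar>s - t\<bar>"
          using d(2) s by (simp add: bad_def not_less)
        also have "\<dots> \<le> e * \<bar>s - t\<bar>" using k by (intro mult_right_mono) auto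
        finally show ?thesis by simp
      qed simp
      then show "\<exists>d>0. \<forall>s\<in>{a..b}. norm (s - t) < d \<longrightarrow> norm (G s - G t - (s - t) *\<^sub>R g t) \<le> e * norm (s - t)"
        using d(1) by blast
    qed
    then show False using nd by (simp add: G_def[abs_def])
  qed
qed

text \<open>The integral form of \<open>y' = z\<close>, which is the working form of absolute continuity below: it is
  stable under sums and linear maps, and by \<open>ac_primitiveI\<close>, \<open>ac_primitive_abs_continuous_on\<close>
  and \<open>ac_primitive_AE_deriv\<close> it says that \<open>y\<close> is absolutely continuous with derivative \<open>z\<close>
  almost everywhere.\<close>

definition ac_primitive :: "real \<Rightarrow> real \<Rightarrow> (real \<Rightarrow> 'v::euclidean_space) \<Rightarrow> (real \<Rightarrow> 'v) \<Rightarrow> bool" where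
  "ac_primitive a b z y \<longleftrightarrow> integrable (lebesgue_on {a..b}) z \<and>
     (\<forall>t\<in>{a..b}. y t = y a + integral {a..t} z)"

lemma AE_lebesgue_on_iff_negligible:
  "(AE t in lebesgue_on {a..b::real}. P t) \<longleftrightarrow> negligible {t \<in> {a..b}. \<not> P t}"
proof -
  have "(AE t in lebesgue_on {a..b}. P t) \<longleftrightarrow> (AE t in lebesgue. t \<in> {a..b} \<longrightarrow> P t)"
    by (subst AE_restrict_space_iff) auto
  also have "\<dots> \<longleftrightarrow> {t. \<not> (t \<in> {a..b} \<longrightarrow> P t)} \<in> null_sets lebesgue"
    by (subst completion.AE_iff_null_sets) auto
  also have "\<dots> \<longleftrightarrow> negligible {t \<in> {a..b}. \<not> P t}"
    by (simp add: negligible_iff_null_sets)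
  finally show ?thesis .
qed

lemma abs_continuous_on_subinterval:
  assumes "abs_continuous_on a b f" "a \<le> u" "v \<le> b"
  shows "abs_continuous_on u v f"
proof -
  have "{u..v} \<subseteq> {a..b}" using assms by auto
  then show ?thesis using assms(1) unfolding abs_continuous_on_def by (elim all_forward imp_forward ex_forward conj_forward) auto
qed

lemma ac_primitive_integrable: "ac_primitive a b z y \<Longrightarrow> integrable (lebesgue_on {a..b}) z"
  by (simp add: ac_primitive_def)

lemma ac_primitive_integrable_on: "ac_primitive a b z y \<Longrightarrow> z integrable_on {a..b}"
  by (intro integrable_on_interval ac_primitive_integrable)

lemma ac_primitive_eq: "ac_primitive a b z y \<Longrightarrow> t \<in> {a..b} \<Longrightarrow> y t = y a + integral {a..t} z"
  unfolding ac_primitive_def by blast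

lemma ac_primitive_abs_continuous_on: "ac_primitive a b z y \<Longrightarrow> abs_continuous_on a b y"
  by (rule abs_continuous_on_indefinite_integral[OF ac_primitive_integrable ac_primitive_eq])

lemma ac_primitive_AE_deriv:
  assumes "ac_primitive a b z y"
  shows "AE t in lebesgue_on {a..b}. (y has_vector_derivative z t) (at t within {a..b})"
proof -
  have zi: "z integrable_on {a..b}" using assms ac_primitive_integrable_on by blast
  have eq: "(y has_vector_derivative z t) (at t within {a..b})"
    if "((\<lambda>t. integral {a..t} z) has_vector_derivative z t) (at t within {a..b})" "t \<in> {a..b}" for t
  proof -
    have "((\<lambda>t. y a + integral {a..t} z) has_vector_derivative z t) (at t within {a..b})"
      using has_vector_derivative_add[OF has_vector_derivative_const[of "y a"] that(1)] by simp
    then show ?thesis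
      using has_vector_derivative_transform[where f="\<lambda>t. y a + integral {a..t} z" and g=y, OF that(2) ac_primitive_eq[OF assms]] by blast
  qed
  then show ?thesis
    unfolding AE_lebesgue_on_iff_negligible
    by (intro negligible_subset[OF lebesgue_differentiation[OF zi]]) auto
qed

lemma ac_primitiveI:
  fixes y :: "real \<Rightarrow> 'v::euclidean_space"
  assumes "integrable (lebesgue_on {a..b}) z" "abs_continuous_on a b y"
    "AE t in lebesgue_on {a..b}. (y has_vector_derivative z t) (at t within {a..b})"
  shows "ac_primitive a b z y"
proof -
  define N where "N = {t \<in> {a..b}. \<not> (y has_vector_derivative z t) (at t within {a..b})}"
  have N: "negligible N" using assms(3) by (simp add: AE_lebesgue_on_iff_negligible N_def)
  have "y t = y a + integral {a..t} z" if t: "t \<in> {a..b}" for t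
  proof -
    have "(z has_integral (y t - y a)) {a..t}"
    proof (rule abs_continuous_on_ftc[OF _ _ N])
      show "abs_continuous_on a t y" using abs_continuous_on_subinterval[OF assms(2)] t by auto
    next
      fix s assume "s \<in> {a..t} - N"
      then have "(y has_vector_derivative z s) (at s within {a..b})" using t by (auto simp: N_def)
      then show "(y has_vector_derivative z s) (at s within {a..t})"
        by (rule has_vector_derivative_within_subset) (use t in auto)
    qed (use t in auto)
    then have "integral {a..t} z = y t - y a" by (rule integral_unique)
    then show ?thesis by simp
  qed
  then show ?thesis using assms(1) unfolding ac_primitive_def by blast
qed

lemma ac_primitive_continuous_on:
  assumes "ac_primitive a b z y"
  shows "continuous_on {a..b} y"
proof -
  have "z integrable_on {a..b}" using assms ac_primitive_integrable_on by blast
  then have "continuous_on {a..b} (\<lambda>t. y a + integral {a..t} z)"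
    by (intro continuous_intros indefinite_integral_continuous_1)
  then show ?thesis
    by (rule continuous_on_eq) (rule ac_primitive_eq[OF assms, symmetric])
qed

lemma ac_primitive_deriv:
  assumes "ac_primitive a b z y" "continuous_on {a..b} z" "t \<in> {a..b}"
  shows "(y has_vector_derivative z t) (at t within {a..b})"
proof -
  have "((\<lambda>t. y a + integral {a..t} z) has_vector_derivative z t) (at t within {a..b})"
    using has_vector_derivative_add[OF has_vector_derivative_const[of "y a"]
      integral_has_vector_derivative[OF assms(2,3)]] by simp
  then show ?thesis
    using has_vector_derivative_transform[where f="\<lambda>t. y a + integral {a..t} z" and g=y, OF assms(3) ac_primitive_eq[OF assms(1)]] by blast
qed

lemma continuous_on_integrable_lebesgue_on:
  fixes f :: "real \<Rightarrow> 'v::euclidean_space"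
  assumes "continuous_on {a..b} f"
  shows "integrable (lebesgue_on {a..b}) f"
  using assms by (intro absolutely_integrable_imp_integrable absolutely_integrable_continuous_real) auto

lemma ac_primitive_cong_AE:
  assumes y: "ac_primitive a b z y" and m: "z' \<in> borel_measurable (lebesgue_on {a..b})"
    and ae: "AE t in lebesgue_on {a..b}. z t = z' t"
  shows "ac_primitive a b z' y"
proof (rule ac_primitiveI)
  have mz: "z \<in> borel_measurable (lebesgue_on {a..b})"
    using ac_primitive_integrable[OF y] by (rule borel_measurable_integrable)
  show "integrable (lebesgue_on {a..b}) z'"
    using integrable_cong_AE[OF mz m ae] ac_primitive_integrable[OF y] by simp
  show "abs_continuous_on a b y" by (rule ac_primitive_abs_continuous_on[OF y])
  show "AE t in lebesgue_on {a..b}. (y has_vector_derivative z' t) (at t within {a..b})"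
    using ac_primitive_AE_deriv[OF y] ae by eventually_elim simp
qed

lemma ac_primitive_add:
  assumes "ac_primitive a b z y" "ac_primitive a b z' y'"
  shows "ac_primitive a b (\<lambda>t. z t + z' t) (\<lambda>t. y t + y' t)"
  unfolding ac_primitive_def
proof (intro conjI ballI)
  show "integrable (lebesgue_on {a..b}) (\<lambda>t. z t + z' t)"
    using assms by (intro Bochner_Integration.integrable_add ac_primitive_integrable)
  fix t assume t: "t \<in> {a..b}"
  have "z integrable_on {a..b}" "z' integrable_on {a..b}"
    using ac_primitive_integrable_on[OF assms(1)] ac_primitive_integrable_on[OF assms(2)] by blast+
  then have "z integrable_on {a..t}" "z' integrable_on {a..t}"
    using t by (auto intro: integrable_subinterval_real)
  then have "integral {a..t} (\<lambda>t. z t + z' t) = integral {a..t} z + integral {a..t} z'"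
    by (rule Henstock_Kurzweil_Integration.integral_add)
  moreover have "y t = y a + integral {a..t} z" "y' t = y' a + integral {a..t} z'"
    by (rule ac_primitive_eq[OF assms(1) t] ac_primitive_eq[OF assms(2) t])+
  ultimately show "y t + y' t = y a + y' a + integral {a..t} (\<lambda>t. z t + z' t)"
    by simp
qed

lemma ac_primitive_linear:
  fixes T :: "'v::euclidean_space \<Rightarrow> 'w::euclidean_space"
  assumes T: "bounded_linear T" and y: "ac_primitive a b z y"
  shows "ac_primitive a b (\<lambda>t. T (z t)) (\<lambda>t. T (y t))"
  unfolding ac_primitive_def
proof (intro conjI ballI)
  show "integrable (lebesgue_on {a..b}) (\<lambda>t. T (z t))"
    using integrable_bounded_linear[OF T ac_primitive_integrable[OF y]] .
  fix t assume t: "t \<in> {a..b}"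
  have "z integrable_on {a..b}" by (rule ac_primitive_integrable_on[OF y])
  then have "z integrable_on {a..t}" using t by (auto intro: integrable_subinterval_real)
  then have "integral {a..t} (\<lambda>t. T (z t)) = T (integral {a..t} z)"
    using integral_linear[OF _ T] by (simp add: o_def)
  moreover have "y t = y a + integral {a..t} z" by (rule ac_primitive_eq[OF y t])
  ultimately show "T (y t) = T (y a) + integral {a..t} (\<lambda>t. T (z t))"
    using linear_add[OF bounded_linear.linear[OF T]] by metis
qed

text \<open>The common core of products and of Lipschitz functions of absolutely continuous functions.\<close>

lemma abs_continuous_on_bound:
  fixes h :: "real \<Rightarrow> 'w::real_normed_vector"
  assumes f: "abs_continuous_on a b f" and g: "abs_continuous_on a b g"
    and K: "0 \<le> K" "\<And>s t. s \<in> {a..b} \<Longrightarrow> t \<in> {a..b} \<Longrightarrow> norm (h s - h t) \<le> K * (norm (f s - f t) + norm (g s - g t))"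
  shows "abs_continuous_on a b h"
  unfolding abs_continuous_on_def
proof (intro allI impI)
  fix e :: real assume e: "e > 0"
  define e' where "e' = e / (2 * (K + 1))"
  have e': "e' > 0" using e K by (simp add: e'_def)
  obtain d1 where d1: "d1 > 0" "\<And>d. d division_of \<Union>d \<Longrightarrow> \<Union>d \<subseteq> {a..b} \<Longrightarrow> (\<Sum>I\<in>d. measure lborel I) < d1 \<Longrightarrow>
        (\<Sum>I\<in>d. norm (f (Sup I) - f (Inf I))) < e'"
    using f e' unfolding abs_continuous_on_def by blast
  obtain d2 where d2: "d2 > 0" "\<And>d. d division_of \<Union>d \<Longrightarrow> \<Union>d \<subseteq> {a..b} \<Longrightarrow> (\<Sum>I\<in>d. measure lborel I) < d2 \<Longrightarrow>
        (\<Sum>I\<in>d. norm (g (Sup I) - g (Inf I))) < e'"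
    using g e' unfolding abs_continuous_on_def by blast
  show "\<exists>\<delta>>0. \<forall>d. d division_of \<Union>d \<longrightarrow> \<Union>d \<subseteq> {a..b} \<longrightarrow> (\<Sum>I\<in>d. measure lborel I) < \<delta> \<longrightarrow>
        (\<Sum>I\<in>d. norm (h (Sup I) - h (Inf I))) < e"
  proof (intro exI[of _ "min d1 d2"] conjI allI impI)
    fix d :: "real set set"
    assume d: "d division_of \<Union>d" "\<Union>d \<subseteq> {a..b}" "(\<Sum>I\<in>d. measure lborel I) < min d1 d2"
    have "(\<Sum>I\<in>d. norm (h (Sup I) - h (Inf I)))
        \<le> (\<Sum>I\<in>d. K * (norm (f (Sup I) - f (Inf I)) + norm (g (Sup I) - g (Inf I))))"
    proof (rule sum_mono)
      fix I assume I: "I \<in> d"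
      obtain u v where uv: "I = {u..v}" "u \<le> v"
        using division_ofD(3,4)[OF d(1) I] by (fastforce simp: box_real)
      have "I \<subseteq> {a..b}" using d(2) I by blast
      then have "u \<in> {a..b}" "v \<in> {a..b}" using uv by auto
      then show "norm (h (Sup I) - h (Inf I)) \<le> K * (norm (f (Sup I) - f (Inf I)) + norm (g (Sup I) - g (Inf I)))"
        using K(2)[of v u] uv by simp
    qed
    also have "\<dots> = K * ((\<Sum>I\<in>d. norm (f (Sup I) - f (Inf I))) + (\<Sum>I\<in>d. norm (g (Sup I) - g (Inf I))))"
      by (simp add: sum_distrib_left sum.distrib distrib_left)
    also have "\<dots> \<le> K * (e' + e')"
      using d1(2)[OF d(1,2)] d2(2)[OF d(1,2)] d(3) K(1) by (intro mult_left_mono add_mono) auto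
    also have "\<dots> = K * (e / (K + 1))" using K(1) by (simp add: e'_def divide_simps)
    also have "\<dots> < e" using e K(1) by (simp add: field_simps)
    finally show "(\<Sum>I\<in>d. norm (h (Sup I) - h (Inf I))) < e" .
  qed (use d1 d2 in auto)
qed

lemma continuous_on_interval_bound:
  fixes f :: "real \<Rightarrow> 'v::real_normed_vector"
  assumes "continuous_on {a..b} f"
  obtains C where "C > 0" "\<And>t. t \<in> {a..b} \<Longrightarrow> norm (f t) \<le> C"
proof -
  have "bounded (f ` {a..b})" using compact_continuous_image[OF assms compact_Icc] compact_imp_bounded by blast
  then show ?thesis using that unfolding bounded_pos by blast
qed

text \<open>Integration by parts, obtained by differentiating the product almost everywhere. The general
  bilinear map covers products of matrices as well as of a matrix with a vector.\<close>

lemma ac_primitive_bilinear: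
  fixes prod :: "'u::euclidean_space \<Rightarrow> 'v::euclidean_space \<Rightarrow> 'w::euclidean_space"
  assumes bl: "bounded_bilinear prod" and f: "ac_primitive a b f' f" and g: "ac_primitive a b g' g"
  shows "ac_primitive a b (\<lambda>t. prod (f' t) (g t) + prod (f t) (g' t)) (\<lambda>t. prod (f t) (g t))"
proof (rule ac_primitiveI)
  interpret bounded_bilinear prod by (fact bl)
  note cf = ac_primitive_continuous_on[OF f] and cg = ac_primitive_continuous_on[OF g]
  note i_f = ac_primitive_integrable[OF f] and i_g = ac_primitive_integrable[OF g]
  obtain Cf where Cf: "Cf > 0" "\<And>t. t \<in> {a..b} \<Longrightarrow> norm (f t) \<le> Cf" using continuous_on_interval_bound[OF cf] by blast
  obtain Cg where Cg: "Cg > 0" "\<And>t. t \<in> {a..b} \<Longrightarrow> norm (g t) \<le> Cg" using continuous_on_interval_bound[OF cg] by blast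
  obtain K where K: "K > 0" "\<And>x y. norm (prod x y) \<le> norm x * norm y * K" using pos_bounded by blast
  have cont2: "continuous_on UNIV (\<lambda>x. prod (fst x) (snd x))"
    by (intro continuous_on continuous_intros)
  have meas: "(\<lambda>t. prod (F t) (H t)) \<in> borel_measurable (lebesgue_on {a..b})"
    if "F \<in> borel_measurable (lebesgue_on {a..b})" "H \<in> borel_measurable (lebesgue_on {a..b})" for F H
    using borel_measurable_continuous_Pair[OF that cont2] by simp
  have mf: "f \<in> borel_measurable (lebesgue_on {a..b})" and mg: "g \<in> borel_measurable (lebesgue_on {a..b})"
    using continuous_on_integrable_lebesgue_on[OF cf] continuous_on_integrable_lebesgue_on[OF cg] by auto
  have 1: "integrable (lebesgue_on {a..b}) (\<lambda>t. prod (f' t) (g t))"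
  proof (rule Bochner_Integration.integrable_bound)
    show "integrable (lebesgue_on {a..b}) (\<lambda>t. K * Cg * norm (f' t))" using i_f by simp
    show "AE t in lebesgue_on {a..b}. norm (prod (f' t) (g t)) \<le> norm (K * Cg * norm (f' t))"
    proof (rule AE_I2)
      fix t assume "t \<in> space (lebesgue_on {a..b})"
      then have "norm (f' t) * norm (g t) * K \<le> norm (f' t) * Cg * K"
        using Cg K by (intro mult_right_mono mult_left_mono) auto
      then show "norm (prod (f' t) (g t)) \<le> norm (K * Cg * norm (f' t))"
        using K Cg order_trans[OF K(2)] by (fastforce simp: mult_ac abs_mult)
    qed
  qed (use meas i_f mg in auto)
  have 2: "integrable (lebesgue_on {a..b}) (\<lambda>t. prod (f t) (g' t))"
  proof (rule Bochner_Integration.integrable_bound)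
    show "integrable (lebesgue_on {a..b}) (\<lambda>t. K * Cf * norm (g' t))" using i_g by simp
    show "AE t in lebesgue_on {a..b}. norm (prod (f t) (g' t)) \<le> norm (K * Cf * norm (g' t))"
    proof (rule AE_I2)
      fix t assume "t \<in> space (lebesgue_on {a..b})"
      then have "norm (f t) * norm (g' t) * K \<le> Cf * norm (g' t) * K"
        using Cf K by (intro mult_right_mono) auto
      then show "norm (prod (f t) (g' t)) \<le> norm (K * Cf * norm (g' t))"
        using K Cf order_trans[OF K(2)] by (fastforce simp: mult_ac abs_mult)
    qed
  qed (use meas i_g mf in auto)
  show "integrable (lebesgue_on {a..b}) (\<lambda>t. prod (f' t) (g t) + prod (f t) (g' t))"
    using 1 2 by simp
  show "AE t in lebesgue_on {a..b}. ((\<lambda>t. prod (f t) (g t)) has_vector_derivative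
      prod (f' t) (g t) + prod (f t) (g' t)) (at t within {a..b})"
    using ac_primitive_AE_deriv[OF f] ac_primitive_AE_deriv[OF g]
  proof eventually_elim
    case (elim t)
    then show ?case using has_vector_derivative[OF elim] by (simp add: add.commute)
  qed
  show "abs_continuous_on a b (\<lambda>t. prod (f t) (g t))"
  proof (rule abs_continuous_on_bound[OF ac_primitive_abs_continuous_on[OF f] ac_primitive_abs_continuous_on[OF g]])
    show "0 \<le> K * (Cf + Cg)" using K Cf Cg by simp
    fix s t assume st: "s \<in> {a..b}" "t \<in> {a..b}"
    have "prod (f s) (g s) - prod (f t) (g t) = prod (f s) (g s - g t) + prod (f s - f t) (g t)"
      by (simp add: diff_left diff_right)
    then have "norm (prod (f s) (g s) - prod (f t) (g t)) \<le> norm (prod (f s) (g s - g t)) + norm (prod (f s - f t) (g t))"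
      using norm_triangle_ineq by simp
    also have "\<dots> \<le> norm (f s) * norm (g s - g t) * K + norm (f s - f t) * norm (g t) * K"
      by (intro add_mono K)
    also have "\<dots> \<le> Cf * norm (g s - g t) * K + norm (f s - f t) * Cg * K"
      using K Cf Cg st by (intro add_mono mult_right_mono mult_left_mono) auto
    also have "\<dots> \<le> (Cf + Cg) * norm (g s - g t) * K + norm (f s - f t) * (Cf + Cg) * K"
      using K Cf Cg by (intro add_mono mult_right_mono mult_left_mono) auto
    also have "\<dots> = K * (Cf + Cg) * (norm (f s - f t) + norm (g s - g t))" by (simp add: algebra_simps)
    finally show "norm (prod (f s) (g s) - prod (f t) (g t)) \<le> K * (Cf + Cg) * (norm (f s - f t) + norm (g s - g t))" .
  qed
qed

section \<open>\<open>L\<^sub>p\<close> functions on an interval\<close>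

text \<open>This makes \<open>deriv_on\<close> measurable although its values are unspecified on a null set.\<close>

lemma borel_measurable_lebesgue_on_AE:
  fixes f g :: "real \<Rightarrow> 'v::euclidean_space"
  assumes f: "f \<in> borel_measurable (lebesgue_on {a..b})" and ae: "AE t in lebesgue_on {a..b}. f t = g t"
  shows "g \<in> borel_measurable (lebesgue_on {a..b})"
proof -
  have neg: "negligible {t \<in> {a..b}. f t \<noteq> g t}" using ae by (simp add: AE_lebesgue_on_iff_negligible)
  have "f measurable_on {a..b}" using f by (simp add: measurable_on_iff_borel_measurable)
  then have "g measurable_on {a..b}" by (rule measurable_on_spike[OF _ neg]) auto
  then show ?thesis by (simp add: measurable_on_iff_borel_measurable)
qed

lemma enn2real_ge_1:
  assumes "1 \<le> p" "p \<noteq> \<infinity>"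
  shows "1 \<le> enn2real p"
proof -
  have "enn2real 1 \<le> enn2real p" using assms by (intro enn2real_mono) (auto simp: less_top)
  then show ?thesis by simp
qed

lemma Lp_fun_infinity_iff:
  fixes f :: "real \<Rightarrow> 'v::euclidean_space"
  shows "Lp_fun \<infinity> a b f \<longleftrightarrow> f \<in> borel_measurable (lebesgue_on {a..b}) \<and>
     (\<exists>C. AE t in lebesgue_on {a..b}. norm (f t) \<le> C)"
proof (cases "f \<in> borel_measurable (lebesgue_on {a..b})")
  case True
  then have m: "(\<lambda>t. ennreal (norm (f t))) \<in> borel_measurable (lebesgue_on {a..b})" by measurable
  let ?s = "esssup (lebesgue_on {a..b}) (\<lambda>t. ennreal (norm (f t)))"
  have "?s < \<infinity> \<longleftrightarrow> (\<exists>C. AE t in lebesgue_on {a..b}. norm (f t) \<le> C)"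
  proof
    assume s: "?s < \<infinity>"
    have "AE t in lebesgue_on {a..b}. norm (f t) \<le> enn2real ?s"
      using esssup_AE[of "\<lambda>t. ennreal (norm (f t))" "lebesgue_on {a..b}"]
    proof eventually_elim
      case (elim t)
      have "enn2real (ennreal (norm (f t))) \<le> enn2real ?s"
        using elim s by (intro enn2real_mono) auto
      then show ?case by simp
    qed
    then show "\<exists>C. AE t in lebesgue_on {a..b}. norm (f t) \<le> C" by blast
  next
    assume "\<exists>C. AE t in lebesgue_on {a..b}. norm (f t) \<le> C"
    then obtain C where "AE t in lebesgue_on {a..b}. norm (f t) \<le> C" by blast
    then have "AE t in lebesgue_on {a..b}. ennreal (norm (f t)) \<le> ennreal C"
      by eventually_elim (rule ennreal_leI)
    then have "?s \<le> ennreal C" by (rule esssup_I[OF m])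
    then show "?s < \<infinity>" by (simp add: order_le_less_trans)
  qed
  then show ?thesis using True by (simp add: Lp_fun_def)
qed (simp add: Lp_fun_def)

locale lp_interval =
  fixes a b :: real and p :: ennreal
  assumes a_less_b: "a < b" and one_le_p: "1 \<le> p"
begin

abbreviation "\<mu> \<equiv> lebesgue_on {a..b}"

lemma Lp_fun_measurable: "Lp_fun p a b f \<Longrightarrow> f \<in> borel_measurable \<mu>"
  by (simp add: Lp_fun_def)

text \<open>All closure properties of \<open>Lp_fun\<close> are reduced to this one, in which finite and infinite \<open>p\<close>
  are treated separately; the same holds for the next lemma, which serves for sums.\<close>

lemma Lp_fun_mono:
  fixes f :: "real \<Rightarrow> 'u::euclidean_space" and g :: "real \<Rightarrow> 'v::euclidean_space"
  assumes f: "Lp_fun p a b f" and g: "g \<in> borel_measurable \<mu>"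
    and le: "AE t in \<mu>. norm (g t) \<le> C * norm (f t)"
  shows "Lp_fun p a b g"
proof (cases "p = \<infinity>")
  case True
  then obtain K where K: "AE t in \<mu>. norm (f t) \<le> K" using f Lp_fun_infinity_iff by blast
  have "AE t in \<mu>. norm (g t) \<le> \<bar>C\<bar> * K"
    using le K
  proof eventually_elim
    case (elim t)
    have "C * norm (f t) \<le> \<bar>C\<bar> * norm (f t)" by (intro mult_right_mono) auto
    also have "\<dots> \<le> \<bar>C\<bar> * K" using elim by (intro mult_left_mono) auto
    finally show ?case using elim by simp
  qed
  then show ?thesis using True g Lp_fun_infinity_iff by blast
next
  case False
  define q where "q = enn2real p"
  have q: "1 \<le> q" unfolding q_def by (rule enn2real_ge_1[OF one_le_p False])
  have fi: "integrable \<mu> (\<lambda>t. norm (f t) powr q)" using f False by (simp add: Lp_fun_def q_def)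
  have "integrable \<mu> (\<lambda>t. norm (g t) powr q)"
  proof (rule Bochner_Integration.integrable_bound)
    show "integrable \<mu> (\<lambda>t. \<bar>C\<bar> powr q * norm (f t) powr q)" using fi by simp
    show "(\<lambda>t. norm (g t) powr q) \<in> borel_measurable \<mu>" using g by measurable
    show "AE t in \<mu>. norm (norm (g t) powr q) \<le> norm (\<bar>C\<bar> powr q * norm (f t) powr q)"
      using le
    proof eventually_elim
      case (elim t)
      have "C * norm (f t) \<le> \<bar>C\<bar> * norm (f t)" by (intro mult_right_mono) auto
      then have "norm (g t) powr q \<le> (\<bar>C\<bar> * norm (f t)) powr q"
        using elim q by (intro powr_mono2) auto
      then show ?case by (simp add: powr_mult)
    qed
  qed
  then show ?thesis using False g by (simp add: Lp_fun_def q_def)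
qed

lemma Lp_fun_max_norm:
  fixes f :: "real \<Rightarrow> 'u::euclidean_space" and g :: "real \<Rightarrow> 'v::euclidean_space"
  assumes f: "Lp_fun p a b f" and g: "Lp_fun p a b g"
  shows "Lp_fun p a b (\<lambda>t. max (norm (f t)) (norm (g t)))"
proof (cases "p = \<infinity>")
  case True
  obtain K where K: "AE t in \<mu>. norm (f t) \<le> K" using f True Lp_fun_infinity_iff by blast
  obtain K' where K': "AE t in \<mu>. norm (g t) \<le> K'" using g True Lp_fun_infinity_iff by blast
  have "AE t in \<mu>. norm (max (norm (f t)) (norm (g t))) \<le> max K K'"
    using K K' by eventually_elim (auto simp: abs_real_def max_def)
  moreover have "(\<lambda>t. max (norm (f t)) (norm (g t))) \<in> borel_measurable \<mu>"
    using Lp_fun_measurable[OF f] Lp_fun_measurable[OF g] by measurable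
  ultimately show ?thesis unfolding True Lp_fun_infinity_iff by blast
next
  case False
  define q where "q = enn2real p"
  have abs: "\<bar>max (norm (f t)) (norm (g t))\<bar> = max (norm (f t)) (norm (g t))" for t
    by (simp add: le_max_iff_disj)
  have m: "(\<lambda>t. max (norm (f t)) (norm (g t))) \<in> borel_measurable \<mu>"
    using Lp_fun_measurable[OF f] Lp_fun_measurable[OF g] by measurable
  have "integrable \<mu> (\<lambda>t. max (norm (f t)) (norm (g t)) powr q)"
  proof (rule Bochner_Integration.integrable_bound)
    show "integrable \<mu> (\<lambda>t. norm (f t) powr q + norm (g t) powr q)"
      using f g False by (simp add: Lp_fun_def q_def)
    show "(\<lambda>t. max (norm (f t)) (norm (g t)) powr q) \<in> borel_measurable \<mu>" using m by measurable
  qed (auto simp: max_def)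
  then show ?thesis using False m abs by (simp add: Lp_fun_def q_def)
qed

lemma Lp_fun_add:
  fixes f g :: "real \<Rightarrow> 'v::euclidean_space"
  assumes f: "Lp_fun p a b f" and g: "Lp_fun p a b g"
  shows "Lp_fun p a b (\<lambda>t. f t + g t)"
proof (rule Lp_fun_mono[OF Lp_fun_max_norm[OF f g], where C=2])
  show "(\<lambda>t. f t + g t) \<in> borel_measurable \<mu>"
    using Lp_fun_measurable[OF f] Lp_fun_measurable[OF g] by measurable
  show "AE t in \<mu>. norm (f t + g t) \<le> 2 * norm (max (norm (f t)) (norm (g t)))"
  proof (intro always_eventually allI)
    fix t show "norm (f t + g t) \<le> 2 * norm (max (norm (f t)) (norm (g t)))"
      using norm_triangle_ineq[of "f t" "g t"] by simp
  qed
qed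

lemma Lp_fun_one: "Lp_fun p a b (\<lambda>t. 1::real)"
proof (cases "p = \<infinity>")
  case True
  show ?thesis unfolding True Lp_fun_infinity_iff by (auto intro!: exI[of _ 1])
next
  case False
  then show ?thesis by (simp add: Lp_fun_def emeasure_restrict_space)
qed

lemma continuous_on_imp_Lp_fun:
  fixes f :: "real \<Rightarrow> 'v::euclidean_space"
  assumes f: "continuous_on {a..b} f"
  shows "Lp_fun p a b f"
proof -
  obtain C where C: "\<And>t. t \<in> {a..b} \<Longrightarrow> norm (f t) \<le> C" using continuous_on_interval_bound[OF f] by blast
  show ?thesis
    using continuous_on_integrable_lebesgue_on[OF f] C
    by (intro Lp_fun_mono[OF Lp_fun_one, where C=C] AE_I2) auto
qed

lemma Lp_fun_integrable:
  fixes f :: "real \<Rightarrow> 'v::euclidean_space"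
  assumes f: "Lp_fun p a b f"
  shows "integrable \<mu> f"
proof (cases "p = \<infinity>")
  case True
  then obtain K where K: "AE t in \<mu>. norm (f t) \<le> K" using f Lp_fun_infinity_iff by blast
  have "integrable \<mu> (\<lambda>t. K)" using continuous_on_integrable_lebesgue_on[of a b "\<lambda>t. K"] by simp
  then show ?thesis
    by (rule Bochner_Integration.integrable_bound)
      (use K Lp_fun_measurable[OF f] in \<open>auto elim!: eventually_mono\<close>)
next
  case False
  define q where "q = enn2real p"
  have q: "1 \<le> q" unfolding q_def by (rule enn2real_ge_1[OF one_le_p False])
  show ?thesis
  proof (rule Bochner_Integration.integrable_bound)
    show "integrable \<mu> (\<lambda>t. 1 + norm (f t) powr q)"
      using f False continuous_on_integrable_lebesgue_on[of a b "\<lambda>t. 1::real"]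
      by (simp add: Lp_fun_def q_def)
    show "AE t in \<mu>. norm (f t) \<le> norm (1 + norm (f t) powr q)"
    proof (intro always_eventually allI)
      fix t
      have "norm (f t) \<le> 1 \<or> norm (f t) powr 1 \<le> norm (f t) powr q"
        using q powr_mono[of 1 q "norm (f t)"] by linarith
      moreover have "0 \<le> norm (f t) powr q" "0 \<le> norm (f t)" by auto
      ultimately show "norm (f t) \<le> norm (1 + norm (f t) powr q)"
        by (auto simp del: powr_ge_zero norm_ge_zero)
    qed
  qed (rule Lp_fun_measurable[OF f])
qed

lemma Lp_fun_AE_cong:
  fixes f g :: "real \<Rightarrow> 'v::euclidean_space"
  assumes f: "Lp_fun p a b f" and ae: "AE t in \<mu>. f t = g t"
  shows "Lp_fun p a b g"
proof (rule Lp_fun_mono[OF f borel_measurable_lebesgue_on_AE[OF Lp_fun_measurable[OF f] ae], where C=1])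
  show "AE t in \<mu>. norm (g t) \<le> 1 * norm (f t)" using ae by eventually_elim simp
qed

lemma Lp_fun_linear:
  fixes T :: "'u::euclidean_space \<Rightarrow> 'v::euclidean_space"
  assumes T: "bounded_linear T" and f: "Lp_fun p a b f"
  shows "Lp_fun p a b (\<lambda>t. T (f t))"
proof -
  obtain K where K: "\<And>x. norm (T x) \<le> norm x * K" using bounded_linear.bounded[OF T] by blast
  have "continuous_on UNIV T" using T by (simp add: linear_continuous_on)
  then have "T \<in> borel_measurable borel" by (rule borel_measurable_continuous_onI)
  then have "(\<lambda>t. T (f t)) \<in> borel_measurable \<mu>"
    using Lp_fun_measurable[OF f] by (rule measurable_compose[rotated])
  then show ?thesis
    by (rule Lp_fun_mono[OF f, where C=K]) (use K in \<open>auto simp: mult.commute\<close>)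
qed

lemma Lp_fun_bilinear:
  fixes prod :: "'u::euclidean_space \<Rightarrow> 'v::euclidean_space \<Rightarrow> 'w::euclidean_space"
  assumes bl: "bounded_bilinear prod" and f: "Lp_fun p a b f" and g: "continuous_on {a..b} g"
  shows "Lp_fun p a b (\<lambda>t. prod (f t) (g t))"
proof -
  interpret bounded_bilinear prod by (fact bl)
  obtain C where C: "C > 0" "\<And>t. t \<in> {a..b} \<Longrightarrow> norm (g t) \<le> C" using continuous_on_interval_bound[OF g] by blast
  obtain K where K: "K > 0" "\<And>x y. norm (prod x y) \<le> norm x * norm y * K" using pos_bounded by blast
  have cont2: "continuous_on UNIV (\<lambda>x. prod (fst x) (snd x))"
    by (intro continuous_on continuous_intros)
  have mg: "g \<in> borel_measurable \<mu>" using continuous_on_integrable_lebesgue_on[OF g] by simp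
  show ?thesis
  proof (rule Lp_fun_mono[OF f, where C="C * K"])
    show "(\<lambda>t. prod (f t) (g t)) \<in> borel_measurable \<mu>"
      using borel_measurable_continuous_Pair[OF Lp_fun_measurable[OF f] mg cont2] by simp
    show "AE t in \<mu>. norm (prod (f t) (g t)) \<le> C * K * norm (f t)"
    proof (rule AE_I2)
      fix t assume "t \<in> space \<mu>"
      then have "norm (f t) * norm (g t) * K \<le> norm (f t) * C * K"
        using C K by (intro mult_right_mono mult_left_mono) auto
      then show "norm (prod (f t) (g t)) \<le> C * K * norm (f t)"
        using order_trans[OF K(2)] by (simp add: mult_ac)
    qed
  qed
qed

end

section \<open>Sobolev functions as iterated primitives\<close>

context lp_interval
begin

abbreviation "W \<equiv> sobolev_fun p"
abbreviation "D \<equiv> deriv_on a b"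
abbreviation "DD \<equiv> nth_deriv a b"

lemma nth_deriv_0 [simp]: "DD 0 y = y"
  by (simp add: nth_deriv_def)

lemma nth_deriv_Suc: "DD (Suc k) y = DD k (D y)"
  by (simp add: nth_deriv_def funpow_Suc_right del: funpow.simps)

lemma nth_deriv_Suc_outer: "DD (Suc k) y = D (DD k y)"
  by (simp add: nth_deriv_def)

lemma deriv_on_outside: "t \<notin> {a..b} \<Longrightarrow> D y t = 0"
  by (auto simp: deriv_on_def)

lemma sobolev_fun_outside: "y \<in> W s a b \<Longrightarrow> t \<notin> {a..b} \<Longrightarrow> y t = 0"
  by (simp add: sobolev_fun_def)

lemma sobolev_fun_0_iff: "y \<in> W 0 a b \<longleftrightarrow> (\<forall>t. t \<notin> {a..b} \<longrightarrow> y t = 0) \<and> Lp_fun p a b y"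
  by (simp add: sobolev_fun_def)

lemma deriv_on_eq:
  fixes y :: "real \<Rightarrow> 'v::euclidean_space"
  assumes "(y has_vector_derivative z) (at t within {a..b})" "t \<in> {a..b}"
  shows "D y t = z"
  using vector_derivative_within_closed_interval[OF a_less_b assms(2,1)] assms(2) by (simp add: deriv_on_def)

lemma deriv_on_works:
  assumes "y differentiable (at t within {a..b})" "t \<in> {a..b}"
  shows "(y has_vector_derivative D y t) (at t within {a..b})"
  using assms by (simp add: deriv_on_def vector_derivative_works)

text \<open>Together with \<open>sobolev_fun_0_iff\<close>, the following two equivalences replace the definition of
  \<open>sobolev_fun\<close> by a recursion on the order; orders 0 and 1 are separate
  because only there the function itself or its first derivative is determined merely almost
  everywhere.\<close>

lemma sobolev_fun_1_iff:
  "y \<in> W (Suc 0) a b \<longleftrightarrow> (\<forall>t. t \<notin> {a..b} \<longrightarrow> y t = 0) \<and> continuous_on {a..b} y \<and>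
     abs_continuous_on a b y \<and> (AE t in \<mu>. y differentiable (at t within {a..b})) \<and> D y \<in> W 0 a b"
  by (auto simp: sobolev_fun_def nth_deriv_Suc deriv_on_outside)

lemma sobolev_fun_Suc_Suc_iff:
  "y \<in> W (Suc (Suc s)) a b \<longleftrightarrow> (\<forall>t. t \<notin> {a..b} \<longrightarrow> y t = 0) \<and> continuous_on {a..b} y \<and>
     (\<forall>t\<in>{a..b}. y differentiable (at t within {a..b})) \<and> D y \<in> W (Suc s) a b"
  unfolding sobolev_fun_def mem_Collect_eq
  by (simp only: Suc_less_eq All_less_Suc2 nth_deriv_Suc nth_deriv_0 diff_Suc_1 zero_less_Suc)
    (auto simp: deriv_on_outside)

lemma sobolev_fun_continuous_on: "y \<in> W (Suc s) a b \<Longrightarrow> continuous_on {a..b} y"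
  by (cases s) (auto simp: sobolev_fun_1_iff sobolev_fun_Suc_Suc_iff)

lemma sobolev_fun_deriv: "y \<in> W (Suc s) a b \<Longrightarrow> D y \<in> W s a b"
  by (cases s) (auto simp: sobolev_fun_1_iff sobolev_fun_Suc_Suc_iff)

lemma continuous_on_imp_sobolev_fun_0:
  fixes y :: "real \<Rightarrow> 'v::euclidean_space"
  shows "continuous_on {a..b} y \<Longrightarrow> (\<And>t. t \<notin> {a..b} \<Longrightarrow> y t = 0) \<Longrightarrow> y \<in> W 0 a b"
  by (simp add: sobolev_fun_0_iff continuous_on_imp_Lp_fun)

lemma sobolev_fun_Lp_fun:
  fixes y :: "real \<Rightarrow> 'v::euclidean_space"
  assumes "y \<in> W s a b" shows "Lp_fun p a b y"
  using assms sobolev_fun_continuous_on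
  by (cases s) (auto simp: sobolev_fun_0_iff intro: continuous_on_imp_Lp_fun)

lemma sobolev_fun_primitive:
  fixes y :: "real \<Rightarrow> 'v::euclidean_space"
  assumes y: "y \<in> W (Suc s) a b"
  shows "ac_primitive a b (D y) y"
proof (cases s)
  case 0
  then have y': "abs_continuous_on a b y" "AE t in \<mu>. y differentiable (at t within {a..b})" "Lp_fun p a b (D y)"
    using y by (auto simp: sobolev_fun_1_iff sobolev_fun_0_iff)
  show ?thesis
  proof (rule ac_primitiveI[OF Lp_fun_integrable[OF y'(3)] y'(1)])
    show "AE t in \<mu>. (y has_vector_derivative D y t) (at t within {a..b})"
      using y'(2) AE_space by eventually_elim (simp add: deriv_on_works)
  qed
next
  case (Suc s')
  then have d: "(y has_vector_derivative D y t) (at t within {a..b})" if "t \<in> {a..b}" for t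
    using y that by (auto simp: sobolev_fun_Suc_Suc_iff deriv_on_works)
  have "continuous_on {a..b} (D y)"
    using sobolev_fun_continuous_on[of "D y" s'] sobolev_fun_deriv[OF y] Suc by simp
  moreover have "y t = y a + integral {a..t} (D y)" if t: "t \<in> {a..b}" for t
  proof -
    have "(D y has_integral (y t - y a)) {a..t}"
    proof (rule fundamental_theorem_of_calculus)
      fix x assume "x \<in> {a..t}"
      then have "(y has_vector_derivative D y x) (at x within {a..b})" using d t by auto
      then show "(y has_vector_derivative D y x) (at x within {a..t})"
        by (rule has_vector_derivative_within_subset) (use t in auto)
    qed (use t in auto)
    then have "integral {a..t} (D y) = y t - y a" by (rule integral_unique)
    then show ?thesis by simp
  qed
  ultimately show ?thesis
    unfolding ac_primitive_def using continuous_on_integrable_lebesgue_on by blast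
qed

text \<open>For \<open>s = 0\<close> the derivative is known only almost everywhere; for \<open>s > 0\<close> the function \<open>z\<close> is
  continuous and the derivative is \<open>z\<close> everywhere, endpoints included.\<close>

lemma primitive_sobolev_fun:
  fixes y z :: "real \<Rightarrow> 'v::euclidean_space"
  assumes z: "z \<in> W s a b" and zy: "ac_primitive a b z y" and y: "\<And>t. t \<notin> {a..b} \<Longrightarrow> y t = 0"
  shows "y \<in> W (Suc s) a b" and "AE t in \<mu>. D y t = z t" and "0 < s \<Longrightarrow> D y = z"
proof -
  have d: "AE t in \<mu>. (y has_vector_derivative z t) (at t within {a..b})"
    by (rule ac_primitive_AE_deriv[OF zy])
  then show ae: "AE t in \<mu>. D y t = z t"
    using AE_space by eventually_elim (simp add: deriv_on_eq)
  have dS: "(y has_vector_derivative z t) (at t within {a..b})" if "0 < s" "t \<in> {a..b}" for t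
  proof -
    have "continuous_on {a..b} z" using z that(1) sobolev_fun_continuous_on[of z "s - 1"] by simp
    then show ?thesis using ac_primitive_deriv[OF zy _ that(2)] by blast
  qed
  show Dz: "D y = z" if "0 < s"
  proof
    fix t show "D y t = z t"
      using deriv_on_eq[OF dS[OF that, of t]] deriv_on_outside[of t y] sobolev_fun_outside[OF z, of t]
      by (cases "t \<in> {a..b}") auto
  qed
  show "y \<in> W (Suc s) a b"
  proof (cases s)
    case 0
    have "AE t in \<mu>. y differentiable (at t within {a..b})"
      using d by eventually_elim (auto simp: differentiable_def has_vector_derivative_def)
    moreover have "Lp_fun p a b (D y)"
    proof (rule Lp_fun_AE_cong)
      show "Lp_fun p a b z" using z 0 by (simp add: sobolev_fun_0_iff)
      show "AE t in \<mu>. z t = D y t" using ae by eventually_elim simp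
    qed
    ultimately show ?thesis
      using y 0 ac_primitive_continuous_on[OF zy] ac_primitive_abs_continuous_on[OF zy]
      by (simp add: sobolev_fun_1_iff sobolev_fun_0_iff deriv_on_outside)
  next
    case (Suc s')
    then have "\<forall>t\<in>{a..b}. y differentiable (at t within {a..b})"
      using dS differentiableI_vector by blast
    then show ?thesis
      using Suc y Dz z ac_primitive_continuous_on[OF zy]
      by (simp add: sobolev_fun_Suc_Suc_iff)
  qed
qed

lemma sobolev_fun_Suc_subset:
  fixes y :: "real \<Rightarrow> 'v::euclidean_space"
  shows "y \<in> W (Suc s) a b \<Longrightarrow> y \<in> W s a b"
proof (induction s arbitrary: y)
  case 0
  then show ?case
    using continuous_on_imp_sobolev_fun_0[OF sobolev_fun_continuous_on] sobolev_fun_outside by blast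
next
  case (Suc s)
  show ?case
    using primitive_sobolev_fun(1)[OF Suc.IH[OF sobolev_fun_deriv[OF Suc.prems]]
        sobolev_fun_primitive[OF Suc.prems]] sobolev_fun_outside[OF Suc.prems] by blast
qed

lemma sobolev_fun_antimono:
  fixes y :: "real \<Rightarrow> 'v::euclidean_space"
  assumes "s \<le> s'" "y \<in> W s' a b" shows "y \<in> W s a b"
  using assms by (induction rule: dec_induct) (auto dest: sobolev_fun_Suc_subset)

lemma sobolev_fun_nth_deriv:
  fixes y :: "real \<Rightarrow> 'v::euclidean_space"
  shows "y \<in> W (s + k) a b \<Longrightarrow> DD k y \<in> W s a b"
  by (induction k arbitrary: y) (auto simp: nth_deriv_Suc dest: sobolev_fun_deriv)

text \<open>Two linear maps at once, so that sums, scalar multiples, differences and columns of matrices are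
  all instances.\<close>

lemma sobolev_fun_linear_comb:
  fixes y1 :: "real \<Rightarrow> 'u::euclidean_space" and y2 :: "real \<Rightarrow> 'v::euclidean_space"
    and T1 :: "'u \<Rightarrow> 'w::euclidean_space" and T2 :: "'v \<Rightarrow> 'w"
  assumes T: "bounded_linear T1" "bounded_linear T2"
    and y: "y1 \<in> W s a b" "y2 \<in> W s a b"
  shows sobolev_fun_linear_comb_mem: "(\<lambda>t. T1 (y1 t) + T2 (y2 t)) \<in> W s a b" (is ?mem)
    and nth_deriv_linear_comb_AE: "\<And>k. k \<le> s \<Longrightarrow> AE t in \<mu>. DD k (\<lambda>t. T1 (y1 t) + T2 (y2 t)) t = T1 (DD k y1 t) + T2 (DD k y2 t)" (is "\<And>k. PROP ?ae k")
    and nth_deriv_linear_comb: "\<And>k. k < s \<Longrightarrow> DD k (\<lambda>t. T1 (y1 t) + T2 (y2 t)) = (\<lambda>t. T1 (DD k y1 t) + T2 (DD k y2 t))" (is "\<And>k. PROP ?eq k")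
proof -
  note T0 = linear_0[OF bounded_linear.linear[OF T(1)]] linear_0[OF bounded_linear.linear[OF T(2)]]
  have "(\<lambda>t. T1 (y1 t) + T2 (y2 t)) \<in> W s a b \<and>
    (\<forall>k\<le>s. AE t in \<mu>. DD k (\<lambda>t. T1 (y1 t) + T2 (y2 t)) t = T1 (DD k y1 t) + T2 (DD k y2 t)) \<and>
    (\<forall>k<s. DD k (\<lambda>t. T1 (y1 t) + T2 (y2 t)) = (\<lambda>t. T1 (DD k y1 t) + T2 (DD k y2 t)))"
    using y
  proof (induction s arbitrary: y1 y2)
    case 0
    then show ?case
      using Lp_fun_add[OF Lp_fun_linear[OF T(1)] Lp_fun_linear[OF T(2)]] T0 by (simp add: sobolev_fun_0_iff)
  next
    case (Suc s)
    let ?y = "\<lambda>t. T1 (y1 t) + T2 (y2 t)" and ?z = "\<lambda>t. T1 (D y1 t) + T2 (D y2 t)"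
    note IH = Suc.IH[OF sobolev_fun_deriv[OF Suc.prems(1)] sobolev_fun_deriv[OF Suc.prems(2)]]
    have zy: "ac_primitive a b ?z ?y"
      by (rule ac_primitive_add[OF ac_primitive_linear[OF T(1) sobolev_fun_primitive[OF Suc.prems(1)]]
            ac_primitive_linear[OF T(2) sobolev_fun_primitive[OF Suc.prems(2)]]])
    have y0: "?y t = 0" if "t \<notin> {a..b}" for t
      using sobolev_fun_outside[OF Suc.prems(1) that] sobolev_fun_outside[OF Suc.prems(2) that] T0 by simp
    note Y = primitive_sobolev_fun[OF conjunct1[OF IH] zy y0]
    have ae: "AE t in \<mu>. DD k ?y t = T1 (DD k y1 t) + T2 (DD k y2 t)" if "k \<le> Suc s" for k
    proof (cases k)
      case (Suc k')
      show ?thesis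
      proof (cases "s = 0")
        case True
        then show ?thesis using Suc that Y(2) by (simp add: nth_deriv_Suc)
      next
        case False
        then show ?thesis using Suc that Y(3) IH by (simp add: nth_deriv_Suc)
      qed
    qed simp
    have eq: "DD k ?y = (\<lambda>t. T1 (DD k y1 t) + T2 (DD k y2 t))" if "k < Suc s" for k
      using that Y(3) IH by (cases k) (auto simp: nth_deriv_Suc)
    show ?case using Y(1) ae eq by blast
  qed
  then show ?mem and "\<And>k. PROP ?ae k" and "\<And>k. PROP ?eq k" by blast+
qed

lemma sobolev_fun_zero: "(\<lambda>t. 0 :: 'v::euclidean_space) \<in> W s a b"
  and nth_deriv_zero: "DD k (\<lambda>t. 0 :: 'v) = (\<lambda>t. 0)"
proof -
  have D0: "D (\<lambda>t. 0 :: 'v) = (\<lambda>t. 0)"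
    using deriv_on_eq[of "\<lambda>t. 0 :: 'v" 0] deriv_on_outside[of _ "\<lambda>t. 0 :: 'v"] by force
  show "DD k (\<lambda>t. 0 :: 'v) = (\<lambda>t. 0)"
    by (induction k) (auto simp: nth_deriv_Suc D0)
  show "(\<lambda>t. 0 :: 'v) \<in> W s a b"
  proof (induction s)
    case 0
    show ?case by (rule continuous_on_imp_sobolev_fun_0) auto
  next
    case (Suc s)
    show ?case
      by (rule primitive_sobolev_fun(1)[OF Suc])
        (auto simp: ac_primitive_def continuous_on_integrable_lebesgue_on)
  qed
qed

lemma sobolev_fun_add:
  fixes y1 y2 :: "real \<Rightarrow> 'v::euclidean_space"
  assumes "y1 \<in> W s a b" "y2 \<in> W s a b"
  shows "(\<lambda>t. y1 t + y2 t) \<in> W s a b"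
  using sobolev_fun_linear_comb_mem[OF bounded_linear_ident bounded_linear_ident assms] .

lemma sobolev_fun_linear:
  fixes y :: "real \<Rightarrow> 'u::euclidean_space" and T :: "'u \<Rightarrow> 'w::euclidean_space"
  assumes "bounded_linear T" "y \<in> W s a b"
  shows sobolev_fun_linear_mem: "(\<lambda>t. T (y t)) \<in> W s a b"
    and nth_deriv_linear: "k < s \<Longrightarrow> DD k (\<lambda>t. T (y t)) = (\<lambda>t. T (DD k y t))"
  using sobolev_fun_linear_comb[OF assms(1) bounded_linear_zero assms(2) assms(2)] by simp_all

lemma sobolev_fun_sum:
  fixes y :: "'i \<Rightarrow> real \<Rightarrow> 'v::euclidean_space"
  assumes "\<And>i. i \<in> I \<Longrightarrow> y i \<in> W s a b"
  shows "(\<lambda>t. \<Sum>i\<in>I. y i t) \<in> W s a b"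
  using assms by (induction I rule: infinite_finite_induct) (auto intro: sobolev_fun_zero sobolev_fun_add)

lemma sobolev_fun_bilinear_aux:
  fixes f :: "real \<Rightarrow> 'u::euclidean_space" and g :: "real \<Rightarrow> 'v::euclidean_space"
    and prod :: "'u \<Rightarrow> 'v \<Rightarrow> 'w::euclidean_space"
  assumes bl: "bounded_bilinear prod" and f: "f \<in> W (Suc s) a b" and g: "g \<in> W (Suc s) a b"
    and 1: "(\<lambda>t. prod (D f t) (g t)) \<in> W s a b" and 2: "(\<lambda>t. prod (f t) (D g t)) \<in> W s a b"
  shows "(\<lambda>t. prod (f t) (g t)) \<in> W (Suc s) a b"
proof (rule primitive_sobolev_fun(1)[OF sobolev_fun_add[OF 1 2]])
  show "ac_primitive a b (\<lambda>t. prod (D f t) (g t) + prod (f t) (D g t)) (\<lambda>t. prod (f t) (g t))"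
    by (rule ac_primitive_bilinear[OF bl sobolev_fun_primitive[OF f] sobolev_fun_primitive[OF g]])
  show "prod (f t) (g t) = 0" if "t \<notin> {a..b}" for t
    using sobolev_fun_outside[OF f that] bounded_bilinear.zero_left[OF bl] by simp
qed

text \<open>The induction carries both orders of the factors, since the product rule differentiates either of
  them. For \<open>s = 0\<close> the smoother factor is continuous, hence bounded, while for finite \<open>p\<close> two
  factors in \<open>L\<^sub>p\<close> need not have a product in \<open>L\<^sub>p\<close>.\<close>

lemma sobolev_fun_bilinear:
  fixes f :: "real \<Rightarrow> 'u::euclidean_space" and g :: "real \<Rightarrow> 'v::euclidean_space"
    and prod :: "'u \<Rightarrow> 'v \<Rightarrow> 'w::euclidean_space"
  assumes bl: "bounded_bilinear prod" and f: "f \<in> W s a b" and g: "g \<in> W (Suc s) a b"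
  shows "(\<lambda>t. prod (f t) (g t)) \<in> W s a b"
proof -
  have "(\<forall>f\<in>W s a b. \<forall>g\<in>W (Suc s) a b. (\<lambda>t. prod (f t) (g t)) \<in> W s a b) \<and>
        (\<forall>f\<in>W (Suc s) a b. \<forall>g\<in>W s a b. (\<lambda>t. prod (f t) (g t)) \<in> W s a b)"
  proof (induction s)
    case 0
    note bl' = bounded_bilinear.flip[OF bl]
    have "(\<lambda>t. prod (f t) (g t)) \<in> W 0 a b" if "f \<in> W 0 a b" "g \<in> W (Suc 0) a b" for f g
      using that Lp_fun_bilinear[OF bl _ sobolev_fun_continuous_on[OF that(2)]] bounded_bilinear.zero_left[OF bl]
      by (simp add: sobolev_fun_0_iff)
    moreover have "(\<lambda>t. prod (f t) (g t)) \<in> W 0 a b" if "f \<in> W (Suc 0) a b" "g \<in> W 0 a b" for f g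
      using that Lp_fun_bilinear[OF bl' _ sobolev_fun_continuous_on[OF that(1)]] bounded_bilinear.zero_right[OF bl]
      by (simp add: sobolev_fun_0_iff)
    ultimately show ?case by blast
  next
    case (Suc s)
    have "(\<lambda>t. prod (f t) (g t)) \<in> W (Suc s) a b" if "f \<in> W (Suc s) a b" "g \<in> W (Suc s) a b" for f g
      using Suc.IH that sobolev_fun_deriv[OF that(1)] sobolev_fun_deriv[OF that(2)]
      by (intro sobolev_fun_bilinear_aux[OF bl that]) blast+
    then show ?case
      using sobolev_fun_Suc_subset[where 'v='u and s="Suc s"] sobolev_fun_Suc_subset[where 'v='v and s="Suc s"]
      by blast
  qed
  then show ?thesis using f g by blast
qed

lemma sobolev_fun_algebra:
  fixes f :: "real \<Rightarrow> 'u::euclidean_space" and g :: "real \<Rightarrow> 'v::euclidean_space"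
    and prod :: "'u \<Rightarrow> 'v \<Rightarrow> 'w::euclidean_space"
  assumes bl: "bounded_bilinear prod" and f: "f \<in> W (Suc s) a b" and g: "g \<in> W (Suc s) a b"
  shows "(\<lambda>t. prod (f t) (g t)) \<in> W (Suc s) a b"
  using sobolev_fun_bilinear[OF bl sobolev_fun_deriv[OF f] g]
    sobolev_fun_bilinear[OF bounded_bilinear.flip[OF bl] sobolev_fun_deriv[OF g] f]
  by (rule sobolev_fun_bilinear_aux[OF bl f g])

text \<open>The gain of smoothness from the equation: if the highest derivative agrees almost everywhere
  with a smoother function \<open>h\<close>, then it can be replaced by \<open>h\<close> and integrated \<open>r + 1\<close> times.\<close>

lemma sobolev_fun_of_nth_deriv:
  fixes y h :: "real \<Rightarrow> 'v::euclidean_space"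
  assumes "y \<in> W (Suc r) a b" "h \<in> W s a b" "AE t in \<mu>. DD (Suc r) y t = h t"
  shows "y \<in> W (Suc r + s) a b"
  using assms
proof (induction r arbitrary: y)
  case 0
  have "ac_primitive a b h y"
  proof (rule ac_primitive_cong_AE[OF sobolev_fun_primitive[OF 0(1)]])
    show "h \<in> borel_measurable \<mu>" by (intro Lp_fun_measurable sobolev_fun_Lp_fun[OF 0(2)])
    show "AE t in \<mu>. D y t = h t" using 0(3) by (simp add: nth_deriv_Suc)
  qed
  then show ?case using primitive_sobolev_fun(1)[OF 0(2)] sobolev_fun_outside[OF 0(1)] by simp
next
  case (Suc r)
  have "D y \<in> W (Suc r + s) a b"
    using Suc.prems by (intro Suc.IH) (auto simp: nth_deriv_Suc dest: sobolev_fun_deriv)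
  then show ?case
    using primitive_sobolev_fun(1)[OF _ sobolev_fun_primitive[OF Suc.prems(1)]] sobolev_fun_outside[OF Suc.prems(1)] by simp
qed

end

section \<open>Linear Volterra equations\<close>

text \<open>The weight \<open>E = exp (2 \<Phi>)\<close>, where \<open>\<Phi>\<close> is the primitive of \<open>\<phi>\<close>, is absolutely continuous with
  \<open>E' = 2 \<phi> E\<close> almost everywhere. The factor 2 is what makes the Volterra operator below a contraction with constant
  1/2 on the whole interval.\<close>

lemma exp_weight_integral:
  fixes \<phi> :: "real \<Rightarrow> real"
  assumes \<phi>: "integrable (lebesgue_on {a..b}) \<phi>" and ab: "a \<le> b"
  defines "E \<equiv> (\<lambda>t. exp (2 * integral {a..t} \<phi>))"
  shows "continuous_on {a..b} E" and "integrable (lebesgue_on {a..b}) (\<lambda>t. \<phi> t * E t)"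
    and "t \<in> {a..b} \<Longrightarrow> integral {a..t} (\<lambda>s. \<phi> s * E s) \<le> E t / 2"
proof -
  define \<Phi> where "\<Phi> t = integral {a..t} \<phi>" for t
  have \<Phi>: "ac_primitive a b \<phi> \<Phi>" using \<phi> by (simp add: ac_primitive_def \<Phi>_def)
  have E: "E t = exp (2 * \<Phi> t)" for t by (simp add: E_def \<Phi>_def)
  have c\<Phi>: "continuous_on {a..b} \<Phi>" by (rule ac_primitive_continuous_on[OF \<Phi>])
  show cE: "continuous_on {a..b} E" unfolding E by (intro continuous_intros c\<Phi>)
  obtain R where R: "\<And>t. t \<in> {a..b} \<Longrightarrow> norm (\<Phi> t) \<le> R" using continuous_on_interval_bound[OF c\<Phi>] by blast
  obtain C where C: "C > 0" "\<And>t. t \<in> {a..b} \<Longrightarrow> norm (E t) \<le> C" using continuous_on_interval_bound[OF cE] by blast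
  have mE: "E \<in> borel_measurable (lebesgue_on {a..b})" using continuous_on_integrable_lebesgue_on[OF cE] by simp
  show i: "integrable (lebesgue_on {a..b}) (\<lambda>t. \<phi> t * E t)"
  proof (rule Bochner_Integration.integrable_bound)
    show "integrable (lebesgue_on {a..b}) (\<lambda>t. C * norm (\<phi> t))" using \<phi> by simp
    show "AE t in lebesgue_on {a..b}. norm (\<phi> t * E t) \<le> norm (C * norm (\<phi> t))"
    proof (rule AE_I2)
      fix t assume "t \<in> space (lebesgue_on {a..b})"
      then have "\<bar>E t\<bar> * \<bar>\<phi> t\<bar> \<le> C * \<bar>\<phi> t\<bar>" using C by (intro mult_right_mono) auto
      then show "norm (\<phi> t * E t) \<le> norm (C * norm (\<phi> t))" using C(1) by (simp add: abs_mult mult.commute)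
    qed
  qed (use borel_measurable_integrable[OF \<phi>] mE in measurable)
  have "ac_primitive a b (\<lambda>t. 2 * (\<phi> t * E t)) E"
  proof (rule ac_primitiveI)
    show "integrable (lebesgue_on {a..b}) (\<lambda>t. 2 * (\<phi> t * E t))" using i by simp
    have lip: "norm (E s - E t) \<le> (2 * exp (2 * R)) * norm (\<Phi> s - \<Phi> t)"
      if st: "s \<in> {a..b}" "t \<in> {a..b}" "\<Phi> t \<le> \<Phi> s" for s t
    proof -
      \<comment> \<open>Convexity of the exponential function gives the Lipschitz bound.\<close>
      have "1 + 2 * (\<Phi> t - \<Phi> s) \<le> exp (2 * (\<Phi> t - \<Phi> s))" by (rule exp_ge_add_one_self)
      then have "exp (2 * \<Phi> s) * (1 + 2 * (\<Phi> t - \<Phi> s)) \<le> exp (2 * \<Phi> s) * exp (2 * (\<Phi> t - \<Phi> s))"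
        by (rule mult_left_mono) simp
      also have "\<dots> = E t" by (simp add: E flip: exp_add)
      finally have "E s - E t \<le> exp (2 * \<Phi> s) * (2 * (\<Phi> s - \<Phi> t))" by (simp add: E algebra_simps)
      also have "\<dots> \<le> exp (2 * R) * (2 * (\<Phi> s - \<Phi> t))"
        using R[OF st(1)] st(3) by (intro mult_right_mono) auto
      finally show ?thesis using st(3) by (simp add: E algebra_simps)
    qed
    show "abs_continuous_on a b E"
    proof (rule abs_continuous_on_bound[OF ac_primitive_abs_continuous_on[OF \<Phi>] ac_primitive_abs_continuous_on[OF \<Phi>]])
      show "0 \<le> 2 * exp (2 * R)" by simp
      fix s t assume st: "s \<in> {a..b}" "t \<in> {a..b}"
      have "norm (E s - E t) \<le> (2 * exp (2 * R)) * norm (\<Phi> s - \<Phi> t)"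
        using lip[of s t] lip[of t s] st by (cases "\<Phi> t \<le> \<Phi> s") (auto simp: norm_minus_commute)
      also have "\<dots> \<le> (2 * exp (2 * R)) * (norm (\<Phi> s - \<Phi> t) + norm (\<Phi> s - \<Phi> t))"
        by (intro mult_left_mono) auto
      finally show "norm (E s - E t) \<le> (2 * exp (2 * R)) * (norm (\<Phi> s - \<Phi> t) + norm (\<Phi> s - \<Phi> t))" .
    qed
    show "AE t in lebesgue_on {a..b}. (E has_vector_derivative 2 * (\<phi> t * E t)) (at t within {a..b})"
      using ac_primitive_AE_deriv[OF \<Phi>]
    proof eventually_elim
      case (elim t)
      then have "(\<Phi> has_real_derivative \<phi> t) (at t within {a..b})"
        by (simp add: has_real_derivative_iff_has_vector_derivative)
      then have "((\<lambda>t. exp (2 * \<Phi> t)) has_real_derivative 2 * (\<phi> t * exp (2 * \<Phi> t))) (at t within {a..b})"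
        by (auto intro!: derivative_eq_intros)
      then show ?case by (simp add: has_real_derivative_iff_has_vector_derivative E[abs_def])
    qed
  qed
  from ac_primitive_eq[OF this] show "integral {a..t} (\<lambda>s. \<phi> s * E s) \<le> E t / 2" if "t \<in> {a..b}"
    using that by (simp add: E_def)
qed

text \<open>The equation \<open>u(t) = c + \<integral>\<^sub>a\<^sup>t (F(s) u(s) + f(s)) ds\<close>, with an integrable bound \<open>\<phi>\<close> for the operator
  norm of \<open>F(t)\<close>. Measurability is asked for each fixed vector only; \<open>integrable_F\<close> extends it to
  continuous \<open>u\<close> by expanding in a basis.\<close>

locale volterra =
  fixes a b :: real and F :: "real \<Rightarrow> 'v::euclidean_space \<Rightarrow> 'v" and \<phi> :: "real \<Rightarrow> real"
  assumes ab: "a < b"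
    and lin: "\<And>t. linear (F t)"
    and bound: "\<And>t v. norm (F t v) \<le> \<phi> t * norm v"
    and meas: "\<And>v. (\<lambda>t. F t v) \<in> borel_measurable (lebesgue_on {a..b})"
    and \<phi>_int: "integrable (lebesgue_on {a..b}) \<phi>"
begin

abbreviation "\<mu> \<equiv> lebesgue_on {a..b}"

definition "weight t = exp (2 * integral {a..t} \<phi>)"

lemma weight_pos: "weight t > 0" by (simp add: weight_def)

lemmas weight_props = exp_weight_integral[OF \<phi>_int less_imp_le[OF ab], folded weight_def]

lemma \<phi>_nonneg: "0 \<le> \<phi> t"
proof -
  obtain i :: 'v where "i \<in> Basis" using nonempty_Basis by blast
  then show ?thesis using order_trans[OF norm_ge_zero bound[of t i]] by simp
qed

lemma integrable_F:
  assumes u: "continuous_on {a..b} u"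
  shows "integrable \<mu> (\<lambda>t. F t (u t))"
proof -
  obtain C where C: "C > 0" "\<And>t. t \<in> {a..b} \<Longrightarrow> norm (u t) \<le> C" using continuous_on_interval_bound[OF u] by blast
  have mu: "u \<in> borel_measurable \<mu>" using continuous_on_integrable_lebesgue_on[OF u] by simp
  have "F t (u t) = (\<Sum>i\<in>Basis. (u t \<bullet> i) *\<^sub>R F t i)" for t
    using euclidean_representation[of "u t"] linear_sum[OF lin, of t "\<lambda>i. (u t \<bullet> i) *\<^sub>R i" Basis] linear_scale[OF lin]
    by simp
  then have m: "(\<lambda>t. F t (u t)) \<in> borel_measurable \<mu>"
    using mu meas by simp
  show ?thesis
  proof (rule Bochner_Integration.integrable_bound[OF _ m])
    show "integrable \<mu> (\<lambda>t. C * \<phi> t)" using \<phi>_int by simp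
    show "AE t in \<mu>. norm (F t (u t)) \<le> norm (C * \<phi> t)"
    proof (rule AE_I2)
      fix t assume t: "t \<in> space \<mu>"
      have "norm (F t (u t)) \<le> \<phi> t * norm (u t)" by (rule bound)
      also have "\<dots> \<le> \<phi> t * C" using C(2) t \<phi>_nonneg by (intro mult_left_mono) auto
      finally show "norm (F t (u t)) \<le> norm (C * \<phi> t)" using C(1) \<phi>_nonneg[of t] by (simp add: abs_mult mult.commute)
    qed
  qed
qed

text \<open>The contraction estimate: integrating \<open>F u\<close> at least halves the supremum of \<open>norm (u t) / weight t\<close>.\<close>

lemma weighted_bound:
  assumes u: "continuous_on {a..b} u" and M: "\<And>s. s \<in> {a..b} \<Longrightarrow> norm (u s) \<le> M * weight s" and t: "t \<in> {a..b}"
  shows "norm (integral {a..t} (\<lambda>s. F s (u s))) \<le> M * weight t / 2"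
proof -
  have M0: "0 \<le> M"
    using order_trans[OF norm_ge_zero M[OF t]] weight_pos[of t] by (simp add: zero_le_mult_iff)
  have sub: "{a..t} \<subseteq> {a..b}" using t by auto
  have i1: "(\<lambda>s. F s (u s)) integrable_on {a..t}"
    by (rule integrable_subinterval_real[OF integrable_on_interval[OF integrable_F[OF u]] sub])
  have i2: "(\<lambda>s. \<phi> s * weight s) integrable_on {a..t}"
    by (rule integrable_subinterval_real[OF integrable_on_interval[OF weight_props(2)] sub])
  have "norm (integral {a..t} (\<lambda>s. F s (u s))) \<le> integral {a..t} (\<lambda>s. M * (\<phi> s * weight s))"
  proof (rule Henstock_Kurzweil_Integration.integral_norm_bound_integral[OF i1])
    show "(\<lambda>s. M * (\<phi> s * weight s)) integrable_on {a..t}" using integrable_on_cmult_left[OF i2, of M] by simp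
    fix s assume s: "s \<in> {a..t}"
    have "norm (F s (u s)) \<le> \<phi> s * norm (u s)" by (rule bound)
    also have "\<dots> \<le> \<phi> s * (M * weight s)" using s sub by (intro mult_left_mono M \<phi>_nonneg) auto
    finally show "norm (F s (u s)) \<le> M * (\<phi> s * weight s)" by (simp add: mult_ac)
  qed
  also have "\<dots> = M * integral {a..t} (\<lambda>s. \<phi> s * weight s)" by simp
  also have "\<dots> \<le> M * (weight t / 2)" by (intro mult_left_mono weight_props(3) t M0)
  finally show ?thesis by simp
qed

lemma homogeneous_zero:
  assumes u: "ac_primitive a b (\<lambda>t. F t (u t)) u" and u0: "u a = 0" and t: "t \<in> {a..b}"
  shows "u t = 0"
proof -
  note cu = ac_primitive_continuous_on[OF u]
  have "continuous_on {a..b} (\<lambda>t. norm (u t) / weight t)"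
    using weight_pos by (intro continuous_intros cu weight_props(1)) (auto simp: less_imp_neq[symmetric])
  \<comment> \<open>At a maximum point of the weighted norm the maximum \<open>M\<close> satisfies \<open>M \<le> M/2\<close>.\<close>
  then have "\<exists>t0\<in>{a..b}. \<forall>s\<in>{a..b}. norm (u s) / weight s \<le> norm (u t0) / weight t0"
    using ab by (intro continuous_attains_sup) auto
  then obtain t0 where t0: "t0 \<in> {a..b}" "\<And>s. s \<in> {a..b} \<Longrightarrow> norm (u s) / weight s \<le> norm (u t0) / weight t0"
    by blast
  define M where "M = norm (u t0) / weight t0"
  have M: "norm (u s) \<le> M * weight s" if "s \<in> {a..b}" for s
    using t0(2)[OF that] weight_pos[of s] by (simp add: M_def field_simps)
  have "u t0 = integral {a..t0} (\<lambda>s. F s (u s))" using ac_primitive_eq[OF u t0(1)] u0 by simp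
  then have "norm (u t0) \<le> M * weight t0 / 2" using weighted_bound[OF cu M t0(1)] by simp
  then have "M \<le> M / 2" using weight_pos[of t0] unfolding M_def by (simp add: field_simps)
  then have "M \<le> 0" by simp
  then have "norm (u t) \<le> 0" using M[OF t] weight_pos[of t] mult_nonpos_nonneg[of M "weight t"] by linarith
  then show ?thesis by simp
qed

text \<open>Banach's fixed point theorem for \<open>v = u / weight\<close>, in the plain supremum norm. Clamping
  the argument extends a continuous function on the interval to a bounded continuous function on
  the real line; these form a complete space.\<close>

lemma solution_exists:
  assumes f: "integrable \<mu> f"
  obtains u where "ac_primitive a b (\<lambda>t. F t (u t) + f t) u" "u a = c"
proof -
  define H where "H v t = (1 / weight t) *\<^sub>R (c + integral {a..t} (\<lambda>s. F s (weight s *\<^sub>R v s) + f s))"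
    for v :: "real \<Rightarrow> 'v" and t
  have cw: "continuous_on {a..b} (\<lambda>s. weight s *\<^sub>R v s)" if "continuous_on {a..b} v" for v :: "real \<Rightarrow> 'v"
    by (intro continuous_intros weight_props(1) that)
  have int: "integrable \<mu> (\<lambda>s. F s (weight s *\<^sub>R v s) + f s)" if "continuous_on {a..b} v" for v
    using integrable_F[OF cw[OF that]] f by simp
  have cv: "continuous_on {a..b} (apply_bcontfun v)" for v :: "real \<Rightarrow>\<^sub>C 'v"
    using continuous_on_subset[OF continuous_on_apply_bcontfun] by blast
  have "\<exists>g :: real \<Rightarrow>\<^sub>C 'v. \<forall>x. apply_bcontfun g x = H (apply_bcontfun v) (clamp a b x)" for v :: "real \<Rightarrow>\<^sub>C 'v"
  proof -
    have "continuous_on {a..b} (H (apply_bcontfun v))"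
      unfolding H_def using weight_pos
      by (intro continuous_intros weight_props(1) indefinite_integral_continuous_1 integrable_on_interval int cv)
        (auto simp: less_imp_neq[symmetric])
    then have "continuous_on (cbox a b) (H (apply_bcontfun v))" by simp
    then show ?thesis by (rule continuous_on_cbox_bcontfunE) blast
  qed
  then obtain T :: "(real \<Rightarrow>\<^sub>C 'v) \<Rightarrow> (real \<Rightarrow>\<^sub>C 'v)"
    where T: "\<And>v x. apply_bcontfun (T v) x = H (apply_bcontfun v) (clamp a b x)" by metis
  have contr: "dist (T v) (T w) \<le> (1/2) * dist v w" for v w
  proof (rule dist_bound)
    fix x
    define t where "t = clamp a b x"
    have t: "t \<in> {a..b}" using clamp_in_interval[of a b x] ab by (simp add: t_def)
    have sub: "{a..t} \<subseteq> {a..b}" using t by auto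
    have ion: "(\<lambda>s. F s (weight s *\<^sub>R v s) + f s) integrable_on {a..t}" for v :: "real \<Rightarrow>\<^sub>C 'v"
      by (rule integrable_subinterval_real[OF integrable_on_interval[OF int[OF cv]] sub])
    have "integral {a..t} (\<lambda>s. F s (weight s *\<^sub>R v s) + f s) - integral {a..t} (\<lambda>s. F s (weight s *\<^sub>R w s) + f s)
        = integral {a..t} (\<lambda>s. (F s (weight s *\<^sub>R v s) + f s) - (F s (weight s *\<^sub>R w s) + f s))"
      by (rule Henstock_Kurzweil_Integration.integral_diff[symmetric, OF ion ion])
    also have "\<dots> = integral {a..t} (\<lambda>s. F s (weight s *\<^sub>R (v s - w s)))"
      by (simp add: scaleR_diff_right linear_diff[OF lin])
    finally have "H v t - H w t = (1 / weight t) *\<^sub>R integral {a..t} (\<lambda>s. F s (weight s *\<^sub>R (v s - w s)))"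
      by (simp add: H_def flip: scaleR_diff_right)
    moreover have "norm (integral {a..t} (\<lambda>s. F s (weight s *\<^sub>R (v s - w s)))) \<le> dist v w * weight t / 2"
    proof (rule weighted_bound[OF _ _ t])
      show "continuous_on {a..b} (\<lambda>s. weight s *\<^sub>R (v s - w s))"
        by (intro cw continuous_on_diff cv)
      fix s
      have "norm (v s - w s) \<le> dist v w" using dist_bounded[of v s w] by (simp add: dist_norm)
      then show "norm (weight s *\<^sub>R (v s - w s)) \<le> dist v w * weight s"
        using weight_pos[of s] by (simp add: mult.commute mult_left_mono)
    qed
    ultimately have "norm (H v t - H w t) \<le> (1 / weight t) * (dist v w * weight t / 2)"
      using weight_pos[of t] by (simp add: pos_divide_le_eq)
    then show "dist (T v x) (T w x) \<le> (1/2) * dist v w"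
      using weight_pos[of t] by (simp add: T dist_norm flip: t_def)
  qed
  have "\<exists>!v. T v = v" using contr by (intro banach_fix_type[of "1/2"]) auto
  then obtain v where v: "T v = v" by blast
  define u where "u t = weight t *\<^sub>R apply_bcontfun v t" for t
  have ut: "u t = c + integral {a..t} (\<lambda>s. F s (u s) + f s)" if t: "t \<in> {a..b}" for t
  proof -
    have "apply_bcontfun v t = H v t" using T[of v t] v t by simp
    then show ?thesis using weight_pos[of t] by (simp add: u_def H_def)
  qed
  have ua: "u a = c" using ut[of a] ab by simp
  have "ac_primitive a b (\<lambda>t. F t (u t) + f t) u"
    unfolding ac_primitive_def using ut ua int[OF cv[of v]] by (simp add: u_def)
  then show thesis using ua that by blast
qed

end

section \<open>The Cauchy problem for linear equations of order r\<close>

lemma ac_primitive_cong: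
  assumes y: "ac_primitive a b z y" and eq: "\<And>t. t \<in> {a..b} \<Longrightarrow> z' t = z t" "\<And>t. t \<in> {a..b} \<Longrightarrow> y' t = y t"
  shows "ac_primitive a b z' y'"
  unfolding ac_primitive_def
proof (intro conjI ballI)
  show "integrable (lebesgue_on {a..b}) z'"
    using ac_primitive_integrable[OF y] eq(1) by (subst Bochner_Integration.integrable_cong[OF refl]) auto
  fix t assume t: "t \<in> {a..b}"
  have "integral {a..t} z' = integral {a..t} z" using t eq(1) by (intro integral_cong) auto
  moreover have "y' t = y t" "y' a = y a" using t by (auto intro: eq(2))
  moreover have "y t = y a + integral {a..t} z" by (rule ac_primitive_eq[OF y t])
  ultimately show "y' t = y' a + integral {a..t} z'" by metis
qed

lemma ac_primitive_sum:
  assumes "finite I" "\<And>i. i \<in> I \<Longrightarrow> ac_primitive a b (z i) (y i)"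
  shows "ac_primitive a b (\<lambda>t. \<Sum>i\<in>I. z i t) (\<lambda>t. \<Sum>i\<in>I. y i t)"
  using assms
proof (induction I rule: finite_induct)
  case empty
  then show ?case by (auto simp: ac_primitive_def)
next
  case (insert i I)
  then show ?case by (simp add: ac_primitive_add)
qed

lemma bounded_linear_axis: "bounded_linear (axis i :: 'w::euclidean_space \<Rightarrow> 'w ^ 'r::finite)"
  by (rule linear_conv_bounded_linear[THEN iffD1], rule linearI) (auto simp: axis_def vec_eq_iff)

lemma vec_eq_sum_axis: "(u :: 'w::euclidean_space ^ 'r::finite) = (\<Sum>i\<in>UNIV. axis i (u $ i))"
  by (simp add: vec_eq_iff axis_def if_distrib[of "\<lambda>x. x $ _"] sum.delta)

lemma ac_primitive_vec:
  fixes z u :: "real \<Rightarrow> 'w::euclidean_space ^ 'r::finite"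
  assumes "\<And>i. ac_primitive a b (\<lambda>t. z t $ i) (\<lambda>t. u t $ i)"
  shows "ac_primitive a b z u"
proof -
  have "ac_primitive a b (\<lambda>t. \<Sum>i\<in>UNIV. axis i (z t $ i)) (\<lambda>t. \<Sum>i\<in>UNIV. axis i (u t $ i))"
    by (intro ac_primitive_sum ac_primitive_linear[OF bounded_linear_axis assms]) auto
  then show ?thesis by (simp flip: vec_eq_sum_axis)
qed

lemma borel_measurable_vec:
  fixes f :: "'a \<Rightarrow> 'w::euclidean_space ^ 'r::finite"
  assumes "\<And>i. (\<lambda>t. f t $ i) \<in> borel_measurable M"
  shows "f \<in> borel_measurable M"
proof -
  have ax: "(axis i :: 'w \<Rightarrow> 'w ^ 'r) \<in> borel_measurable borel" for i
    by (rule borel_measurable_continuous_onI) (rule linear_continuous_on[OF bounded_linear_axis])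
  have "(\<lambda>t. \<Sum>i\<in>UNIV. axis i (f t $ i)) \<in> borel_measurable M"
    by (intro borel_measurable_sum measurable_compose[OF assms ax])
  then show ?thesis by (simp flip: vec_eq_sum_axis)
qed

lemma norm_vec_le_sum: "norm (u :: 'w::euclidean_space ^ 'r::finite) \<le> (\<Sum>i\<in>UNIV. norm (u $ i))"
  unfolding norm_vec_def by (rule L2_set_le_sum) auto

context lp_interval
begin

text \<open>The differential operator with an arbitrary product \<open>mul\<close> of coefficients and values, since the
  equation is needed for vectors and, for the fundamental matrices \<open>Y\<^sub>k\<close>, for matrices.\<close>

definition ode_op :: "('c \<Rightarrow> 'w \<Rightarrow> 'w::euclidean_space) \<Rightarrow> nat \<Rightarrow> (nat \<Rightarrow> real \<Rightarrow> 'c) \<Rightarrow> (real \<Rightarrow> 'w) \<Rightarrow> real \<Rightarrow> 'w" where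
  "ode_op mul r A y = (\<lambda>t. DD r y t + (\<Sum>j = 1..r. mul (A (r - j) t) (DD (r - j) y t)))"

text \<open>Linear maps that commute with the coefficients commute with the operator. They may change the type
  of the values, so that taking a column turns a matrix solution into a vector solution.\<close>

lemma ode_op_linear_comb:
  fixes y1 :: "real \<Rightarrow> 'u::euclidean_space" and y2 :: "real \<Rightarrow> 'v::euclidean_space"
    and T1 :: "'u \<Rightarrow> 'w::euclidean_space" and T2 :: "'v \<Rightarrow> 'w"
    and mul :: "'c \<Rightarrow> 'w \<Rightarrow> 'w"
  assumes T: "bounded_linear T1" "bounded_linear T2"
    and y: "y1 \<in> W (n + r) a b" "y2 \<in> W (n + r) a b"
    and c: "\<And>c x. mul c (T1 x) = T1 (mul1 c x)" "\<And>c x. mul c (T2 x) = T2 (mul2 c x)"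
      "\<And>c x x'. mul c (x + x') = mul c x + mul c x'"
  shows "AE t in \<mu>. ode_op mul r A (\<lambda>t. T1 (y1 t) + T2 (y2 t)) t = T1 (ode_op mul1 r A y1 t) + T2 (ode_op mul2 r A y2 t)"
  using nth_deriv_linear_comb_AE[OF T y, of r, OF le_add2]
proof eventually_elim
  case (elim t)
  have "DD (r - j) (\<lambda>t. T1 (y1 t) + T2 (y2 t)) t = T1 (DD (r - j) y1 t) + T2 (DD (r - j) y2 t)" if "j \<in> {1..r}" for j
    using nth_deriv_linear_comb[OF T y, of "r - j"] that by auto
  then show ?case
    using elim by (simp add: ode_op_def c sum.distrib linear_add[OF bounded_linear.linear[OF T(1)]]
        linear_add[OF bounded_linear.linear[OF T(2)]] linear_sum[OF bounded_linear.linear[OF T(1)]]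
        linear_sum[OF bounded_linear.linear[OF T(2)]])
qed

end

text \<open>The enumeration \<open>blk\<close> makes \<open>'r\<close> an index type for the \<open>r\<close> derivatives of orders
  \<open>0, \<dots>, r - 1\<close>: component \<open>\<rho>\<close> of the state \<open>'w ^ 'r\<close> is the derivative of order \<open>blk \<rho> - 1\<close>.\<close>

locale linear_ode = lp_interval a b p for a b :: real and p :: ennreal +
  fixes mul :: "'c::euclidean_space \<Rightarrow> 'w::euclidean_space \<Rightarrow> 'w" and A :: "nat \<Rightarrow> real \<Rightarrow> 'c"
    and n r :: nat and blk :: "'r::finite \<Rightarrow> nat"
  assumes bl: "bounded_bilinear mul" and r: "1 \<le> r" and A: "\<And>j. j < r \<Longrightarrow> A j \<in> W n a b"
    and blk: "bij_betw blk UNIV {1..r}"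
begin

sublocale mul: bounded_bilinear mul by (fact bl)

abbreviation "L \<equiv> ode_op mul r A"

text \<open>The derivatives that meet a coefficient have order below \<open>r\<close>, hence lie in \<open>W (Suc n)\<close>, which is
  the surplus that \<open>sobolev_fun_bilinear\<close> asks for.\<close>

lemma ode_op_mem:
  assumes y: "y \<in> W (n + r) a b" shows "L y \<in> W n a b"
proof -
  have "(\<lambda>t. mul (A (r - j) t) (DD (r - j) y t)) \<in> W n a b" if j: "j \<in> {1..r}" for j
  proof (rule sobolev_fun_bilinear[OF bl])
    show "A (r - j) \<in> W n a b" using j by (intro A) auto
    have "y \<in> W (Suc n + (r - j)) a b" by (rule sobolev_fun_antimono[OF _ y]) (use j in auto)
    then show "DD (r - j) y \<in> W (Suc n) a b" by (rule sobolev_fun_nth_deriv)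
  qed
  then show ?thesis
    unfolding ode_op_def by (intro sobolev_fun_add sobolev_fun_sum sobolev_fun_nth_deriv y)
qed

definition "idx = inv_into UNIV blk"

lemma blk_range: "1 \<le> blk \<rho>" "blk \<rho> \<le> r"
  using bij_betw_apply[OF blk, of \<rho>] by auto

lemma blk_idx: "k \<in> {1..r} \<Longrightarrow> blk (idx k) = k"
  using blk unfolding idx_def by (intro f_inv_into_f) (auto simp: bij_betw_def)

lemma idx_blk: "idx (blk \<rho>) = \<rho>"
  using blk unfolding idx_def by (intro inv_into_f_f) (auto simp: bij_betw_def)

text \<open>The right-hand side of the homogeneous first-order system: each component but the last is mapped
  to the next one, the last to minus the lower-order terms of the equation.\<close>

definition sys :: "real \<Rightarrow> 'w ^ 'r \<Rightarrow> 'w ^ 'r" where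
  "sys t u = (\<chi> \<rho>. if blk \<rho> < r then u $ idx (Suc (blk \<rho>))
     else - (\<Sum>j = 1..r. mul (A (r - j) t) (u $ idx (Suc (r - j)))))"

definition mul_bound :: real where
  "mul_bound = (SOME K. 0 < K \<and> (\<forall>x y. norm (mul x y) \<le> norm x * norm y * K))"

definition sys_bound :: "real \<Rightarrow> real" where
  "sys_bound t = real CARD('r) * (1 + (\<Sum>j = 1..r. norm (A (r - j) t) * mul_bound))"

sublocale sys: volterra a b sys sys_bound
proof (rule volterra.intro)
  show "a < b" by (rule a_less_b)
  show "linear (sys t)" for t
  proof (rule linearI)
    show "sys t (u + v) = sys t u + sys t v" for u v
      by (simp add: sys_def vec_eq_iff mul.add_right sum.distrib)
    show "sys t (c *\<^sub>R u) = c *\<^sub>R sys t u" for c u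
      by (simp add: sys_def vec_eq_iff mul.scaleR_right scaleR_sum_right)
  qed
  have "0 < mul_bound \<and> (\<forall>x y. norm (mul x y) \<le> norm x * norm y * mul_bound)"
    unfolding mul_bound_def by (rule someI_ex) (rule mul.pos_bounded)
  then have K: "mul_bound > 0" "\<And>x y. norm (mul x y) \<le> norm x * norm y * mul_bound" by auto
  show "norm (sys t u) \<le> sys_bound t * norm u" for t u
  proof -
    have S0: "0 \<le> (\<Sum>j = 1..r. norm (A (r - j) t) * mul_bound)" using K by (intro sum_nonneg) simp
    have "norm (sys t u $ \<rho>) \<le> (1 + (\<Sum>j = 1..r. norm (A (r - j) t) * mul_bound)) * norm u" for \<rho>
    proof (cases "blk \<rho> < r")
      case True
      then have "norm (sys t u $ \<rho>) \<le> norm u" by (simp add: sys_def Finite_Cartesian_Product.norm_nth_le)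
      also have "\<dots> \<le> (1 + (\<Sum>j = 1..r. norm (A (r - j) t) * mul_bound)) * norm u"
        using mult_nonneg_nonneg[OF S0 norm_ge_zero[of u]] by (simp add: distrib_right)
      finally show ?thesis .
    next
      case False
      then have "norm (sys t u $ \<rho>) \<le> (\<Sum>j = 1..r. norm (mul (A (r - j) t) (u $ idx (Suc (r - j)))))"
        by (simp add: sys_def norm_sum)
      also have "\<dots> \<le> (\<Sum>j = 1..r. (norm (A (r - j) t) * mul_bound) * norm u)"
      proof (rule sum_mono)
        fix j
        have "norm (mul (A (r - j) t) (u $ idx (Suc (r - j)))) \<le> norm (A (r - j) t) * norm (u $ idx (Suc (r - j))) * mul_bound"
          by (rule K)
        also have "\<dots> \<le> norm (A (r - j) t) * norm u * mul_bound"
          using K by (intro mult_right_mono mult_left_mono Finite_Cartesian_Product.norm_nth_le) auto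
        finally show "norm (mul (A (r - j) t) (u $ idx (Suc (r - j)))) \<le> (norm (A (r - j) t) * mul_bound) * norm u"
          by (simp add: mult_ac)
      qed
      also have "\<dots> \<le> (1 + (\<Sum>j = 1..r. norm (A (r - j) t) * mul_bound)) * norm u"
        by (simp add: distrib_right sum_distrib_right)
      finally show ?thesis .
    qed
    then have "(\<Sum>\<rho>\<in>UNIV. norm (sys t u $ \<rho>)) \<le> (\<Sum>\<rho>\<in>(UNIV::'r set). (1 + (\<Sum>j = 1..r. norm (A (r - j) t) * mul_bound)) * norm u)"
      by (intro sum_mono)
    then show ?thesis
      using norm_vec_le_sum[of "sys t u"] by (simp add: sys_bound_def mult.assoc)
  qed
  have mA: "A (r - j) \<in> borel_measurable \<mu>" and iA: "integrable \<mu> (A (r - j))" if "j \<in> {1..r}" for j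
    using A[of "r - j"] that r by (auto intro!: Lp_fun_measurable Lp_fun_integrable sobolev_fun_Lp_fun)
  show "(\<lambda>t. sys t v) \<in> borel_measurable \<mu>" for v
  proof (rule borel_measurable_vec)
    fix \<rho>
    have "(\<lambda>t. mul (A (r - j) t) w) \<in> borel_measurable \<mu>" if "j \<in> {1..r}" for j w
      by (intro measurable_compose[OF mA[OF that]] borel_measurable_continuous_onI linear_continuous_on mul.bounded_linear_left)
    then show "(\<lambda>t. sys t v $ \<rho>) \<in> borel_measurable \<mu>"
      by (cases "blk \<rho> < r") (auto simp: sys_def intro!: borel_measurable_uminus borel_measurable_sum)
  qed
  have "integrable \<mu> (\<lambda>t. 1::real)" using continuous_on_integrable_lebesgue_on[of a b "\<lambda>t. 1::real"] by simp
  then show "integrable \<mu> sys_bound"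
    unfolding sys_bound_def using iA
    by (intro integrable_mult_right Bochner_Integration.integrable_add Bochner_Integration.integrable_sum integrable_mult_left integrable_norm)
qed

theorem cauchy_problem_unique:
  assumes y: "y \<in> W (n + r) a b" and Ly: "AE t in \<mu>. L y t = 0"
    and init: "\<And>\<rho>. DD (blk \<rho> - 1) y a = 0"
  shows "y = (\<lambda>t. 0)"
proof
  define u :: "real \<Rightarrow> 'w ^ 'r" where "u t = (\<chi> \<rho>. DD (blk \<rho> - 1) y t)" for t
  have ui: "u t $ idx k = DD (k - 1) y t" if "k \<in> {1..r}" for k t
    using that by (simp add: u_def blk_idx)
  have u: "ac_primitive a b (\<lambda>t. sys t (u t)) u"
  proof (rule ac_primitive_vec)
    fix \<rho>
    let ?k = "blk \<rho> - 1"
    have k: "Suc ?k = blk \<rho>" using blk_range(1)[of \<rho>] by simp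
    have "y \<in> W (Suc (n + r - blk \<rho>) + ?k) a b" using y blk_range[of \<rho>] by simp
    then have "ac_primitive a b (D (DD ?k y)) (DD ?k y)"
      by (intro sobolev_fun_primitive sobolev_fun_nth_deriv)
    then have prim: "ac_primitive a b (DD (blk \<rho>) y) (\<lambda>t. u t $ \<rho>)"
      using k nth_deriv_Suc_outer[of ?k y] by (simp add: u_def)
    have ae: "AE t in \<mu>. DD (blk \<rho>) y t = sys t (u t) $ \<rho>"
    proof (cases "blk \<rho> < r")
      case True
      then show ?thesis by (simp add: sys_def ui)
    next
      case False
      then have br: "blk \<rho> = r" using blk_range(2)[of \<rho>] by simp
      show ?thesis
        using Ly
      proof eventually_elim
        case (elim t)
        have "(\<Sum>j = 1..r. mul (A (r - j) t) (u t $ idx (Suc (r - j)))) = (\<Sum>j = 1..r. mul (A (r - j) t) (DD (r - j) y t))"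
          by (rule sum.cong) (auto simp: ui)
        then show ?case using elim br by (simp add: sys_def ode_op_def eq_neg_iff_add_eq_0)
      qed
    qed
    show "ac_primitive a b (\<lambda>t. sys t (u t) $ \<rho>) (\<lambda>t. u t $ \<rho>)"
    proof (rule ac_primitive_cong_AE[OF prim _ ae])
      show "(\<lambda>t. sys t (u t) $ \<rho>) \<in> borel_measurable \<mu>"
        by (rule borel_measurable_lebesgue_on_AE[OF borel_measurable_integrable[OF ac_primitive_integrable[OF prim]] ae])
    qed
  qed
  have ua: "u a = 0" using init by (simp add: u_def vec_eq_iff)
  fix t
  show "y t = 0"
  proof (cases "t \<in> {a..b}")
    case True
    have "u t $ idx 1 = 0" using sys.homogeneous_zero[OF u ua True] by simp
    then show ?thesis using ui[of 1 t] r by simp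
  next
    case False
    then show ?thesis by (rule sobolev_fun_outside[OF y])
  qed
qed

corollary cauchy_problem_unique_solution:
  assumes y: "y1 \<in> W (n + r) a b" "y2 \<in> W (n + r) a b" and L: "AE t in \<mu>. L y1 t = L y2 t"
    and init: "\<And>\<rho>. DD (blk \<rho> - 1) y1 a = DD (blk \<rho> - 1) y2 a"
  shows "y1 = y2"
proof -
  note T = bounded_linear_ident bounded_linear_minus[OF bounded_linear_ident]
  have "(\<lambda>t. y1 t + - y2 t) = (\<lambda>t. 0)"
  proof (rule cauchy_problem_unique)
    show "(\<lambda>t. y1 t + - y2 t) \<in> W (n + r) a b" by (rule sobolev_fun_linear_comb_mem[OF T y])
    have "AE t in \<mu>. L (\<lambda>t. y1 t + - y2 t) t = L y1 t + - L y2 t"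
      by (rule ode_op_linear_comb[OF T y]) (simp_all add: mul.minus_right mul.add_right)
    then show "AE t in \<mu>. L (\<lambda>t. y1 t + - y2 t) t = 0" using L by eventually_elim simp
    show "DD (blk \<rho> - 1) (\<lambda>t. y1 t + - y2 t) a = 0" for \<rho>
      using nth_deriv_linear_comb[OF T y, of "blk \<rho> - 1"] blk_range[of \<rho>] init[of \<rho>] by simp
  qed
  then show ?thesis by (auto simp: fun_eq_iff add_eq_0_iff2)
qed

text \<open>Solve the first-order system and let \<open>v 1\<close> be its first component, cut off outside the interval.
  The components are successive primitives, so that \<open>v 1\<close> is in \<open>W r\<close> and solves the equation; then
  the order of smoothness is raised from \<open>r\<close> to \<open>n + r\<close> one step at a time.\<close>

theorem cauchy_problem_exists:
  assumes g: "g \<in> W n a b"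
  obtains y where "y \<in> W (n + r) a b" "AE t in \<mu>. L y t = g t" "\<And>\<rho>. DD (blk \<rho> - 1) y a = c $ \<rho>"
proof -
  have gi: "integrable \<mu> g" by (rule Lp_fun_integrable[OF sobolev_fun_Lp_fun[OF g]])
  have "integrable \<mu> (\<lambda>t. axis (idx r) (g t))" by (rule integrable_bounded_linear[OF bounded_linear_axis gi])
  then obtain u where u: "ac_primitive a b (\<lambda>t. sys t (u t) + axis (idx r) (g t)) u" "u a = c"
    using sys.solution_exists by blast
  define v where "v k t = (if t \<in> {a..b} then u t $ idx k else 0)" for k t
  define h where "h t = g t - (\<Sum>j = 1..r. mul (A (r - j) t) (v (Suc (r - j)) t))" for t
  have v0: "v k t = 0" if "t \<notin> {a..b}" for k t using that by (auto simp: v_def)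
  have comp: "ac_primitive a b (\<lambda>t. (sys t (u t) + axis (idx r) (g t)) $ \<rho>) (\<lambda>t. u t $ \<rho>)" for \<rho>
    by (rule ac_primitive_linear[OF bounded_linear_vec_nth u(1)])
  have idx_r: "idx k = idx r \<longleftrightarrow> k = r" if "k \<in> {1..r}" for k
    using blk_idx[OF that] blk_idx[of r] r by (metis atLeastAtMost_iff order_refl)
  have vk: "ac_primitive a b (v (Suc k)) (v k)" if "k \<in> {1..<r}" for k
  proof (rule ac_primitive_cong[OF comp[of "idx k"]])
    fix t assume "t \<in> {a..b}"
    then show "v (Suc k) t = (sys t (u t) + axis (idx r) (g t)) $ idx k" "v k t = u t $ idx k"
      using that blk_idx[of k] idx_r[of k] by (auto simp: v_def sys_def axis_def)
  qed
  have vr: "ac_primitive a b h (v r)"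
  proof (rule ac_primitive_cong[OF comp[of "idx r"]])
    fix t assume "t \<in> {a..b}"
    then show "h t = (sys t (u t) + axis (idx r) (g t)) $ idx r" "v r t = u t $ idx r"
      using blk_idx[of r] r by (auto simp: v_def h_def sys_def axis_def)
  qed
  have cv: "continuous_on {a..b} (v k)" if "k \<in> {1..r}" for k
    using ac_primitive_continuous_on[OF vr] ac_primitive_continuous_on[OF vk, of k] that by (cases "k = r") auto
  have h_mem: "h \<in> W s a b" if "g \<in> W s a b" "\<And>j. j \<in> {1..r} \<Longrightarrow> (\<lambda>t. mul (A (r - j) t) (v (Suc (r - j)) t)) \<in> W s a b" for s
  proof -
    have "(\<lambda>t. g t + - (\<Sum>j = 1..r. mul (A (r - j) t) (v (Suc (r - j)) t))) \<in> W s a b"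
      by (intro sobolev_fun_add that(1) sobolev_fun_linear_mem[OF bounded_linear_minus[OF bounded_linear_ident]] sobolev_fun_sum that(2))
    then show ?thesis by (simp add: h_def[abs_def])
  qed
  have h0: "h \<in> W 0 a b"
  proof (rule h_mem)
    show "g \<in> W 0 a b" by (rule sobolev_fun_antimono[OF _ g]) simp
    fix j assume j: "j \<in> {1..r}"
    have "A (r - j) \<in> W 0 a b" using sobolev_fun_antimono[OF _ A[of "r - j"], of 0] j by simp
    moreover have "continuous_on {a..b} (v (Suc (r - j)))" using j by (intro cv) auto
    ultimately show "(\<lambda>t. mul (A (r - j) t) (v (Suc (r - j)) t)) \<in> W 0 a b"
      using Lp_fun_bilinear[OF bl] mul.zero_left by (auto simp: sobolev_fun_0_iff)
  qed
  have vS: "v (r - i) \<in> W (Suc i) a b" if "i < r" for i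
    using that
  proof (induction i)
    case 0
    show ?case using primitive_sobolev_fun(1)[OF h0 vr v0] by simp
  next
    case (Suc i)
    have eq: "Suc (r - Suc i) = r - i" using Suc.prems by simp
    have "ac_primitive a b (v (r - i)) (v (r - Suc i))" using vk[of "r - Suc i"] Suc.prems eq by simp
    then show ?case using primitive_sobolev_fun(1)[OF Suc.IH _ v0] Suc.prems by simp
  qed
  have Dv: "D (v k) = v (Suc k)" if k: "k \<in> {1..<r}" for k
  proof -
    have eq: "r - (r - Suc k) = Suc k" using k by simp
    have "v (Suc k) \<in> W (Suc (r - Suc k)) a b" using vS[of "r - Suc k"] k by (simp only: eq) auto
    then show ?thesis using primitive_sobolev_fun(3)[OF _ vk[OF k] v0] by simp
  qed
  have DDv: "DD k (v 1) = v (Suc k)" if "k < r" for k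
    using that
  proof (induction k)
    case (Suc k)
    then show ?case using Dv[of "Suc k"] by (simp add: nth_deriv_Suc_outer)
  qed simp
  let ?y = "v 1"
  obtain r' where r': "r = Suc r'" using r by (cases r) auto
  have DDr: "AE t in \<mu>. DD r ?y t = h t"
    using primitive_sobolev_fun(2)[OF h0 vr v0] DDv[of r'] r' by (simp add: nth_deriv_Suc_outer)
  have y0: "?y \<in> W (r + 0) a b" using vS[of r'] r' by simp
  have "?y \<in> W (r + k) a b" if "k \<le> n" for k
    using that
  proof (induction k)
    case 0
    show ?case by (rule y0)
  next
    case (Suc k)
    then have yk: "?y \<in> W (r + k) a b" by simp
    \<comment> \<open>All derivatives in \<open>h\<close> have order below \<open>r\<close>, so \<open>h\<close> is smoother by one than membership in \<open>W (r + k)\<close> says of the derivative of order \<open>r\<close>.\<close>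
    have "h \<in> W (Suc k) a b"
    proof (rule h_mem)
      show "g \<in> W (Suc k) a b" by (rule sobolev_fun_antimono[OF Suc.prems g])
      fix j assume j: "j \<in> {1..r}"
      have Aj: "A (r - j) \<in> W (Suc k) a b"
        by (rule sobolev_fun_antimono[OF Suc.prems]) (use j in \<open>auto intro: A\<close>)
      have "?y \<in> W (Suc k + (r - j)) a b" by (rule sobolev_fun_antimono[OF _ yk]) (use j in auto)
      then have "DD (r - j) ?y \<in> W (Suc k) a b" by (rule sobolev_fun_nth_deriv)
      moreover have "DD (r - j) ?y = v (Suc (r - j))" using j by (intro DDv) auto
      ultimately show "(\<lambda>t. mul (A (r - j) t) (v (Suc (r - j)) t)) \<in> W (Suc k) a b"
        using sobolev_fun_algebra[OF bl Aj] by simp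
    qed
    then show ?case
      using sobolev_fun_of_nth_deriv[of ?y r' h "Suc k"] y0 DDr r' by simp
  qed
  then have "?y \<in> W (n + r) a b" by (simp add: add.commute)
  moreover have "AE t in \<mu>. L ?y t = g t"
    using DDr
  proof eventually_elim
    case (elim t)
    have "(\<Sum>j = 1..r. mul (A (r - j) t) (DD (r - j) ?y t)) = (\<Sum>j = 1..r. mul (A (r - j) t) (v (Suc (r - j)) t))"
    proof (rule sum.cong[OF refl])
      fix j assume "j \<in> {1..r}"
      then have "DD (r - j) ?y = v (Suc (r - j))" by (intro DDv) auto
      then show "mul (A (r - j) t) (DD (r - j) ?y t) = mul (A (r - j) t) (v (Suc (r - j)) t)" by simp
    qed
    then show ?case using elim by (simp add: ode_op_def h_def)
  qed
  moreover have "DD (blk \<rho> - 1) ?y a = c $ \<rho>" for \<rho>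
  proof -
    have "DD (blk \<rho> - 1) ?y = v (blk \<rho>)" using DDv[of "blk \<rho> - 1"] blk_range[of \<rho>] by simp
    then show ?thesis using u(2) a_less_b by (simp add: v_def idx_blk)
  qed
  ultimately show thesis by (rule that)
qed

end

section \<open>Kernels, cokernels and dimensions\<close>

text \<open>Linearly independent subsets of the subspace are independent in the whole space and so have bounded
  size; a maximal one is a basis.\<close>

lemma (in vectorspace) subspace_fin_dim:
  assumes U: "subspace K U V" and fd: fin_dim
  shows "vectorspace.fin_dim K (vs U)"
proof -
  interpret U: vectorspace K "vs U" by (rule subspace_is_vs[OF U])
  have UV: "U \<subseteq> carrier V" using U by (auto simp: subspace_def submodule_def)
  have small: "finite S \<and> card S \<le> dim" if S: "S \<subseteq> carrier (vs U) \<and> U.lin_indpt S" for S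
  proof -
    have SU: "S \<subseteq> U" and li: "U.lin_indpt S" using S by simp_all
    have "U.lin_dep S = lin_dep S" by (rule span_li_not_depend(2)[OF SU is_module[OF U]])
    then have "lin_indpt S" using li by blast
    then show ?thesis using li_le_dim[OF fd, of S] SU UV by blast
  qed
  have "\<exists>S. finite S \<and> maximal S (\<lambda>S. S \<subseteq> carrier (vs U) \<and> U.lin_indpt S)"
  proof (rule maximal_exists[where N=dim and B="{}"])
    show "{} \<subseteq> carrier (vs U) \<and> U.lin_indpt {}" by (auto simp: U.lin_dep_def)
  qed (rule small)
  then obtain S where "finite S" "maximal S (\<lambda>S. S \<subseteq> carrier (vs U) \<and> U.lin_indpt S)" by blast
  then have "U.basis S" "finite S" using U.max_li_is_basis by blast+
  then show ?thesis unfolding U.fin_dim_def U.basis_def by blast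
qed

lemma linear_mapI:
  assumes "vectorspace K V" "vectorspace K W"
    and "\<And>x. x \<in> carrier V \<Longrightarrow> T x \<in> carrier W"
    and "\<And>x y. x \<in> carrier V \<Longrightarrow> y \<in> carrier V \<Longrightarrow> T (x \<oplus>\<^bsub>V\<^esub> y) = T x \<oplus>\<^bsub>W\<^esub> T y"
    and "\<And>c x. c \<in> carrier K \<Longrightarrow> x \<in> carrier V \<Longrightarrow> T (c \<odot>\<^bsub>V\<^esub> x) = c \<odot>\<^bsub>W\<^esub> T x"
  shows "linear_map K V W T"
proof -
  have "mod_hom K V W T"
    using assms by (auto simp: module_hom_def mod_hom_def mod_hom_axioms_def vectorspace_def)
  then show ?thesis using assms(1,2) by (simp add: linear_map_def)
qed

context vectorspace
begin

lemma submodule_abelian_subgroup: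
  assumes U: "submodule K U V"
  shows "abelian_subgroup U V"
proof (rule abelian_subgroupI3)
  interpret U: submodule K U V by (rule U)
  show "additive_subgroup U V"
  proof (rule additive_subgroup.intro, rule subgroup.intro)
    fix x assume "x \<in> U"
    moreover have "\<ominus>\<^bsub>K\<^esub> \<one>\<^bsub>K\<^esub> \<in> carrier K" by simp
    ultimately have "(\<ominus>\<^bsub>K\<^esub> \<one>\<^bsub>K\<^esub>) \<odot>\<^bsub>V\<^esub> x \<in> U" by (rule U.smult_closed[rotated])
    moreover have "x \<in> carrier V" using \<open>x \<in> U\<close> U.subset by blast
    ultimately have "\<ominus>\<^bsub>V\<^esub> x \<in> U" using smult_minus_1[of x] by simp
    then show "inv\<^bsub>add_monoid V\<^esub> x \<in> U" by (simp add: a_inv_def)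
  qed (use U.subset in auto)
  show "abelian_group V" by (rule abelian_group_axioms)
qed

end

text \<open>Every statement about \<open>quotient_space\<close> is transported along the map \<open>x \<mapsto> U +> x\<close>, which is onto
  and compatible with the operations.\<close>

locale vector_quotient = vectorspace K V for K :: "('k, 'e) ring_scheme" and V :: "('k, 'v) module" +
  fixes U :: "'v set"
  assumes U: "submodule K U V"
begin

interpretation U: submodule K U V by (rule U)
interpretation U: abelian_subgroup U V by (rule submodule_abelian_subgroup[OF U])

lemma quotient_space_simps:
  shows carrier_quotient_space: "carrier (quotient_space V U) = (\<lambda>x. U +>\<^bsub>V\<^esub> x) ` carrier V"
    and zero_quotient_space: "\<zero>\<^bsub>quotient_space V U\<^esub> = U +>\<^bsub>V\<^esub> \<zero>\<^bsub>V\<^esub>"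
    and add_quotient_space: "x \<in> carrier V \<Longrightarrow> y \<in> carrier V \<Longrightarrow>
      (U +>\<^bsub>V\<^esub> x) \<oplus>\<^bsub>quotient_space V U\<^esub> (U +>\<^bsub>V\<^esub> y) = U +>\<^bsub>V\<^esub> (x \<oplus>\<^bsub>V\<^esub> y)"
proof -
  show "carrier (quotient_space V U) = (\<lambda>x. U +>\<^bsub>V\<^esub> x) ` carrier V"
    by (auto simp: quotient_space_def A_RCOSETS_def')
  show "\<zero>\<^bsub>quotient_space V U\<^esub> = U +>\<^bsub>V\<^esub> \<zero>\<^bsub>V\<^esub>"
    using U.subset by (simp add: quotient_space_def)
  show "x \<in> carrier V \<Longrightarrow> y \<in> carrier V \<Longrightarrow>
      (U +>\<^bsub>V\<^esub> x) \<oplus>\<^bsub>quotient_space V U\<^esub> (U +>\<^bsub>V\<^esub> y) = U +>\<^bsub>V\<^esub> (x \<oplus>\<^bsub>V\<^esub> y)"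
    by (simp add: quotient_space_def U.a_rcos_sum)
qed

lemma coset_eq_iff:
  assumes "x \<in> carrier V" "y \<in> carrier V"
  shows "U +>\<^bsub>V\<^esub> x = U +>\<^bsub>V\<^esub> y \<longleftrightarrow> (\<exists>u\<in>U. y = u \<oplus>\<^bsub>V\<^esub> x)"
proof
  assume "U +>\<^bsub>V\<^esub> x = U +>\<^bsub>V\<^esub> y"
  then have "y \<in> U +>\<^bsub>V\<^esub> x" using U.a_rcos_self[OF assms(2)] by simp
  then show "\<exists>u\<in>U. y = u \<oplus>\<^bsub>V\<^esub> x" by (auto simp: a_r_coset_def')
next
  assume "\<exists>u\<in>U. y = u \<oplus>\<^bsub>V\<^esub> x"
  then have "y \<in> U +>\<^bsub>V\<^esub> x" by (auto simp: a_r_coset_def')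
  then show "U +>\<^bsub>V\<^esub> x = U +>\<^bsub>V\<^esub> y" using assms(1) by (rule a_repr_independence[OF _ _ U.a_subgroup])
qed

lemma smult_quotient_space:
  assumes c: "c \<in> carrier K" and x: "x \<in> carrier V"
  shows "c \<odot>\<^bsub>quotient_space V U\<^esub> (U +>\<^bsub>V\<^esub> x) = U +>\<^bsub>V\<^esub> (c \<odot>\<^bsub>V\<^esub> x)"
proof -
  have "U +>\<^bsub>V\<^esub> (c \<odot>\<^bsub>V\<^esub> y) = U +>\<^bsub>V\<^esub> (c \<odot>\<^bsub>V\<^esub> x)" if y: "y \<in> U +>\<^bsub>V\<^esub> x" for y
  proof -
    obtain u where u: "u \<in> U" "y = u \<oplus>\<^bsub>V\<^esub> x" using y by (auto simp: a_r_coset_def')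
    then have uV: "u \<in> carrier V" using U.subset by blast
    have "c \<odot>\<^bsub>V\<^esub> y = c \<odot>\<^bsub>V\<^esub> u \<oplus>\<^bsub>V\<^esub> c \<odot>\<^bsub>V\<^esub> x" using u uV c x by (simp add: smult_r_distr)
    then show ?thesis
      using coset_eq_iff[of "c \<odot>\<^bsub>V\<^esub> x" "c \<odot>\<^bsub>V\<^esub> y"] c x u uV by auto
  qed
  then have "(\<Union>y\<in>U +>\<^bsub>V\<^esub> x. U +>\<^bsub>V\<^esub> (c \<odot>\<^bsub>V\<^esub> y)) = (\<Union>y\<in>U +>\<^bsub>V\<^esub> x. U +>\<^bsub>V\<^esub> (c \<odot>\<^bsub>V\<^esub> x))" by simp
  also have "\<dots> = U +>\<^bsub>V\<^esub> (c \<odot>\<^bsub>V\<^esub> x)" using U.a_rcos_self[OF x] by blast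
  finally show ?thesis by (simp add: quotient_space_def)
qed

lemma quotient_space_vectorspace: "vectorspace K (quotient_space V U)"
proof (rule vs_criteria)
  let ?Q = "quotient_space V U" and ?c = "\<lambda>x. U +>\<^bsub>V\<^esub> x"
  note simps = carrier_quotient_space zero_quotient_space add_quotient_space smult_quotient_space
  show "field K" by (rule field_axioms)
  show "\<zero>\<^bsub>?Q\<^esub> \<in> carrier ?Q" by (simp add: simps)
  show "\<forall>v w. v \<in> carrier ?Q \<and> w \<in> carrier ?Q \<longrightarrow> v \<oplus>\<^bsub>?Q\<^esub> w \<in> carrier ?Q"
    by (auto simp: simps)
  show "\<forall>v\<in>carrier ?Q. \<exists>w\<in>carrier ?Q. v \<oplus>\<^bsub>?Q\<^esub> w = \<zero>\<^bsub>?Q\<^esub>"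
  proof
    fix v assume "v \<in> carrier ?Q"
    then obtain x where x: "x \<in> carrier V" "v = ?c x" by (auto simp: simps)
    have "v \<oplus>\<^bsub>?Q\<^esub> ?c (\<ominus>\<^bsub>V\<^esub> x) = \<zero>\<^bsub>?Q\<^esub>" using x by (simp add: simps r_neg)
    moreover have "?c (\<ominus>\<^bsub>V\<^esub> x) \<in> carrier ?Q" using x by (simp add: simps)
    ultimately show "\<exists>w\<in>carrier ?Q. v \<oplus>\<^bsub>?Q\<^esub> w = \<zero>\<^bsub>?Q\<^esub>" by blast
  qed
  show "\<forall>c v. c \<in> carrier K \<and> v \<in> carrier ?Q \<longrightarrow> c \<odot>\<^bsub>?Q\<^esub> v \<in> carrier ?Q"
    by (auto simp: simps)
  show "\<forall>v w. v \<in> carrier ?Q \<and> w \<in> carrier ?Q \<longrightarrow> v \<oplus>\<^bsub>?Q\<^esub> w = w \<oplus>\<^bsub>?Q\<^esub> v"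
    by (auto simp: simps a_comm)
  show "\<forall>v w x. v \<in> carrier ?Q \<and> w \<in> carrier ?Q \<and> x \<in> carrier ?Q \<longrightarrow>
      v \<oplus>\<^bsub>?Q\<^esub> w \<oplus>\<^bsub>?Q\<^esub> x = v \<oplus>\<^bsub>?Q\<^esub> (w \<oplus>\<^bsub>?Q\<^esub> x)"
    by (auto simp: simps a_assoc)
  show "\<forall>v\<in>carrier ?Q. v \<oplus>\<^bsub>?Q\<^esub> \<zero>\<^bsub>?Q\<^esub> = v" by (auto simp: simps)
  show "\<forall>c d v. c \<in> carrier K \<and> d \<in> carrier K \<and> v \<in> carrier ?Q \<longrightarrow>
      (c \<otimes>\<^bsub>K\<^esub> d) \<odot>\<^bsub>?Q\<^esub> v = c \<odot>\<^bsub>?Q\<^esub> (d \<odot>\<^bsub>?Q\<^esub> v)"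
    by (auto simp: simps smult_assoc1)
  show "\<forall>v\<in>carrier ?Q. \<one>\<^bsub>K\<^esub> \<odot>\<^bsub>?Q\<^esub> v = v" by (auto simp: simps)
  show "\<forall>c d v. c \<in> carrier K \<and> d \<in> carrier K \<and> v \<in> carrier ?Q \<longrightarrow>
      (c \<oplus>\<^bsub>K\<^esub> d) \<odot>\<^bsub>?Q\<^esub> v = c \<odot>\<^bsub>?Q\<^esub> v \<oplus>\<^bsub>?Q\<^esub> d \<odot>\<^bsub>?Q\<^esub> v"
    by (auto simp: simps smult_l_distr)
  show "\<forall>c v w. c \<in> carrier K \<and> v \<in> carrier ?Q \<and> w \<in> carrier ?Q \<longrightarrow>
      c \<odot>\<^bsub>?Q\<^esub> (v \<oplus>\<^bsub>?Q\<^esub> w) = c \<odot>\<^bsub>?Q\<^esub> v \<oplus>\<^bsub>?Q\<^esub> c \<odot>\<^bsub>?Q\<^esub> w"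
    by (auto simp: simps smult_r_distr)
qed

lemma quotient_map_linear: "linear_map K V (quotient_space V U) (\<lambda>x. U +>\<^bsub>V\<^esub> x)"
  by (rule linear_mapI[OF vectorspace_axioms quotient_space_vectorspace])
    (auto simp: carrier_quotient_space add_quotient_space smult_quotient_space)

lemma coset_eq_zero_iff:
  assumes x: "x \<in> carrier V"
  shows "U +>\<^bsub>V\<^esub> x = \<zero>\<^bsub>quotient_space V U\<^esub> \<longleftrightarrow> x \<in> U"
  using coset_eq_iff[OF zero_closed x] x U.subset by (auto simp: zero_quotient_space)

end

text \<open>Two linear maps from \<open>W\<close> onto their targets with the same kernel, namely the range of \<open>T\<close>, have
  targets of equal dimension by rank and nullity. This avoids a map between quotients.\<close>

lemma dim_cokernel_space:
  fixes V :: "('k, 'v) module" and W :: "('k, 'w) module" and Q :: "('k, 'q) module"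
  assumes T: "linear_map K V W T" and fd: "vectorspace.fin_dim K W"
    and P: "linear_map K W Q P" and surj: "P ` carrier W = carrier Q"
    and ker: "\<And>w. w \<in> carrier W \<Longrightarrow> P w = \<zero>\<^bsub>Q\<^esub> \<longleftrightarrow> w \<in> T ` carrier V"
  shows "vectorspace.fin_dim K Q" "vectorspace.dim K Q = vectorspace.dim K (cokernel_space V W T)"
proof -
  interpret T: linear_map K V W T by (rule T)
  interpret P: linear_map K W Q P by (rule P)
  interpret VQ: vector_quotient K W "mod_hom.im V T" 
    by (rule vector_quotient.intro[OF T.W.vectorspace_axioms vector_quotient_axioms.intro[OF T.im_is_submodule]])
  interpret R: linear_map K W "cokernel_space V W T" "\<lambda>x. mod_hom.im V T +>\<^bsub>W\<^esub> x"
    unfolding cokernel_space_def by (rule VQ.quotient_map_linear)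
  show "vectorspace.fin_dim K Q" by (rule P.surj_fin_dim[OF fd surj])
  have imV: "w \<in> carrier W" if "w \<in> T ` carrier V" for w using that T.T_im by blast
  have "mod_hom.ker W Q P = mod_hom.im V T"
    using ker imV by (auto simp: P.ker_def T.im_def)
  moreover have "mod_hom.ker W (cokernel_space V W T) (\<lambda>x. mod_hom.im V T +>\<^bsub>W\<^esub> x) = mod_hom.im V T"
    using VQ.coset_eq_zero_iff imV unfolding R.ker_def by (auto simp: cokernel_space_def T.im_def)
  moreover have "mod_hom.im W P = carrier Q" using surj by (simp add: P.im_def)
  moreover have "mod_hom.im W (\<lambda>x. mod_hom.im V T +>\<^bsub>W\<^esub> x) = carrier (cokernel_space V W T)"
    using VQ.carrier_quotient_space by (simp add: R.im_def cokernel_space_def)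
  ultimately show "vectorspace.dim K Q = vectorspace.dim K (cokernel_space V W T)"
    using P.rank_nullity[OF fd] R.rank_nullity[OF fd] by simp
qed

text \<open>The algebraic core. Here \<open>S\<close> parametrizes the solutions of \<open>\<Lambda> x = 0\<close>, and \<open>N = B \<circ> S\<close> plays the role
  of the characteristic matrix.\<close>

theorem kernel_cokernel_of_pair:
  fixes X :: "('k, 'x) module" and Z :: "('k, 'z) module" and W :: "('k, 'w) module" and C :: "('k, 'c) module"
  assumes \<Lambda>: "linear_map K X Z \<Lambda>" and surj: "\<Lambda> ` carrier X = carrier Z"
    and B: "linear_map K X W B" and S: "linear_map K C X S"
    and inj: "inj_on S (carrier C)" and sol: "S ` carrier C = {x \<in> carrier X. \<Lambda> x = \<zero>\<^bsub>Z\<^esub>}"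
    and N: "linear_map K C W N" "\<And>c. c \<in> carrier C \<Longrightarrow> N c = B (S c)"
    and fd: "vectorspace.fin_dim K C" "vectorspace.fin_dim K W"
  defines "Y \<equiv> direct_sum Z W" and "T \<equiv> (\<lambda>x. (\<Lambda> x, B x))"
  shows "vectorspace.fin_dim K (kernel_space X Y T)"
    and "vectorspace.fin_dim K (cokernel_space X Y T)"
    and "vectorspace.dim K (kernel_space X Y T) = vectorspace.dim K (kernel_space C W N)"
    and "vectorspace.dim K (cokernel_space X Y T) = vectorspace.dim K (cokernel_space C W N)"
proof -
  interpret \<Lambda>: linear_map K X Z \<Lambda> by (rule \<Lambda>)
  interpret B: linear_map K X W B by (rule B)
  interpret S: linear_map K C X S by (rule S)
  interpret N: linear_map K C W N by (rule N(1))
  have Yvs: "vectorspace K Y"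
    unfolding Y_def by (rule direct_sum_is_vs) (rule \<Lambda>.W.vectorspace_axioms B.W.vectorspace_axioms)+
  have Y: "carrier Y = carrier Z \<times> carrier W" "\<zero>\<^bsub>Y\<^esub> = (\<zero>\<^bsub>Z\<^esub>, \<zero>\<^bsub>W\<^esub>)"
    "\<And>v w. v \<oplus>\<^bsub>Y\<^esub> w = (fst v \<oplus>\<^bsub>Z\<^esub> fst w, snd v \<oplus>\<^bsub>W\<^esub> snd w)"
    "\<And>c v. c \<odot>\<^bsub>Y\<^esub> v = (c \<odot>\<^bsub>Z\<^esub> fst v, c \<odot>\<^bsub>W\<^esub> snd v)"
    by (simp_all add: Y_def direct_sum_def)
  have Tx: "T x = (\<Lambda> x, B x)" for x by (simp add: T_def)
  have Tlin: "linear_map K X Y T"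
    by (rule linear_mapI[OF \<Lambda>.V.vectorspace_axioms Yvs]) (auto simp: Y Tx)
  interpret T: linear_map K X Y T by (rule Tlin)
  have kT: "mod_hom.ker X Y T = {x \<in> carrier X. \<Lambda> x = \<zero>\<^bsub>Z\<^esub> \<and> B x = \<zero>\<^bsub>W\<^esub>}"
    by (auto simp: T.ker_def Y Tx)
  have kN: "mod_hom.ker C W N = {c \<in> carrier C. B (S c) = \<zero>\<^bsub>W\<^esub>}"
    using N(2) by (auto simp: N.ker_def)
  have kTvs: "vectorspace K (kernel_space X Y T)"
    unfolding kernel_space_def by (rule \<Lambda>.V.subspace_is_vs[OF T.kerT_is_subspace])
  have kNvs: "vectorspace K (kernel_space C W N)"
    unfolding kernel_space_def by (rule S.V.subspace_is_vs[OF N.kerT_is_subspace])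
  have kNfd: "vectorspace.fin_dim K (kernel_space C W N)"
    unfolding kernel_space_def by (rule S.V.subspace_fin_dim[OF N.kerT_is_subspace fd(1)])
  have Sker: "linear_map K (kernel_space C W N) (kernel_space X Y T) S"
  proof (rule linear_mapI[OF kNvs kTvs])
    fix c assume "c \<in> carrier (kernel_space C W N)"
    then show "S c \<in> carrier (kernel_space X Y T)"
      using sol by (auto simp: kernel_space_def kT kN)
  qed (auto simp: kernel_space_def kN)
  interpret Sk: linear_map K "kernel_space C W N" "kernel_space X Y T" S by (rule Sker)
  have Sk_inj: "inj_on S (carrier (kernel_space C W N))"
    by (rule inj_on_subset[OF inj]) (auto simp: kernel_space_def kN)
  have Sk_surj: "S ` carrier (kernel_space C W N) = carrier (kernel_space X Y T)"
  proof -
    have "x \<in> S ` carrier (kernel_space C W N)" if "x \<in> carrier (kernel_space X Y T)" for x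
    proof -
      have x: "x \<in> carrier X" "\<Lambda> x = \<zero>\<^bsub>Z\<^esub>" "B x = \<zero>\<^bsub>W\<^esub>" using that by (auto simp: kernel_space_def kT)
      then obtain c where "c \<in> carrier C" "x = S c" using sol by blast
      then show ?thesis using x by (auto simp: kernel_space_def kN)
    qed
    then show ?thesis using Sk.T_im by blast
  qed
  show "vectorspace.fin_dim K (kernel_space X Y T)"
    by (rule Sk.surj_fin_dim[OF kNfd Sk_surj])
  show "vectorspace.dim K (kernel_space X Y T) = vectorspace.dim K (kernel_space C W N)"
    by (rule Sk.dim_eq[OF kNfd Sk_inj Sk_surj, symmetric])
  interpret VQ: vector_quotient K Y "mod_hom.im X T" 
    by (rule vector_quotient.intro[OF T.W.vectorspace_axioms vector_quotient_axioms.intro[OF T.im_is_submodule]])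
  interpret Q: linear_map K Y "cokernel_space X Y T" "\<lambda>y. mod_hom.im X T +>\<^bsub>Y\<^esub> y"
    unfolding cokernel_space_def by (rule VQ.quotient_map_linear)
  \<comment> \<open>The map \<open>w \<mapsto> (0,w)\<close> into the cokernel is onto because \<open>\<Lambda>\<close> is, and its kernel is the range of \<open>N\<close>.\<close>
  define P where "P w = mod_hom.im X T +>\<^bsub>Y\<^esub> (\<zero>\<^bsub>Z\<^esub>, w)" for w
  have in2: "(\<zero>\<^bsub>Z\<^esub>, w) \<in> carrier Y" if "w \<in> carrier W" for w using that by (simp add: Y)
  have P: "linear_map K W (cokernel_space X Y T) P"
  proof (rule linear_mapI[OF B.W.vectorspace_axioms Q.W.vectorspace_axioms])
    show "P w \<in> carrier (cokernel_space X Y T)" if "w \<in> carrier W" for w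
      unfolding P_def by (rule Q.T_im[OF in2[OF that]])
    show "P (v \<oplus>\<^bsub>W\<^esub> w) = P v \<oplus>\<^bsub>cokernel_space X Y T\<^esub> P w" if "v \<in> carrier W" "w \<in> carrier W" for v w
      using Q.T_add[OF in2[OF that(1)] in2[OF that(2)]] by (simp add: P_def Y)
    show "P (c \<odot>\<^bsub>W\<^esub> w) = c \<odot>\<^bsub>cokernel_space X Y T\<^esub> P w" if "c \<in> carrier K" "w \<in> carrier W" for c w
      using Q.T_smult[OF that(1) in2[OF that(2)]] that(1) by (simp add: P_def Y)
  qed
  have Psurj: "P ` carrier W = carrier (cokernel_space X Y T)"
  proof -
    have "q \<in> P ` carrier W" if "q \<in> carrier (cokernel_space X Y T)" for q
    proof -
      have "q \<in> (\<lambda>y. mod_hom.im X T +>\<^bsub>Y\<^esub> y) ` (carrier Z \<times> carrier W)"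
        using that VQ.carrier_quotient_space Y(1) by (simp add: cokernel_space_def)
      then obtain z w where zw: "z \<in> carrier Z" "w \<in> carrier W" "q = mod_hom.im X T +>\<^bsub>Y\<^esub> (z, w)"
        by blast
      have "z \<in> \<Lambda> ` carrier X" using zw(1) unfolding surj .
      then obtain x where x: "x \<in> carrier X" "\<Lambda> x = z" by (elim imageE) simp
      have Bx: "B x \<in> carrier W" using x by simp
      have "B x \<oplus>\<^bsub>W\<^esub> (w \<ominus>\<^bsub>W\<^esub> B x) = w"
        using Bx zw(2) B.W.module.M.r_neg2[OF Bx zw(2)] B.W.module.M.a_comm[of w "\<ominus>\<^bsub>W\<^esub> B x"]
        by (simp add: a_minus_def)
      then have "(z, w) = T x \<oplus>\<^bsub>Y\<^esub> (\<zero>\<^bsub>Z\<^esub>, w \<ominus>\<^bsub>W\<^esub> B x)"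
        using x zw by (simp add: Y Tx)
      moreover have "T x \<in> mod_hom.im X T" using x by (simp add: T.im_def)
      moreover have w': "w \<ominus>\<^bsub>W\<^esub> B x \<in> carrier W" using x zw by simp
      ultimately have "q = P (w \<ominus>\<^bsub>W\<^esub> B x)"
        unfolding zw(3) P_def using zw
        by (subst eq_commute, subst VQ.coset_eq_iff[OF in2[OF w']]) (auto simp: Y)
      then show ?thesis using w' by blast
    qed
    then show ?thesis using linear_map.T_im[OF P] by blast
  qed
  have Pker: "P w = \<zero>\<^bsub>cokernel_space X Y T\<^esub> \<longleftrightarrow> w \<in> N ` carrier C" if w: "w \<in> carrier W" for w
  proof -
    have "P w = \<zero>\<^bsub>cokernel_space X Y T\<^esub> \<longleftrightarrow> (\<zero>\<^bsub>Z\<^esub>, w) \<in> mod_hom.im X T"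
      unfolding P_def cokernel_space_def by (rule VQ.coset_eq_zero_iff[OF in2[OF w]])
    also have "\<dots> \<longleftrightarrow> (\<exists>x\<in>carrier X. \<Lambda> x = \<zero>\<^bsub>Z\<^esub> \<and> w = B x)"
      unfolding T.im_def image_iff Tx prod.inject by metis
    also have "\<dots> \<longleftrightarrow> (\<exists>x\<in>S ` carrier C. w = B x)" unfolding sol by blast
    also have "\<dots> \<longleftrightarrow> w \<in> N ` carrier C" using N(2) by (auto simp: image_iff)
    finally show ?thesis .
  qed
  show "vectorspace.fin_dim K (cokernel_space X Y T)"
    "vectorspace.dim K (cokernel_space X Y T) = vectorspace.dim K (cokernel_space C W N)"
    using dim_cokernel_space[OF N(1) fd(2) P Psurj Pker] by blast+
qed

lemma coord_space_simps [simp]: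
  "carrier (coord_space :: (complex, complex ^ 'k) module) = UNIV"
  "\<zero>\<^bsub>coord_space\<^esub> = (0 :: complex ^ 'k)"
  "x \<oplus>\<^bsub>coord_space\<^esub> y = x + (y :: complex ^ 'k)"
  "c \<odot>\<^bsub>coord_space\<^esub> x = c *s (x :: complex ^ 'k)"
  by (simp_all add: coord_space_def)

lemma complex_field_simps [simp]:
  "carrier complex_field = UNIV" "\<one>\<^bsub>complex_field\<^esub> = 1" "\<zero>\<^bsub>complex_field\<^esub> = 0"
  "x \<otimes>\<^bsub>complex_field\<^esub> y = x * y" "x \<oplus>\<^bsub>complex_field\<^esub> y = x + y"
  by (simp_all add: complex_field_def)

lemma vectorspace_coord_space: "vectorspace complex_field (coord_space :: (complex, complex ^ 'k) module)"
proof (rule vs_criteria[OF field_complex_field])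
  show "\<forall>v\<in>carrier coord_space. \<exists>w\<in>carrier coord_space. v \<oplus>\<^bsub>coord_space\<^esub> w = \<zero>\<^bsub>(coord_space :: (complex, complex ^ 'k) module)\<^esub>"
    by (intro ballI bexI[of _ "- _"]) simp_all
qed (auto simp: vec_eq_iff algebra_simps)

lemma fin_dim_coord_space: "vectorspace.fin_dim complex_field (coord_space :: (complex, complex ^ 'k) module)"
proof -
  interpret vectorspace complex_field "coord_space :: (complex, complex ^ 'k) module"
    by (rule vectorspace_coord_space)
  let ?E = "range (\<lambda>i. axis i 1) :: (complex ^ 'k) set"
  have sub: "?E \<subseteq> carrier coord_space" by simp
  interpret E: submodule complex_field "span ?E" "coord_space :: (complex, complex ^ 'k) module"
    by (rule span_is_submodule[OF sub])
  have "(\<Sum>i\<in>I. (v $ i) *s axis i 1) \<in> span ?E" for v :: "complex ^ 'k" and I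
  proof (induction I rule: infinite_finite_induct)
    case (insert i I)
    have "axis i 1 \<in> span ?E" using in_own_span[OF sub] by blast
    then have "(v $ i) *s axis i 1 \<in> span ?E" using E.smult_closed[of "v $ i" "axis i 1"] by simp
    then show ?case using insert E.m_closed by simp
  qed (use E.zero_closed in auto)
  moreover have "(\<Sum>i\<in>UNIV. (v $ i) *s axis i 1) = v" for v :: "complex ^ 'k"
    by (simp add: vec_eq_iff axis_def if_distrib sum.delta cong: if_cong)
  ultimately have "v \<in> span ?E" for v :: "complex ^ 'k" by (metis (no_types))
  then show ?thesis unfolding fin_dim_def by (intro exI[of _ ?E]) auto
qed

section \<open>The boundary-value problem\<close>

lemma bounded_bilinear_matrix_vector_mult:
  "bounded_bilinear ((*v) :: complex ^ 'm ^ 'k \<Rightarrow> complex ^ 'm \<Rightarrow> complex ^ 'k)"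
  unfolding bilinear_conv_bounded_bilinear[symmetric] bilinear_def
  by (auto intro!: linearI
      simp: vec_eq_iff matrix_vector_mult_def sum.distrib algebra_simps scaleR_sum_right)

lemma bounded_bilinear_matrix_matrix_mult:
  "bounded_bilinear ((**) :: complex ^ 'm ^ 'k \<Rightarrow> complex ^ 'j ^ 'm \<Rightarrow> complex ^ 'j ^ 'k)"
  unfolding bilinear_conv_bounded_bilinear[symmetric] bilinear_def
  by (auto intro!: linearI
      simp: vec_eq_iff matrix_matrix_mult_def sum.distrib algebra_simps scaleR_sum_right)

lemma bounded_linear_vector_smult: "bounded_linear ((*s) c :: complex ^ 'm \<Rightarrow> complex ^ 'm)"
  unfolding linear_conv_bounded_linear[symmetric]
  by (rule linearI) (auto simp: vec_eq_iff algebra_simps)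

lemma bounded_linear_column: "bounded_linear (column j :: complex ^ 'm ^ 'k \<Rightarrow> complex ^ 'k)"
  unfolding linear_conv_bounded_linear[symmetric]
  by (rule linearI) (auto simp: vec_eq_iff column_def)

lemma column_matrix_mult: "column j (M ** N) = M *v column j (N :: complex ^ 'j ^ 'm)"
  by (simp add: vec_eq_iff column_def matrix_matrix_mult_def matrix_vector_mult_def)

lemma matrix_vector_smult: "M *v (c *s x) = c *s (M *v (x :: complex ^ 'm))"
  by (simp add: vec_eq_iff matrix_vector_mult_def sum_distrib_left algebra_simps)

lemma sobolev_fun_space_simps [simp]:
  "carrier (sobolev_fun_space p s a b :: (complex, real \<Rightarrow> complex ^ 'm) module) = sobolev_fun p s a b"
  "\<zero>\<^bsub>sobolev_fun_space p s a b\<^esub> = (\<lambda>t. 0 :: complex ^ 'm)"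
  "f \<oplus>\<^bsub>sobolev_fun_space p s a b\<^esub> g = (\<lambda>t. f t + g t :: complex ^ 'm)"
  "c \<odot>\<^bsub>sobolev_fun_space p s a b\<^esub> f = (\<lambda>t. c *s f t :: complex ^ 'm)"
  by (simp_all add: sobolev_fun_space_def)

context lp_interval
begin

lemma vectorspace_sobolev_fun_space:
  "vectorspace complex_field (sobolev_fun_space p s a b :: (complex, real \<Rightarrow> complex ^ 'm) module)"
proof (rule vs_criteria[OF field_complex_field])
  let ?V = "sobolev_fun_space p s a b :: (complex, real \<Rightarrow> complex ^ 'm) module"
  have smult: "(\<lambda>t. c *s y t) \<in> W s a b" if "y \<in> W s a b" for c and y :: "real \<Rightarrow> complex ^ 'm"
    by (rule sobolev_fun_linear_mem[OF bounded_linear_vector_smult that])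
  show "\<forall>v\<in>carrier ?V. \<exists>w\<in>carrier ?V. v \<oplus>\<^bsub>?V\<^esub> w = \<zero>\<^bsub>?V\<^esub>"
  proof
    fix v assume "v \<in> carrier ?V"
    then show "\<exists>w\<in>carrier ?V. v \<oplus>\<^bsub>?V\<^esub> w = \<zero>\<^bsub>?V\<^esub>"
      using smult[of v "-1"] by (intro bexI[of _ "\<lambda>t. (-1) *s v t"]) (simp_all add: vec_eq_iff)
  qed
  show "\<forall>c v. c \<in> carrier complex_field \<and> v \<in> carrier ?V \<longrightarrow> c \<odot>\<^bsub>?V\<^esub> v \<in> carrier ?V"
    using smult by simp
qed (auto simp: sobolev_fun_zero sobolev_fun_add vec_eq_iff algebra_simps)

lemma null_fun_submodule:
  "submodule complex_field (null_fun p s a b) (sobolev_fun_space p s a b :: (complex, real \<Rightarrow> complex ^ 'm) module)"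
proof (rule submodule.intro)
  interpret V: vectorspace complex_field "sobolev_fun_space p s a b :: (complex, real \<Rightarrow> complex ^ 'm) module"
    by (rule vectorspace_sobolev_fun_space)
  show "module complex_field (sobolev_fun_space p s a b :: (complex, real \<Rightarrow> complex ^ 'm) module)"
    by (rule V.module_axioms)
  show "v \<oplus>\<^bsub>sobolev_fun_space p s a b\<^esub> w \<in> null_fun p s a b"
    if "v \<in> null_fun p s a b" "w \<in> null_fun p s a b" for v w :: "real \<Rightarrow> complex ^ 'm"
  proof -
    have "AE t in \<mu>. v t = 0" "AE t in \<mu>. w t = 0" using that by (auto simp: null_fun_def)
    then have "AE t in \<mu>. v t + w t = 0" by eventually_elim simp
    then show ?thesis using that by (simp add: null_fun_def sobolev_fun_add)
  qed
  show "c \<odot>\<^bsub>sobolev_fun_space p s a b\<^esub> v \<in> null_fun p s a b"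
    if "v \<in> null_fun p s a b" for c and v :: "real \<Rightarrow> complex ^ 'm"
  proof -
    have "AE t in \<mu>. v t = 0" using that by (simp add: null_fun_def)
    then have "AE t in \<mu>. c *s v t = 0" by eventually_elim simp
    then show ?thesis
      using that sobolev_fun_linear_mem[OF bounded_linear_vector_smult, of v s c] by (simp add: null_fun_def)
  qed
qed (auto simp: null_fun_def sobolev_fun_zero)

end

text \<open>The coefficients are used with two products: \<open>vec\<close> is the equation for vectors, \<open>mat\<close> the equation
  for the matrices \<open>Y\<^sub>k\<close>.\<close>

locale boundary_value_problem = lp_interval a b p for a b :: real and p :: ennreal +
  fixes A :: "nat \<Rightarrow> real \<Rightarrow> complex ^ 'm ^ 'm" and n r :: nat and blk :: "'r::finite \<Rightarrow> nat"
  assumes r: "1 \<le> r" and A: "\<And>j. j < r \<Longrightarrow> A j \<in> W n a b" and blk: "bij_betw blk UNIV {1..r}"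
begin

sublocale vec: linear_ode a b p "(*v)" A n r blk
  by (rule linear_ode.intro[OF lp_interval_axioms linear_ode_axioms.intro[OF bounded_bilinear_matrix_vector_mult r A blk]])

sublocale mat: linear_ode a b p "(**)" A n r blk
  by (rule linear_ode.intro[OF lp_interval_axioms linear_ode_axioms.intro[OF bounded_bilinear_matrix_matrix_mult r A blk]])

abbreviation "X \<equiv> sobolev_fun_space p (n + r) a b :: (complex, real \<Rightarrow> complex ^ 'm) module"
abbreviation "V \<equiv> sobolev_fun_space p n a b :: (complex, real \<Rightarrow> complex ^ 'm) module"
abbreviation "Z \<equiv> sobolev_space p n a b :: (complex, (real \<Rightarrow> complex ^ 'm) set) module"
abbreviation "ae_class f \<equiv> null_fun p n a b +>\<^bsub>V\<^esub> f"
abbreviation "L_class y \<equiv> ae_class (diff_op r a b A y)"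

sublocale Vq: vector_quotient complex_field V "null_fun p n a b"
  by (rule vector_quotient.intro[OF vectorspace_sobolev_fun_space vector_quotient_axioms.intro[OF null_fun_submodule]])

lemma diff_op_eq: "diff_op r a b A y = vec.L y"
  by (simp add: diff_op_def ode_op_def)

lemma ae_class_eq:
  assumes f: "f \<in> W n a b" and g: "g \<in> W n a b" and ae: "AE t in \<mu>. f t = g t"
  shows "ae_class f = ae_class g"
proof -
  have "(\<lambda>t. g t + - f t) \<in> W n a b"
    by (rule sobolev_fun_linear_comb_mem[OF bounded_linear_ident bounded_linear_minus[OF bounded_linear_ident] g f])
  moreover have "AE t in \<mu>. g t + - f t = 0" using ae by eventually_elim simp
  ultimately have "(\<lambda>t. g t + - f t) \<in> null_fun p n a b" by (simp add: null_fun_def)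
  then show ?thesis
    using Vq.coset_eq_iff[of f g] f g by (auto intro!: bexI[of _ "\<lambda>t. g t + - f t"])
qed

lemma ae_class_eq_zero_iff:
  assumes "f \<in> W n a b" shows "ae_class f = \<zero>\<^bsub>Z\<^esub> \<longleftrightarrow> (AE t in \<mu>. f t = 0)"
  using Vq.coset_eq_zero_iff[of f] assms by (simp add: sobolev_space_def null_fun_def)

lemma vectorspace_Z: "vectorspace complex_field Z"
  unfolding sobolev_space_def by (rule Vq.quotient_space_vectorspace)

lemma carrier_Z: "carrier Z = ae_class ` W n a b"
  unfolding sobolev_space_def using Vq.carrier_quotient_space by simp

text \<open>For \<open>n = 0\<close> the function \<open>diff_op\<close> is additive only almost everywhere, because the derivative of
  order \<open>r\<close> is; passing to classes makes the operator linear.\<close>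

lemma L_class_linear: "linear_map complex_field X Z L_class"
proof (rule linear_mapI[OF vectorspace_sobolev_fun_space vectorspace_Z])
  show "L_class y \<in> carrier Z" if "y \<in> carrier X" for y
    using that vec.ode_op_mem by (simp add: carrier_Z diff_op_eq)
  show "L_class (y1 \<oplus>\<^bsub>X\<^esub> y2) = L_class y1 \<oplus>\<^bsub>Z\<^esub> L_class y2" if "y1 \<in> carrier X" "y2 \<in> carrier X" for y1 y2
  proof -
    have y: "y1 \<in> W (n + r) a b" "y2 \<in> W (n + r) a b" using that by simp_all
    have "L_class (y1 \<oplus>\<^bsub>X\<^esub> y2) = ae_class (\<lambda>t. vec.L y1 t + vec.L y2 t)"
      unfolding diff_op_eq sobolev_fun_space_simps
    proof (rule ae_class_eq)
      show "AE t in \<mu>. vec.L (\<lambda>t. y1 t + y2 t) t = vec.L y1 t + vec.L y2 t"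
        by (rule ode_op_linear_comb[OF bounded_linear_ident bounded_linear_ident y])
          (simp_all add: matrix_vector_right_distrib)
    qed (intro vec.ode_op_mem sobolev_fun_add y)+
    then show ?thesis
      using Vq.add_quotient_space[of "vec.L y1" "vec.L y2"] y vec.ode_op_mem
      by (simp add: sobolev_space_def diff_op_eq)
  qed
  show "L_class (c \<odot>\<^bsub>X\<^esub> y) = c \<odot>\<^bsub>Z\<^esub> L_class y" if "y \<in> carrier X" for c y
  proof -
    have y: "y \<in> W (n + r) a b" using that by simp
    have "L_class (c \<odot>\<^bsub>X\<^esub> y) = ae_class (\<lambda>t. c *s vec.L y t)"
      unfolding diff_op_eq sobolev_fun_space_simps
    proof (rule ae_class_eq)
      have "AE t in \<mu>. vec.L (\<lambda>t. c *s y t + 0) t = c *s vec.L y t + 0"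
        by (rule ode_op_linear_comb[OF bounded_linear_vector_smult bounded_linear_zero y y])
          (simp_all add: matrix_vector_right_distrib matrix_vector_smult)
      then show "AE t in \<mu>. vec.L (\<lambda>t. c *s y t) t = c *s vec.L y t" by simp
    qed (intro vec.ode_op_mem sobolev_fun_linear_mem[OF bounded_linear_vector_smult] y)+
    then show ?thesis
      using Vq.smult_quotient_space[of c "vec.L y"] y vec.ode_op_mem
      by (simp add: sobolev_space_def diff_op_eq)
  qed
qed

lemma L_class_surj: "L_class ` carrier X = carrier Z"
proof
  show "L_class ` carrier X \<subseteq> carrier Z"
    using vec.ode_op_mem by (auto simp: carrier_Z diff_op_eq)
  show "carrier Z \<subseteq> L_class ` carrier X"
  proof
    fix z assume "z \<in> carrier Z"
    then obtain g where g: "g \<in> W n a b" "z = ae_class g" by (auto simp: carrier_Z)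
    obtain y where y: "y \<in> W (n + r) a b" "AE t in \<mu>. vec.L y t = g t"
      using vec.cauchy_problem_exists[OF g(1)] by metis
    have "L_class y = z" unfolding g(2) diff_op_eq by (rule ae_class_eq[OF vec.ode_op_mem[OF y(1)] g(1) y(2)])
    then show "z \<in> L_class ` carrier X" using y(1) by auto
  qed
qed

abbreviation "Yk k \<equiv> cauchy_solution p n r a b A k"

text \<open>The definite description in the definition of \<open>Y\<^sub>k\<close> is meaningful because the matrix Cauchy problem
  is uniquely solvable.\<close>

lemma cauchy_solution:
  assumes k: "k \<in> {1..r}"
  shows "Yk k \<in> W (n + r) a b" and "AE t in \<mu>. mat.L (Yk k) t = 0"
    and "DD (blk \<rho> - 1) (Yk k) a = (if k = blk \<rho> then mat 1 else 0)"
proof -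
  let ?P = "\<lambda>Y. Y \<in> W (n + r) a b \<and> (AE t in \<mu>. mat.L Y t = 0) \<and>
     (\<forall>j\<in>{1..r}. DD (j - 1) Y a = (if k = j then mat 1 else 0))"
  have iff: "(\<forall>j\<in>{1..r}. Q j) \<longleftrightarrow> (\<forall>\<rho>. Q (blk \<rho>))" for Q
    using blk by (auto simp: bij_betw_def image_iff dest: bspec) (metis atLeastAtMost_iff image_iff)
  have "\<exists>!Y. ?P Y"
  proof (rule ex_ex1I)
    obtain Y where Y: "Y \<in> W (n + r) a b" "AE t in \<mu>. mat.L Y t = 0"
      "\<And>\<rho>. DD (blk \<rho> - 1) Y a = (\<chi> \<rho>. if k = blk \<rho> then mat 1 else 0) $ \<rho>"
      by (rule mat.cauchy_problem_exists[OF sobolev_fun_zero]) blast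
    then show "\<exists>Y. ?P Y" unfolding iff by (intro exI[of _ Y]) simp
  next
    fix Y Y' assume Y: "?P Y" "?P Y'"
    then have "AE t in \<mu>. mat.L Y t = 0" "AE t in \<mu>. mat.L Y' t = 0" by blast+
    then have "AE t in \<mu>. mat.L Y t = mat.L Y' t" by eventually_elim simp
    then show "Y = Y'" using Y unfolding iff by (intro mat.cauchy_problem_unique_solution) auto
  qed
  then have the: "?P (THE Y. ?P Y)" by (rule theI')
  have eq: "(THE Y. ?P Y) = Yk k" by (simp only: cauchy_solution_def ode_op_def)
  have "?P (Yk k)" using the unfolding eq .
  then show "Yk k \<in> W (n + r) a b" and "AE t in \<mu>. mat.L (Yk k) t = 0"
    and "DD (blk \<rho> - 1) (Yk k) a = (if k = blk \<rho> then mat 1 else 0)"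
    unfolding iff by auto
qed

text \<open>The columns of all \<open>Y\<^sub>k\<close>, indexed like the columns of the characteristic matrix. Their initial
  values are the unit vectors of the state space.\<close>

definition fundamental_solution :: "'r \<times> 'm \<Rightarrow> real \<Rightarrow> complex ^ 'm" where
  "fundamental_solution q = (\<lambda>t. column (snd q) (Yk (blk (fst q)) t))"

lemma fundamental_solution:
  shows fundamental_solution_mem: "fundamental_solution q \<in> W (n + r) a b" and fundamental_solution_solves: "AE t in \<mu>. vec.L (fundamental_solution q) t = 0"
    and fundamental_solution_init: "DD (blk \<rho> - 1) (fundamental_solution q) a = (if fst q = \<rho> then axis (snd q) 1 else 0)"
proof -
  have k: "blk (fst q) \<in> {1..r}" using vec.blk_range by simp
  note Y = cauchy_solution[OF k]
  have eq: "fundamental_solution q = (\<lambda>t. column (snd q) (Yk (blk (fst q)) t) + 0)" by (simp add: fundamental_solution_def)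
  show "fundamental_solution q \<in> W (n + r) a b"
    unfolding fundamental_solution_def by (rule sobolev_fun_linear_mem[OF bounded_linear_column Y(1)])
  have "AE t in \<mu>. vec.L (fundamental_solution q) t = column (snd q) (mat.L (Yk (blk (fst q))) t) + 0"
    unfolding eq
    by (rule ode_op_linear_comb[OF bounded_linear_column bounded_linear_zero Y(1) Y(1)])
      (simp_all add: column_matrix_mult matrix_vector_right_distrib)
  then show "AE t in \<mu>. vec.L (fundamental_solution q) t = 0"
    using Y(2) by eventually_elim (simp add: column_def vec_eq_iff)
  have "DD (blk \<rho> - 1) (fundamental_solution q) a = column (snd q) (DD (blk \<rho> - 1) (Yk (blk (fst q))) a)"
    using nth_deriv_linear[OF bounded_linear_column Y(1), of "blk \<rho> - 1" "snd q"] vec.blk_range[of \<rho>]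
    by (simp add: fundamental_solution_def)
  also have "\<dots> = (if fst q = \<rho> then axis (snd q) 1 else 0)"
    using Y(3)[of \<rho>] vec.idx_blk by (auto simp: column_def vec_eq_iff mat_def axis_def) metis+
  finally show "DD (blk \<rho> - 1) (fundamental_solution q) a = (if fst q = \<rho> then axis (snd q) 1 else 0)" .
qed

definition general_solution :: "complex ^ ('r \<times> 'm) \<Rightarrow> real \<Rightarrow> complex ^ 'm" where
  "general_solution c = (\<lambda>t. \<Sum>q\<in>UNIV. (c $ q) *s fundamental_solution q t)"

lemma fundamental_solution_sum:
  assumes "finite Q"
  shows "(\<lambda>t. \<Sum>q\<in>Q. (c $ q) *s fundamental_solution q t) \<in> W (n + r) a b \<and>
    (AE t in \<mu>. vec.L (\<lambda>t. \<Sum>q\<in>Q. (c $ q) *s fundamental_solution q t) t = 0) \<and>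
    DD (blk \<rho> - 1) (\<lambda>t. \<Sum>q\<in>Q. (c $ q) *s fundamental_solution q t) a = (\<Sum>q\<in>Q. (c $ q) *s DD (blk \<rho> - 1) (fundamental_solution q) a)"
  using assms
proof (induction Q)
  case empty
  have "AE t in \<mu>. vec.L (\<lambda>t. 0) t = 0"
    by (simp add: ode_op_def nth_deriv_zero)
  then show ?case by (simp add: sobolev_fun_zero nth_deriv_zero)
next
  case (insert q Q)
  let ?y = "\<lambda>t. \<Sum>q\<in>Q. (c $ q) *s fundamental_solution q t"
  note T = bounded_linear_vector_smult[of "c $ q"] bounded_linear_ident
  have y: "fundamental_solution q \<in> W (n + r) a b" "?y \<in> W (n + r) a b" using insert fundamental_solution_mem by auto
  have eq: "(\<lambda>t. \<Sum>q\<in>insert q Q. (c $ q) *s fundamental_solution q t) = (\<lambda>t. (c $ q) *s fundamental_solution q t + ?y t)"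
    using insert by simp
  have "AE t in \<mu>. vec.L (\<lambda>t. (c $ q) *s fundamental_solution q t + ?y t) t = (c $ q) *s vec.L (fundamental_solution q) t + vec.L ?y t"
    by (rule ode_op_linear_comb[OF T y]) (simp_all add: matrix_vector_right_distrib matrix_vector_smult)
  moreover have "AE t in \<mu>. vec.L ?y t = 0" using insert by simp
  ultimately have "AE t in \<mu>. vec.L (\<lambda>t. (c $ q) *s fundamental_solution q t + ?y t) t = 0"
    using fundamental_solution_solves[of q] by eventually_elim simp
  moreover have "DD (blk \<rho> - 1) (\<lambda>t. (c $ q) *s fundamental_solution q t + ?y t) a
      = (c $ q) *s DD (blk \<rho> - 1) (fundamental_solution q) a + DD (blk \<rho> - 1) ?y a"
    using nth_deriv_linear_comb[OF T y, of "blk \<rho> - 1"] vec.blk_range[of \<rho>] by simp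
  moreover have "(\<lambda>t. (c $ q) *s fundamental_solution q t + ?y t) \<in> W (n + r) a b"
    by (rule sobolev_fun_linear_comb_mem[OF T y])
  ultimately show ?case unfolding eq using insert by simp
qed

lemma general_solution_mem: "general_solution c \<in> W (n + r) a b" and general_solution_solves: "AE t in \<mu>. vec.L (general_solution c) t = 0"
  using fundamental_solution_sum[OF finite_class.finite_UNIV, of c undefined] by (auto simp: general_solution_def)

lemma general_solution_init: "DD (blk \<rho> - 1) (general_solution c) a = (\<chi> i. c $ (\<rho>, i))"
proof -
  have "DD (blk \<rho> - 1) (general_solution c) a = (\<Sum>q\<in>UNIV. (c $ q) *s (if fst q = \<rho> then axis (snd q) 1 else 0))"
    using fundamental_solution_sum[OF finite_class.finite_UNIV, of c \<rho>] fundamental_solution_init by (simp add: general_solution_def)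
  also have "\<dots> = (\<Sum>\<sigma>\<in>UNIV. \<Sum>i\<in>UNIV. (c $ (\<sigma>, i)) *s (if \<sigma> = \<rho> then axis i 1 else 0))"
    unfolding UNIV_Times_UNIV[symmetric] by (subst sum.cartesian_product) (simp add: split_def)
  also have "\<dots> = (\<Sum>i\<in>UNIV. (c $ (\<rho>, i)) *s axis i 1)"
    by (subst sum.remove[of UNIV \<rho>]) auto
  also have "\<dots> = (\<chi> i. c $ (\<rho>, i))"
    by (simp add: vec_eq_iff axis_def if_distrib sum.delta cong: if_cong)
  finally show ?thesis .
qed

lemma general_solution_linear: "linear_map complex_field (coord_space :: (complex, complex ^ ('r \<times> 'm)) module) X general_solution"
proof (rule linear_mapI[OF vectorspace_coord_space vectorspace_sobolev_fun_space])
qed (auto simp: general_solution_mem, auto simp: general_solution_def fun_eq_iff vec_eq_iff sum.distrib distrib_right sum_distrib_left mult.assoc)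

lemma inj_general_solution: "inj_on general_solution UNIV"
proof (rule injI)
  fix c c' assume "general_solution c = general_solution c'"
  then have "(\<chi> i. c $ (\<rho>, i)) = (\<chi> i. c' $ (\<rho>, i))" for \<rho> by (simp flip: general_solution_init)
  then show "c = c'" by (simp add: vec_eq_iff)
qed

text \<open>A solution of the homogeneous equation is determined by its initial values, which serve as the
  coefficients \<open>c\<close>.\<close>

lemma range_general_solution: "general_solution ` UNIV = {y \<in> carrier X. L_class y = \<zero>\<^bsub>Z\<^esub>}"
proof -
  have "y \<in> range general_solution" if y: "y \<in> W (n + r) a b" "AE t in \<mu>. vec.L y t = 0" for y
  proof -
    define c where "c = (\<chi> q. DD (blk (fst q) - 1) y a $ snd q)"
    have "y = general_solution c"
    proof (rule vec.cauchy_problem_unique_solution[OF y(1) general_solution_mem])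
      show "AE t in \<mu>. vec.L y t = vec.L (general_solution c) t" using y(2) general_solution_solves[of c] by eventually_elim simp
      show "DD (blk \<rho> - 1) y a = DD (blk \<rho> - 1) (general_solution c) a" for \<rho>
        unfolding general_solution_init by (simp add: c_def vec_eq_iff)
    qed
    then show ?thesis by blast
  qed
  moreover have "{y \<in> carrier X. L_class y = \<zero>\<^bsub>Z\<^esub>} = {y. y \<in> W (n + r) a b \<and> (AE t in \<mu>. vec.L y t = 0)}"
    by (rule Collect_cong) (simp add: ae_class_eq_zero_iff diff_op_eq vec.ode_op_mem cong: conj_cong)
  ultimately show ?thesis using general_solution_mem general_solution_solves by blast
qed

lemma char_matrix_mult:
  fixes B :: "(real \<Rightarrow> complex ^ 'm) \<Rightarrow> complex ^ 'l"
  assumes B: "linear_map complex_field X coord_space B"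
  shows "char_matrix blk p n r a b A B *v c = B (general_solution c)"
proof -
  interpret B: linear_map complex_field X coord_space B by (rule B)
  have "B (\<lambda>t. \<Sum>q\<in>Q. (c $ q) *s fundamental_solution q t) = (\<Sum>q\<in>Q. (c $ q) *s B (fundamental_solution q))" if "finite Q" for Q
    using that
  proof (induction Q)
    case empty
    show ?case using B.T0_is_0 by simp
  next
    case (insert q Q)
    have mem: "(\<lambda>t. (c $ q) *s fundamental_solution q t) \<in> W (n + r) a b" "(\<lambda>t. \<Sum>q\<in>Q. (c $ q) *s fundamental_solution q t) \<in> W (n + r) a b"
      using sobolev_fun_linear_mem[OF bounded_linear_vector_smult fundamental_solution_mem] fundamental_solution_sum[OF insert(1)] by auto
    have "B (\<lambda>t. (c $ q) *s fundamental_solution q t + (\<Sum>q\<in>Q. (c $ q) *s fundamental_solution q t)) = B (\<lambda>t. (c $ q) *s fundamental_solution q t) + B (\<lambda>t. \<Sum>q\<in>Q. (c $ q) *s fundamental_solution q t)"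
      using B.T_add[of "\<lambda>t. (c $ q) *s fundamental_solution q t" "\<lambda>t. \<Sum>q\<in>Q. (c $ q) *s fundamental_solution q t"] mem by simp
    moreover have "B (\<lambda>t. (c $ q) *s fundamental_solution q t) = (c $ q) *s B (fundamental_solution q)"
      using B.T_smult[of "c $ q" "fundamental_solution q"] fundamental_solution_mem by simp
    ultimately show ?case using insert by simp
  qed
  from this[OF finite_class.finite_UNIV] have "B (general_solution c) = (\<Sum>q\<in>UNIV. (c $ q) *s B (fundamental_solution q))" by (simp add: general_solution_def)
  then show ?thesis
    by (simp add: vec_eq_iff char_matrix_def matrix_vector_mult_def fundamental_solution_def mult.commute)
qed

end

theorem theorem2:
  fixes a b :: real and n r :: nat and p :: ennreal
    and A :: "nat \<Rightarrow> real \<Rightarrow> complex ^ 'm ^ 'm"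
    and B :: "(real \<Rightarrow> complex ^ 'm) \<Rightarrow> complex ^ 'l"
    and blk :: "'r::finite \<Rightarrow> nat"
  assumes "a < b" and "1 \<le> r" and "1 \<le> p"
    and "\<And>j. j < r \<Longrightarrow> A j \<in> sobolev_fun p n a b"
    and "B \<in> module_hom complex_field (sobolev_fun_space p (n + r) a b) coord_space"
    and "sobolev_continuous p (n + r) a b B"
    and "bij_betw blk UNIV {1..r}"
  defines "X \<equiv> sobolev_fun_space p (n + r) a b"
    and "Y \<equiv> direct_sum (sobolev_space p n a b) (coord_space :: (complex, complex ^ 'l) module)"
    and "LB \<equiv> bvp_op p n r a b A B"
    and "M \<equiv> char_matrix blk p n r a b A B"
  shows "vectorspace.fin_dim complex_field (kernel_space X Y LB)
    \<and> vectorspace.fin_dim complex_field (cokernel_space X Y LB)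
    \<and> vectorspace.dim complex_field (kernel_space X Y LB)
        = vectorspace.dim complex_field (kernel_space coord_space coord_space ((*v) M))
    \<and> vectorspace.dim complex_field (cokernel_space X Y LB)
        = vectorspace.dim complex_field (cokernel_space coord_space coord_space ((*v) M))"
proof -
  interpret boundary_value_problem a b p A n r blk
    by unfold_locales (fact assms)+
  have B: "linear_map complex_field (sobolev_fun_space p (n + r) a b) coord_space B"
    using module_hom_closed[OF assms(5)] module_hom_add[OF assms(5)] module_hom_smult[OF assms(5)]
    by (intro linear_mapI vectorspace_sobolev_fun_space vectorspace_coord_space) auto
  have M: "linear_map complex_field coord_space coord_space ((*v) M)"
    by (intro linear_mapI vectorspace_coord_space) (auto simp: matrix_vector_right_distrib matrix_vector_smult)
  have LB: "LB = (\<lambda>y. (L_class y, B y))" by (simp add: LB_def bvp_op_def fun_eq_iff)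
  have S: "inj_on general_solution (carrier coord_space)" "general_solution ` carrier coord_space = {y \<in> carrier X. L_class y = \<zero>\<^bsub>Z\<^esub>}"
    using inj_general_solution range_general_solution by (simp_all add: X_def)
  note main = kernel_cokernel_of_pair[OF L_class_linear L_class_surj, OF B, OF general_solution_linear,
      OF S[unfolded X_def], OF M char_matrix_mult[OF B, folded M_def], OF fin_dim_coord_space fin_dim_coord_space]
  show ?thesis
    unfolding X_def Y_def LB using main by blast
qed

end
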